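(* Let $p\in[0,3/4)$. For every fixed $b>0$, the convergence $$\lim_{n\to\infty}\frac{\sqrt{A_{n+k}-A_k}}{a_{k+1}}\,\mathbb{P}_k(R>n)=\sqrt{\frac{2}{\pi}}$$ holds uniformly in the even integers $k\ge 0$ with $k\le bn$ (and $k\ge 2$ when $p=0$). Here $R=\inf\{n\ge 1: S(n+k)=0\}$ under $\mathbb{P}_k$.
   Context: Elephant random walk with memory parameter $p$: let $X_1$ be uniform on $\{+1,-1\}$, and for $n\ge 1$ let $X_{n+1}=\varepsilon_n X_{u(n)}$, where $X_1,u(1),u(2),\ldots,\varepsilon_1,\varepsilon_2,\ldots$ are independent, $u(n)$ is uniform on $\{1,\ldots,n\}$ and $\mathbb{P}(\varepsilon_n=1)=p=1-\mathbb{P}(\varepsilon_n=-1)$. Then $S(0)=0$ and $S(n)=X_1+\cdots+X_n$. For every even integer $k\ge 0$, $\mathbb{P}_k$ is the conditional distribution of $(S(n))_{n\ge k}$ given $S(k)=0$. Factors: $a_0=0$ and $a_n=\Gamma(n)/\Gamma(n+2p-1)$ for $n\ge 1$ (with the convention $a_1=0$ if $p=0$), and $A_n=\sum_{j=1}^n a_j^2$. *)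

theory Defs
  imports "HOL-Probability.Probability"
begin

datatype erw_source = Init | Memory nat | Flip nat

text \<open>
  The independent inputs of the walk have different ranges; they are collected into one
  integer-valued family so that their joint independence is a single
  \<^const>\<open>prob_space.indep_vars\<close> statement. Embedding the natural numbers \<open>u n\<close> into the
  integers does not change the generated sigma-algebras.
\<close>

definition erw_sources ::
  "(nat \<Rightarrow> 'a \<Rightarrow> int) \<Rightarrow> (nat \<Rightarrow> 'a \<Rightarrow> nat) \<Rightarrow> (nat \<Rightarrow> 'a \<Rightarrow> int) \<Rightarrow> erw_source \<Rightarrow> 'a \<Rightarrow> int"
where
  "erw_sources X u \<epsilon> i \<omega> =
     (case i of Init \<Rightarrow> X 1 \<omega> | Memory n \<Rightarrow> int (u n \<omega>) | Flip n \<Rightarrow> \<epsilon> n \<omega>)"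

text \<open>Only the indices \<open>n \<ge> 1\<close> are meaningful; \<open>X 0\<close>, \<open>u 0\<close> and \<open>\<epsilon> 0\<close> are unconstrained.\<close>

locale elephant_random_walk = prob_space M
  for M :: "'a measure" +
  fixes p :: real
    and X :: "nat \<Rightarrow> 'a \<Rightarrow> int"
    and u :: "nat \<Rightarrow> 'a \<Rightarrow> nat"
    and \<epsilon> :: "nat \<Rightarrow> 'a \<Rightarrow> int"
  assumes steps_measurable: "\<And>n. n \<ge> 1 \<Longrightarrow> random_variable (count_space UNIV) (X n)"
    and sources_indep:
      "indep_vars (\<lambda>_. count_space UNIV) (erw_sources X u \<epsilon>)
         ({Init} \<union> Memory ` {1..} \<union> Flip ` {1..})"
    and first_step_uniform:
      "distr M (count_space UNIV) (X 1) = measure_pmf (pmf_of_set {1, -1})"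
    and memory_uniform:
      "\<And>n. n \<ge> 1 \<Longrightarrow> distr M (count_space UNIV) (u n) = measure_pmf (pmf_of_set {1..n})"
    and flip_pos: "\<And>n. n \<ge> 1 \<Longrightarrow> prob {\<omega> \<in> space M. \<epsilon> n \<omega> = 1} = p"
    and flip_neg: "\<And>n. n \<ge> 1 \<Longrightarrow> prob {\<omega> \<in> space M. \<epsilon> n \<omega> = -1} = 1 - p"
    and step_rec: "\<And>n \<omega>. n \<ge> 1 \<Longrightarrow> \<omega> \<in> space M \<Longrightarrow> X (n + 1) \<omega> = \<epsilon> n \<omega> * X (u n \<omega>) \<omega>"

definition erw_position :: "(nat \<Rightarrow> 'a \<Rightarrow> int) \<Rightarrow> nat \<Rightarrow> 'a \<Rightarrow> int" where
  "erw_position X n \<omega> = (\<Sum>i = 1..n. X i \<omega>)"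

text \<open>The conditional distribution of \<open>(S(n))\<^sub>n\<close>, \<open>n \<ge> k\<close>, given \<open>S(k) = 0\<close>, as a measure on paths
  indexed by the times \<open>n \<ge> k\<close>.\<close>

definition erw_cond_law :: "'a measure \<Rightarrow> (nat \<Rightarrow> 'a \<Rightarrow> int) \<Rightarrow> nat \<Rightarrow> (nat \<Rightarrow> int) measure" where
  "erw_cond_law M X k =
     distr (uniform_measure M {\<omega> \<in> space M. erw_position X k \<omega> = 0})
       (\<Pi>\<^sub>M n\<in>{k..}. count_space UNIV)
       (\<lambda>\<omega>. \<lambda>n\<in>{k..}. erw_position X n \<omega>)"

text \<open>The infimum is taken in \<^typ>\<open>enat\<close>, so it is \<open>\<infinity>\<close> for a path that never returns.\<close>

definition return_time :: "nat \<Rightarrow> (nat \<Rightarrow> int) \<Rightarrow> enat" where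
  "return_time k s = Inf (enat ` {n. n \<ge> 1 \<and> s (n + k) = 0})"

definition erw_a :: "real \<Rightarrow> nat \<Rightarrow> real" where
  "erw_a p n = (if n = 0 \<or> (n = 1 \<and> p = 0) then 0 else Gamma (real n) / Gamma (real n + 2 * p - 1))"

definition erw_A :: "real \<Rightarrow> nat \<Rightarrow> real" where
  "erw_A p n = (\<Sum>j = 1..n. (erw_a p j)\<^sup>2)"

end

theory Submission
  imports Defs "HOL-Real_Asymp.Real_Asymp"
begin

text \<open>
  Put \<open>q = 2 p - 1\<close>. Given its past, the walk at time \<open>m\<close> and position \<open>s\<close> moves up with probability
  \<open>(1 + q s / m) / 2\<close>, since \<open>s / m\<close> is the mean of the remembered steps. Hence \<open>S\<close> is a Markov chain,
  \<open>a m * S m\<close> is a martingale, and its quadratic variation is close to \<open>A m\<close>. In the time scale \<open>A\<close>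
  this martingale resembles Brownian motion, and Brownian motion started at \<open>x\<close> avoids \<open>0\<close> during a
  time \<open>B\<close> with probability about \<open>x * sqrt (2 / (pi * B))\<close>. With \<open>x = a (k + 1)\<close>, the size of the
  first excursion step, and \<open>B = A (n + k) - A k\<close> this is the claim.

  The proof replaces Brownian motion by solutions of the heat equation. The avoidance probability is
  \<open>surv q n k (\<lambda>_. 1) 0\<close>, where \<open>surv\<close> iterates the one-step transition with the value \<open>0\<close> imposed at
  the origin. Let \<open>N = k + n\<close>, let \<open>v = \<theta> * B\<close> be a small extra variance, and let \<open>V m = A N - A m + v\<close>.
  A function that solves the heat equation, evaluated at \<open>(V m, a m * s)\<close>, is almost preserved by one
  transition (Taylor expansion, \<open>heat_step_error\<close>). Two solutions are used: \<open>heat0\<close>, the Brownian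
  avoidance probability up to a constant factor, and \<open>heat1\<close>, the Gaussian density. The error of one
  step for \<open>heat0\<close> is proportional to the height \<open>a m * s\<close>. The height is exactly harmonic for the chain
  killed at \<open>0\<close>, so the accumulated error is the initial height \<open>a (k + 1)\<close> times \<open>1 / sqrt v\<close> times a
  sum \<open>\<Sum> rate v m\<close> that tends to \<open>0\<close> (\<open>surv_heat0\<close>, \<open>sum_rate_le\<close>). It is therefore negligible
  against the main term, which has the order \<open>a (k + 1) / sqrt B\<close>.

  Lower bound (\<open>noreturn_lower\<close>): the normalised \<open>heat0\<close> is at most \<open>1\<close>, so its expectation on the
  event of avoidance bounds the probability from below; then \<open>\<theta>\<close> tends to \<open>0\<close>.

  Upper bound (\<open>noreturn_upper\<close>): the normalised \<open>heat0\<close> is close to \<open>1\<close> unless the final height is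
  at most \<open>\<epsilon> * sqrt B\<close>. To be so low at time \<open>N\<close>, the walk must avoid \<open>0\<close> up to a time \<open>k + l\<close> at which
  about half of the variance \<open>B\<close> is spent, and then hit a window of relative size \<open>\<epsilon>\<close>, which costs a
  factor of order \<open>\<epsilon>\<close> by comparison with the Gaussian density. So the rescaled probability at time \<open>n\<close>
  is at most \<open>sqrt (2 / pi) + o(1)\<close> plus \<open>O(\<epsilon>)\<close> times its value at the earlier time \<open>l\<close>. With one fixed
  \<open>\<epsilon>\<close> this recursion shows that the rescaled probabilities are bounded, and then \<open>\<epsilon> \<rightarrow> 0\<close> gives the
  upper bound.

  All estimates are uniform in \<open>k\<close>. Besides the martingale recursion they use that \<open>a (m + 1)\<close> is at
  most a constant times \<open>a m\<close>, and that no single step matters: the largest \<open>(a j)\<^sup>2\<close> with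
  \<open>k < j \<le> k + n\<close> is \<open>o(B)\<close> as \<open>n \<rightarrow> \<infinity>\<close>, uniformly in \<open>k\<close> (\<open>erw_a_negligible\<close>).
  This follows from \<open>a n \<sim> n powr (- q)\<close> and \<open>2 * q < 1\<close>, which is where \<open>p < 3 / 4\<close> enters.
\<close>

section \<open>The Gaussian integral and solutions of the heat equation\<close>

definition gauss_int :: "real \<Rightarrow> real" where
  "gauss_int x = (LBINT t=0..x. exp (- (t\<^sup>2) / 2))"

lemma gauss_int_deriv: "(gauss_int has_real_derivative exp (- (x\<^sup>2) / 2)) (at x)"
proof -
  have "(at x within {min 0 (x - 1)..max 0 (x + 1)}) = at x"
    by (intro at_within_interior) auto
  moreover have "min 0 (x - 1) \<le> x" "x \<le> max 0 (x + 1)"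
    by auto
  moreover have "continuous_on A (\<lambda>t::real. exp (- (t\<^sup>2) / 2))" for A
    by (intro continuous_intros) auto
  ultimately show ?thesis
    using interval_integral_FTC2[of "min 0 (x - 1)" 0 "max 0 (x + 1)" "\<lambda>t. exp (- (t\<^sup>2) / 2)" x]
    by (auto simp: gauss_int_def[abs_def] zero_ereal_def
                   has_real_derivative_iff_has_vector_derivative
             split del: if_split)
qed

lemma gauss_int_0 [simp]: "gauss_int 0 = 0"
  by (simp add: gauss_int_def zero_ereal_def)

lemma gauss_int_mono: "x \<le> y \<Longrightarrow> gauss_int x \<le> gauss_int y"
  by (erule DERIV_nonneg_imp_nondecreasing, rule exI, rule conjI, rule gauss_int_deriv) simp

lemma gauss_int_le: assumes "0 \<le> x" shows "gauss_int x \<le> x"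
proof -
  have d: "((\<lambda>t. t - gauss_int t) has_real_derivative 1 - exp (- (t\<^sup>2) / 2)) (at t)" for t
    by (auto intro!: derivative_eq_intros gauss_int_deriv)
  have "(\<lambda>t. t - gauss_int t) 0 \<le> (\<lambda>t. t - gauss_int t) x"
    by (rule DERIV_nonneg_imp_nondecreasing[OF assms], rule exI, rule conjI, rule d) simp
  then show ?thesis by simp
qed

text \<open>
  Near \<open>0\<close> the integral is linear up to a relative error of second order. Together with
  \<open>gauss_int_le\<close> this identifies the avoidance probability from a low starting height.
\<close>

lemma gauss_int_ge: assumes "0 \<le> x" shows "x * (1 - x\<^sup>2 / 2) \<le> gauss_int x"
proof -
  have d: "((\<lambda>t. gauss_int t - t * (1 - x\<^sup>2/2)) has_real_derivative exp (- (t\<^sup>2) / 2) - (1 - x\<^sup>2/2)) (at t)" for t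
    by (auto intro!: derivative_eq_intros gauss_int_deriv)
  have "0 \<le> exp (- (t\<^sup>2) / 2) - (1 - x\<^sup>2/2)" if "0 \<le> t" "t \<le> x" for t
  proof -
    have "t\<^sup>2 \<le> x\<^sup>2" using that by (simp add: power_mono)
    moreover have "1 + (- (t\<^sup>2) / 2) \<le> exp (- (t\<^sup>2) / 2)" by (rule exp_ge_add_one_self)
    ultimately show ?thesis by simp
  qed
  then have "(\<lambda>t. gauss_int t - t * (1 - x\<^sup>2/2)) 0 \<le> (\<lambda>t. gauss_int t - t * (1 - x\<^sup>2/2)) x"
    by (intro DERIV_nonneg_imp_nondecreasing[OF assms]) (rule exI, rule conjI, rule d)
  then show ?thesis by simp
qed

text \<open>
  The value \<open>sqrt (pi / 2)\<close> of this integral is the source of the constant \<open>sqrt (2 / pi)\<close>.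
\<close>

lemma half_gaussian_integral:
  "has_bochner_integral lborel (\<lambda>x::real. indicator {0..} x * exp (- (x\<^sup>2) / 2)) (sqrt (pi / 2))"
proof -
  have "has_bochner_integral lborel (\<lambda>x::real. indicator {0..} x *\<^sub>R exp (- (x\<^sup>2))) (sqrt pi / 2)"
    using gaussian_moment_0 by simp
  moreover have "(\<lambda>x::real. indicator {0..} x *\<^sub>R exp (- (x\<^sup>2))) = 
     (\<lambda>x. indicator {0..} (0 + sqrt 2 * x) * exp (- ((0 + sqrt 2 * x)\<^sup>2) / 2))"
    by (auto simp: fun_eq_iff indicator_def power_mult_distrib zero_le_mult_iff)
  ultimately have "has_bochner_integral lborel (\<lambda>x::real. indicator {0..} x * exp (- (x\<^sup>2) / 2))
     (\<bar>sqrt 2\<bar> *\<^sub>R (sqrt pi / 2))"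
    by (subst lborel_has_bochner_integral_real_affine_iff[where c="sqrt 2" and t=0])
       (simp_all add: field_simps)
  moreover have "\<bar>sqrt 2\<bar> *\<^sub>R (sqrt pi / 2) = sqrt (pi / 2)"
    by (simp add: real_sqrt_divide field_simps)
  ultimately show ?thesis by simp
qed

lemma gauss_int_tendsto: "(gauss_int \<longlongrightarrow> sqrt (pi / 2)) at_top"
proof -
  let ?f = "\<lambda>x::real. indicator {0..} x * exp (- (x\<^sup>2) / 2)"
  have "((\<lambda>y. \<integral>x. indicator {..y} x *\<^sub>R ?f x \<partial>lborel) \<longlongrightarrow> (\<integral>x. ?f x \<partial>lborel)) at_top"
    by (rule tendsto_integral_at_top) (use integrable.intros[OF half_gaussian_integral] in auto)
  then have lim: "((\<lambda>y. \<integral>x. indicator {..y} x *\<^sub>R ?f x \<partial>lborel) \<longlongrightarrow> sqrt (pi / 2)) at_top"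
    unfolding has_bochner_integral_integral_eq[OF half_gaussian_integral] .
  have "\<forall>\<^sub>F y in at_top. (\<integral>x. indicator {..y} x *\<^sub>R ?f x \<partial>lborel) = gauss_int y"
    using eventually_ge_at_top[of 0]
  proof eventually_elim
    case (elim y)
    have "gauss_int y = (LBINT x=ereal 0..ereal y. exp (- (x\<^sup>2) / 2))"
      by (simp add: gauss_int_def zero_ereal_def)
    also have "\<dots> = (LBINT x:{0..y}. exp (- (x\<^sup>2) / 2))"
      using elim by (simp add: interval_integral_Icc)
    also have "\<dots> = (\<integral>x. indicator {..y} x *\<^sub>R ?f x \<partial>lborel)"
      unfolding set_lebesgue_integral_def
      by (rule Bochner_Integration.integral_cong) (auto simp: indicator_def)
    finally show ?case by simp
  qed
  from Lim_transform_eventually[OF lim this] show ?thesis .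
qed

lemma gauss_int_upper: "gauss_int x \<le> sqrt (pi / 2)"
proof (rule tendsto_lowerbound[OF gauss_int_tendsto])
  show "\<forall>\<^sub>F y in at_top. gauss_int x \<le> gauss_int y"
    using eventually_ge_at_top[of x] by eventually_elim (rule gauss_int_mono)
qed auto

text \<open>
  Here \<open>x\<close> is the height and \<open>V\<close> the remaining variance (backward time). The function \<open>heat0\<close> is
  \<open>sqrt (pi / 2)\<close> times the probability that Brownian motion from \<open>x > 0\<close> stays positive for time \<open>V\<close>.
  Each further function is the \<open>x\<close>-derivative of its predecessor. All of them solve the heat equation,
  so the derivative of \<open>heat_i\<close> in \<open>V\<close> is half of the function with index \<open>i + 2\<close>; for \<open>i = 0\<close> and
  \<open>i = 1\<close> this is what makes them almost invariant under one step of the walk.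
\<close>

definition "heat0 V x = gauss_int (x / sqrt V)"
definition "heat1 V x = exp (- (x\<^sup>2) / (2 * V)) / sqrt V" for V x :: real
definition "heat2 V x = - x * exp (- (x\<^sup>2) / (2 * V)) / (V * sqrt V)" for V x :: real
definition "heat3 V x = (x\<^sup>2 / V - 1) * exp (- (x\<^sup>2) / (2 * V)) / (V * sqrt V)" for V x :: real
definition "heat4 V x = x * (3 - x\<^sup>2 / V) * exp (- (x\<^sup>2) / (2 * V)) / (V\<^sup>2 * sqrt V)" for V x :: real
definition "heat5 V x = (3 - 6 * (x\<^sup>2 / V) + (x\<^sup>2 / V)\<^sup>2) * exp (- (x\<^sup>2) / (2 * V)) / (V\<^sup>2 * sqrt V)" for V x :: real

lemma heat0_dx:
  assumes "V > 0" shows "((\<lambda>x. heat0 V x) has_real_derivative heat1 V x) (at x)"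
proof -
  have "((\<lambda>x. x / sqrt V) has_real_derivative 1 / sqrt V) (at x)"
    by (rule DERIV_cdivide[OF DERIV_ident])
  from DERIV_chain2[OF gauss_int_deriv this] show ?thesis
    unfolding heat0_def heat1_def
    by (rule DERIV_cong) (use assms in \<open>simp add: power_divide\<close>)
qed

text \<open>
  Every kernel from \<open>heat1\<close> on has the form polynomial times Gaussian over a half-integer power of \<open>V\<close>.
  This lemma and the next one reduce its derivatives to those of the polynomial.
\<close>

lemma gauss_exp_prefactor_dx:
  assumes "V > 0" and P: "(P has_real_derivative P') (at x)"
  shows "((\<lambda>x. P x * exp (- (x\<^sup>2) / (2 * V)) / c) has_real_derivative
    (P' - x / V * P x) * exp (- (x\<^sup>2) / (2 * V)) / c) (at x)"
proof -
  have "((\<lambda>x. exp (- (x\<^sup>2) / (2 * V))) has_real_derivative - x / V * exp (- (x\<^sup>2) / (2 * V))) (at x)"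
    using assms by (auto intro!: derivative_eq_intros simp: field_simps)
  from DERIV_cdivide[OF DERIV_mult[OF P this], of c] show ?thesis
    by (rule DERIV_cong) (simp add: algebra_simps)
qed

lemma gauss_exp_prefactor_dV:
  assumes "V > 0" and P: "(P has_real_derivative P') (at V)"
    and c: "(c has_real_derivative k / V * c V) (at V)" and "c V \<noteq> 0"
  shows "((\<lambda>V. P V * exp (- (x\<^sup>2) / (2 * V)) / c V) has_real_derivative
    (P' + (x\<^sup>2 / (2 * V\<^sup>2) - k / V) * P V) * exp (- (x\<^sup>2) / (2 * V)) / c V) (at V)"
proof -
  have "((\<lambda>V. exp (- (x\<^sup>2) / (2 * V))) has_real_derivative
      x\<^sup>2 / (2 * V\<^sup>2) * exp (- (x\<^sup>2) / (2 * V))) (at V)"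
    using assms by (auto intro!: derivative_eq_intros simp: field_simps power2_eq_square)
  from DERIV_divide[OF DERIV_mult[OF P this] c \<open>c V \<noteq> 0\<close>] show ?thesis
    by (rule DERIV_cong) (use \<open>c V \<noteq> 0\<close> in \<open>simp add: field_simps\<close>)
qed

lemma half_powers_dV:
  assumes "V > 0"
  shows "(sqrt has_real_derivative (1/2) / V * sqrt V) (at V)"
    "((\<lambda>V. V * sqrt V) has_real_derivative (3/2) / V * (V * sqrt V)) (at V)"
    "((\<lambda>V. V\<^sup>2 * sqrt V) has_real_derivative (5/2) / V * (V\<^sup>2 * sqrt V)) (at V)"
proof -
  have "inverse (sqrt V) / 2 = (1/2) / V * sqrt V"
    using assms by (simp add: field_simps)
  then show 1: "(sqrt has_real_derivative (1/2) / V * sqrt V) (at V)"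
    using DERIV_real_sqrt[OF assms] by (simp only:)
  show "((\<lambda>V. V * sqrt V) has_real_derivative (3/2) / V * (V * sqrt V)) (at V)"
    by (rule DERIV_cong[OF DERIV_mult[OF DERIV_ident 1]]) (use assms in \<open>simp add: field_simps\<close>)
  show "((\<lambda>V. V\<^sup>2 * sqrt V) has_real_derivative (5/2) / V * (V\<^sup>2 * sqrt V)) (at V)"
    by (rule DERIV_cong[OF DERIV_mult[OF DERIV_power[OF DERIV_ident, of 2] 1]])
       (use assms in \<open>simp add: field_simps power2_eq_square\<close>)
qed

lemma heat0_dV:
  assumes "V > 0" shows "((\<lambda>V. heat0 V x) has_real_derivative heat2 V x / 2) (at V)"
proof -
  have "((\<lambda>V. x / sqrt V) has_real_derivative (0 * sqrt V - x * ((1/2) / V * sqrt V)) / (sqrt V * sqrt V)) (at V)"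
    using assms by (intro DERIV_divide DERIV_const half_powers_dV) auto
  from DERIV_chain2[OF gauss_int_deriv this] show ?thesis
    unfolding heat0_def heat2_def
    by (rule DERIV_cong) (use assms in \<open>simp add: power_divide field_simps\<close>)
qed

lemma heat1_dx:
  assumes "V > 0" shows "((\<lambda>x. heat1 V x) has_real_derivative heat2 V x) (at x)"
proof -
  have "((\<lambda>x. 1) has_real_derivative 0) (at x)"
    using assms by (auto intro!: derivative_eq_intros simp: field_simps power2_eq_square)
  from gauss_exp_prefactor_dx[OF assms this] show ?thesis
    unfolding heat1_def heat2_def mult_1
    by (rule DERIV_cong) (use assms in \<open>simp add: field_simps power2_eq_square\<close>)
qed

lemma heat2_dx:
  assumes "V > 0" shows "((\<lambda>x. heat2 V x) has_real_derivative heat3 V x) (at x)"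
proof -
  have "((\<lambda>x. - x) has_real_derivative - 1) (at x)"
    using assms by (auto intro!: derivative_eq_intros simp: field_simps power2_eq_square)
  from gauss_exp_prefactor_dx[OF assms this] show ?thesis
    unfolding heat2_def heat3_def mult_1
    by (rule DERIV_cong) (use assms in \<open>simp add: field_simps power2_eq_square\<close>)
qed

lemma heat3_dx:
  assumes "V > 0" shows "((\<lambda>x. heat3 V x) has_real_derivative heat4 V x) (at x)"
proof -
  have "((\<lambda>x. x\<^sup>2 / V - 1) has_real_derivative 2 * x / V) (at x)"
    using assms by (auto intro!: derivative_eq_intros simp: field_simps power2_eq_square)
  from gauss_exp_prefactor_dx[OF assms this] show ?thesis
    unfolding heat3_def heat4_def mult_1
    by (rule DERIV_cong) (use assms in \<open>simp add: field_simps power2_eq_square\<close>)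
qed

lemma heat4_dx:
  assumes "V > 0" shows "((\<lambda>x. heat4 V x) has_real_derivative heat5 V x) (at x)"
proof -
  have "((\<lambda>x. x * (3 - x\<^sup>2 / V)) has_real_derivative 3 - 3 * x\<^sup>2 / V) (at x)"
    using assms by (auto intro!: derivative_eq_intros simp: field_simps power2_eq_square)
  from gauss_exp_prefactor_dx[OF assms this] show ?thesis
    unfolding heat4_def heat5_def mult_1
    by (rule DERIV_cong) (use assms in \<open>simp add: field_simps power2_eq_square\<close>)
qed

lemma heat1_dV:
  assumes "V > 0" shows "((\<lambda>V. heat1 V x) has_real_derivative heat3 V x / 2) (at V)"
proof -
  have "((\<lambda>V. 1) has_real_derivative 0) (at V)"
    using assms by (auto intro!: derivative_eq_intros simp: field_simps power2_eq_square)
  from gauss_exp_prefactor_dV[OF assms this half_powers_dV(1)[OF assms], of x] assms show ?thesis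
    unfolding heat1_def heat3_def mult_1
    by (auto elim!: DERIV_cong simp: field_simps power2_eq_square)
qed

lemma heat2_dV:
  assumes "V > 0" shows "((\<lambda>V. heat2 V x) has_real_derivative heat4 V x / 2) (at V)"
proof -
  have "((\<lambda>V. - x) has_real_derivative 0) (at V)"
    using assms by (auto intro!: derivative_eq_intros simp: field_simps power2_eq_square)
  from gauss_exp_prefactor_dV[OF assms this half_powers_dV(2)[OF assms], of x] assms show ?thesis
    unfolding heat2_def heat4_def mult_1
    by (auto elim!: DERIV_cong simp: field_simps power2_eq_square)
qed

lemma heat3_dV:
  assumes "V > 0" shows "((\<lambda>V. heat3 V x) has_real_derivative heat5 V x / 2) (at V)"
proof -
  have "((\<lambda>V. x\<^sup>2 / V - 1) has_real_derivative - x\<^sup>2 / V\<^sup>2) (at V)"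
    using assms by (auto intro!: derivative_eq_intros simp: field_simps power2_eq_square)
  from gauss_exp_prefactor_dV[OF assms this half_powers_dV(2)[OF assms], of x] assms show ?thesis
    unfolding heat3_def heat5_def mult_1
    by (auto elim!: DERIV_cong simp: field_simps power2_eq_square)
qed


lemma taylor_third_order:
  fixes f :: "real \<Rightarrow> real"
  assumes "\<And>t. (f has_real_derivative f1 t) (at t)" "\<And>t. (f1 has_real_derivative f2 t) (at t)"
    "\<And>t. (f2 has_real_derivative f3 t) (at t)" "\<And>t. (f3 has_real_derivative f4 t) (at t)"
    and C: "\<And>t. \<bar>t - x\<bar> \<le> \<bar>d\<bar> \<Longrightarrow> \<bar>f4 t\<bar> \<le> C"
  shows "\<bar>f (x + d) - (f x + f1 x * d + f2 x * d\<^sup>2 / 2 + f3 x * d ^ 3 / 6)\<bar> \<le> C * d ^ 4 / 24"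
proof (cases "d = 0")
  case False
  define diff where "diff n = (if n = 0 then f else if n = 1 then f1 else if n = 2 then f2
     else if n = 3 then f3 else f4)" for n :: nat
  have D: "DERIV (diff m) t :> diff (Suc m) t" if "m < 4" for m t
  proof -
    have "m = 0 \<or> m = 1 \<or> m = 2 \<or> m = 3" using that by presburger
    then show ?thesis using assms by (auto simp: diff_def)
  qed
  have "\<exists>t. (if x + d < x then x + d < t \<and> t < x else x < t \<and> t < x + d) \<and>
      f (x + d) = (\<Sum>m<4. diff m x / fact m * (x + d - x) ^ m) + diff 4 t / fact 4 * (x + d - x) ^ 4"
    by (rule Taylor[where a="x - \<bar>d\<bar>" and b="x + \<bar>d\<bar>"]) (use D False in \<open>auto simp: diff_def[of 0]\<close>)
  then obtain t where t: "(if x + d < x then x + d < t \<and> t < x else x < t \<and> t < x + d)"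
      "f (x + d) = (\<Sum>m<4. diff m x / fact m * (x + d - x) ^ m) + diff 4 t / fact 4 * (x + d - x) ^ 4"
    by blast
  have "(\<Sum>m<4. diff m x / fact m * (x + d - x) ^ m) = f x + f1 x * d + f2 x * d\<^sup>2 / 2 + f3 x * d ^ 3 / 6"
    by (simp add: diff_def eval_nat_numeral)
  with t(2) have "f (x + d) - (f x + f1 x * d + f2 x * d\<^sup>2 / 2 + f3 x * d ^ 3 / 6) = f4 t * d ^ 4 / 24"
    by (simp add: diff_def fact_numeral)
  moreover have "\<bar>f4 t\<bar> \<le> C" using t(1) by (intro C) (auto split: if_splits)
  then have "\<bar>f4 t\<bar> * d ^ 4 \<le> C * d ^ 4" by (intro mult_right_mono) auto
  then have "\<bar>f4 t * d ^ 4 / 24\<bar> \<le> C * d ^ 4 / 24" by (simp add: abs_mult)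
  ultimately show ?thesis by (simp only:)
qed auto

lemma taylor_first_order:
  fixes g :: "real \<Rightarrow> real"
  assumes "0 \<le> h" "\<And>t. V \<le> t \<Longrightarrow> (g has_real_derivative g1 t) (at t)"
    "\<And>t. V \<le> t \<Longrightarrow> (g1 has_real_derivative g2 t) (at t)"
    and C: "\<And>t. V \<le> t \<Longrightarrow> \<bar>g2 t\<bar> \<le> C"
  shows "\<bar>g (V + h) - (g V + g1 V * h)\<bar> \<le> C * h\<^sup>2 / 2"
proof (cases "h = 0")
  case False
  define diff where "diff n = (if n = 0 then g else if n = 1 then g1 else g2)" for n :: nat
  have D: "DERIV (diff m) t :> diff (Suc m) t" if "m < 2" "V \<le> t" for m t
  proof -
    have "m = 0 \<or> m = 1" using that by presburger
    then show ?thesis using assms that by (auto simp: diff_def)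
  qed
  have "\<exists>t. (if V + h < V then V + h < t \<and> t < V else V < t \<and> t < V + h) \<and>
      g (V + h) = (\<Sum>m<2. diff m V / fact m * (V + h - V) ^ m) + diff 2 t / fact 2 * (V + h - V) ^ 2"
    by (rule Taylor[where a="V" and b="V + h"]) (use D False assms(1) in \<open>auto simp: diff_def[of 0]\<close>)
  then obtain t where t: "V < t"
      "g (V + h) = (\<Sum>m<2. diff m V / fact m * (V + h - V) ^ m) + diff 2 t / fact 2 * (V + h - V) ^ 2"
    using assms(1) by (auto split: if_splits)
  have "(\<Sum>m<2. diff m V / fact m * (V + h - V) ^ m) = g V + g1 V * h"
    by (simp add: diff_def eval_nat_numeral)
  with t(2) have "g (V + h) - (g V + g1 V * h) = g2 t * h\<^sup>2 / 2"
    by (simp add: diff_def fact_numeral)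
  moreover have "\<bar>g2 t\<bar> \<le> C" using t(1) by (intro C) auto
  then have "\<bar>g2 t\<bar> * h\<^sup>2 \<le> C * h\<^sup>2" by (intro mult_right_mono) auto
  then have "\<bar>g2 t * h\<^sup>2 / 2\<bar> \<le> C * h\<^sup>2 / 2" by (simp add: abs_mult)
  ultimately show ?thesis by (simp only:)
qed auto

text \<open>
  A martingale step with two values: the increments \<open>a * (1 - \<mu>)\<close> and \<open>- a * (1 + \<mu>)\<close>, taken with the
  probabilities \<open>(1 + \<mu>) / 2\<close> and \<open>(1 - \<mu>) / 2\<close>, have mean \<open>0\<close>, variance
  \<open>a\<^sup>2 * (1 - \<mu>\<^sup>2)\<close> and third moment \<open>- 2 * a ^ 3 * \<mu> * (1 - \<mu>\<^sup>2)\<close>. The heat equation cancels the variance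
  \<open>a\<^sup>2\<close> against the decrease of the time parameter from \<open>V + a\<^sup>2\<close> to \<open>V\<close>. What remains is the defect
  \<open>(a * \<mu>)\<^sup>2\<close> of the variance, the third moment, and the Taylor remainders of fourth order.
\<close>

lemma heat_step_error:
  fixes F0 F1 F2 F3 F4 :: "real \<Rightarrow> real \<Rightarrow> real"
  assumes dx: "\<And>V x. V > 0 \<Longrightarrow> (F0 V has_real_derivative F1 V x) (at x)"
    "\<And>V x. V > 0 \<Longrightarrow> (F1 V has_real_derivative F2 V x) (at x)"
    "\<And>V x. V > 0 \<Longrightarrow> (F2 V has_real_derivative F3 V x) (at x)"
    "\<And>V x. V > 0 \<Longrightarrow> (F3 V has_real_derivative F4 V x) (at x)"
    and dV: "\<And>V x. V > 0 \<Longrightarrow> ((\<lambda>V. F0 V x) has_real_derivative F2 V x / 2) (at V)"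
    "\<And>V x. V > 0 \<Longrightarrow> ((\<lambda>V. F2 V x) has_real_derivative F4 V x / 2) (at V)"
    and "V > 0" "a \<ge> 0" "\<bar>\<mu>\<bar> \<le> 1"
    and C: "\<And>W y. V \<le> W \<Longrightarrow> \<bar>y - x\<bar> \<le> 2 * a \<Longrightarrow> \<bar>F4 W y\<bar> \<le> C"
  shows "\<bar>(1 + \<mu>) / 2 * F0 V (x + a * (1 - \<mu>)) + (1 - \<mu>) / 2 * F0 V (x - a * (1 + \<mu>)) - F0 (V + a\<^sup>2) x\<bar>
    \<le> (a * \<mu>)\<^sup>2 * \<bar>F2 V x\<bar> + a ^ 3 * \<bar>\<mu>\<bar> * \<bar>F3 V x\<bar> + a ^ 4 * C"
proof -
  define T where "T d = F0 V x + F1 V x * d + F2 V x * d\<^sup>2 / 2 + F3 V x * d ^ 3 / 6" for d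
  have tay: "\<bar>F0 V (x + d) - T d\<bar> \<le> C * d ^ 4 / 24" if "\<bar>d\<bar> \<le> 2 * a" for d
    unfolding T_def
    by (rule taylor_third_order[where ?f4.0="F4 V"]) (use dx \<open>V > 0\<close> C that in auto)
  have C0: "0 \<le> C" using C[of V x] \<open>a \<ge> 0\<close> by auto
  have d4: "C * d ^ 4 / 24 \<le> 2 / 3 * C * a ^ 4" if "\<bar>d\<bar> \<le> 2 * a" for d
  proof -
    have "d ^ 4 = \<bar>d\<bar> ^ 4" by simp
    also have "\<dots> \<le> (2 * a) ^ 4" using that by (intro power_mono) auto
    finally have "C * d ^ 4 \<le> C * (16 * a ^ 4)" using C0 by (intro mult_left_mono) (auto simp: power_mult_distrib)
    then show ?thesis by simp
  qed
  define dp dm where "dp = a * (1 - \<mu>)" and "dm = - (a * (1 + \<mu>))"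
  have b: "\<bar>dp\<bar> \<le> 2 * a" "\<bar>dm\<bar> \<le> 2 * a"
    using mult_left_mono[of "\<bar>1 - \<mu>\<bar>" 2 a] mult_left_mono[of "\<bar>1 + \<mu>\<bar>" 2 a] \<open>a \<ge> 0\<close> \<open>\<bar>\<mu>\<bar> \<le> 1\<close>
    by (simp_all add: dp_def dm_def abs_mult mult.commute)
  have P: "\<bar>F0 V (x + dp) - T dp\<bar> \<le> 2 / 3 * C * a ^ 4" "\<bar>F0 V (x + dm) - T dm\<bar> \<le> 2 / 3 * C * a ^ 4"
    using tay[OF b(1)] tay[OF b(2)] d4[OF b(1)] d4[OF b(2)] by linarith+
  have w: "0 \<le> (1 + \<mu>) / 2" "0 \<le> (1 - \<mu>) / 2" using assms by auto
  have "\<bar>(1 + \<mu>) / 2 * (F0 V (x + dp) - T dp) + (1 - \<mu>) / 2 * (F0 V (x + dm) - T dm)\<bar>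
     \<le> (1 + \<mu>) / 2 * \<bar>F0 V (x + dp) - T dp\<bar> + (1 - \<mu>) / 2 * \<bar>F0 V (x + dm) - T dm\<bar>"
    using abs_triangle_ineq[of "(1 + \<mu>) / 2 * (F0 V (x + dp) - T dp)" "(1 - \<mu>) / 2 * (F0 V (x + dm) - T dm)"]
      abs_of_nonneg[OF w(1)] abs_of_nonneg[OF w(2)] by (simp only: abs_mult)
  also have "\<dots> \<le> (1 + \<mu>) / 2 * (2 / 3 * C * a ^ 4) + (1 - \<mu>) / 2 * (2 / 3 * C * a ^ 4)"
    by (intro add_mono mult_left_mono w P)
  also have "\<dots> = 2 / 3 * C * a ^ 4" by (simp add: field_simps)
  finally have 1: "\<bar>(1 + \<mu>) / 2 * (F0 V (x + dp) - T dp) + (1 - \<mu>) / 2 * (F0 V (x + dm) - T dm)\<bar> \<le> 2 / 3 * C * a ^ 4" .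
  have 2: "(1 + \<mu>) / 2 * T dp + (1 - \<mu>) / 2 * T dm = 
      F0 V x + a\<^sup>2 * (1 - \<mu>\<^sup>2) * F2 V x / 2 - a ^ 3 * \<mu> * (1 - \<mu>\<^sup>2) * F3 V x / 3"
    unfolding T_def dp_def dm_def by (simp add: field_simps power2_eq_square power3_eq_cube)
  have 3: "\<bar>F0 (V + a\<^sup>2) x - (F0 V x + F2 V x / 2 * a\<^sup>2)\<bar> \<le> C / 4 * (a\<^sup>2)\<^sup>2 / 2"
  proof (rule taylor_first_order[where ?g2.0="\<lambda>V. F4 V x / 4" and g="\<lambda>V. F0 V x" and ?g1.0="\<lambda>V. F2 V x / 2"])
    fix t assume "V \<le> t"
    then have t: "t > 0" using \<open>V > 0\<close> by simp
    show "((\<lambda>V. F0 V x) has_real_derivative F2 t x / 2) (at t)" using dV(1)[OF t] .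
    show "((\<lambda>V. F2 V x / 2) has_real_derivative F4 t x / 4) (at t)" using DERIV_cdivide[OF dV(2)[OF t, of x], of 2] by simp
    show "\<bar>F4 t x / 4\<bar> \<le> C / 4" using C[OF \<open>V \<le> t\<close>, of x] \<open>a \<ge> 0\<close> by simp
  qed simp
  have mu2: "\<mu>\<^sup>2 \<le> 1" using assms(9) by (simp add: abs_square_le_1)
  have 4: "\<bar>a ^ 3 * \<mu> * (1 - \<mu>\<^sup>2) * F3 V x / 3\<bar> \<le> a ^ 3 * \<bar>\<mu>\<bar> * \<bar>F3 V x\<bar>"
  proof -
    have "(1 - y) / 3 \<le> 1" if "0 \<le> y" for y :: real using that by simp
    then have third: "(1 - \<mu>\<^sup>2) / 3 \<le> 1" using zero_le_power2 by blast
    have "\<bar>a ^ 3 * \<mu> * (1 - \<mu>\<^sup>2) * F3 V x / 3\<bar> = a ^ 3 * \<bar>\<mu>\<bar> * \<bar>F3 V x\<bar> * ((1 - \<mu>\<^sup>2) / 3)"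
      using mu2 \<open>a \<ge> 0\<close> by (simp add: abs_mult)
    also have "\<dots> \<le> a ^ 3 * \<bar>\<mu>\<bar> * \<bar>F3 V x\<bar> * 1"
      by (intro mult_left_mono third) (use \<open>a \<ge> 0\<close> in simp)
    finally show ?thesis by simp
  qed
  have 5: "\<bar>a\<^sup>2 * \<mu>\<^sup>2 * F2 V x / 2\<bar> \<le> (a * \<mu>)\<^sup>2 * \<bar>F2 V x\<bar>"
    by (simp add: abs_mult power_mult_distrib)
  have eq: "(1 + \<mu>) / 2 * F0 V (x + a * (1 - \<mu>)) + (1 - \<mu>) / 2 * F0 V (x - a * (1 + \<mu>)) - F0 (V + a\<^sup>2) x
    = ((1 + \<mu>) / 2 * (F0 V (x + dp) - T dp) + (1 - \<mu>) / 2 * (F0 V (x + dm) - T dm))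
      - (F0 (V + a\<^sup>2) x - (F0 V x + F2 V x / 2 * a\<^sup>2))
      - a\<^sup>2 * \<mu>\<^sup>2 * F2 V x / 2 - a ^ 3 * \<mu> * (1 - \<mu>\<^sup>2) * F3 V x / 3"
  proof -
    have x: "x + a * (1 - \<mu>) = x + dp" "x - a * (1 + \<mu>) = x + dm" by (simp_all add: dp_def dm_def)
    have alg: "wp * fp + wm * fm - G = (wp * (fp - Tp) + wm * (fm - Tm)) - (G - (F + H / 2 * A)) - A * M * H / 2 - Z / 3"
      if T: "wp * Tp + wm * Tm = F + A * (1 - M) * H / 2 - Z / 3" for wp fp wm fm G Tp Tm F H A M Z :: real
    proof -
      have "wp * fp + wm * fm = (wp * (fp - Tp) + wm * (fm - Tm)) + (wp * Tp + wm * Tm)"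
        by (simp add: algebra_simps)
      then show ?thesis unfolding T by (simp add: field_simps)
    qed
    show ?thesis unfolding x by (rule alg[OF 2])
  qed
  have 6: "C / 4 * (a\<^sup>2)\<^sup>2 / 2 = C * a ^ 4 / 8" by (simp add: power_mult[symmetric])
  have abs4: "\<bar>P - Q - R - S\<bar> \<le> p + q + r + s"
    if "\<bar>P\<bar> \<le> p" "\<bar>Q\<bar> \<le> q" "\<bar>R\<bar> \<le> r" "\<bar>S\<bar> \<le> s" for P Q R S p q r s :: real
    using that by linarith
  have "2 / 3 * C * a ^ 4 + C / 4 * (a\<^sup>2)\<^sup>2 / 2 \<le> a ^ 4 * C"
    using C0 zero_le_even_power[of 4 a] unfolding 6 by (simp add: mult.commute)
  then show ?thesis
    unfolding eq by (intro order_trans[OF abs4[OF 1 3 5 4]]) simp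
qed

section \<open>Bounds for the Gaussian kernels\<close>

lemma mult_exp_half_le: assumes "(z::real) \<ge> 0"
  shows "z * exp (- z / 2) \<le> 2" "z\<^sup>2 * exp (- z / 2) \<le> 8"
proof -
  have "1 + z / 2 + (z / 2)\<^sup>2 / 2 \<le> exp (z / 2)"
    using assms by (intro exp_lower_Taylor_quadratic) auto
  then have *: "1 + z / 2 + z\<^sup>2 / 8 \<le> exp (z / 2)" by (simp add: power_divide)
  have "0 \<le> z\<^sup>2 / 8" by simp
  then have "z \<le> 2 * exp (z / 2)" "z\<^sup>2 \<le> 8 * exp (z / 2)" using * assms by linarith+
  moreover have "exp (- z / 2) = 1 / exp (z / 2)" by (simp add: exp_minus inverse_eq_divide)
  ultimately show "z * exp (- z / 2) \<le> 2" "z\<^sup>2 * exp (- z / 2) \<le> 8"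
    by (simp_all add: divide_le_eq)
qed

text \<open>
  Polynomials in \<open>x\<^sup>2 / V\<close> are absorbed by the Gaussian factor. The bounds on the kernels below are
  consequences; those with an additional factor \<open>x\<close> or \<open>x\<^sup>2\<close> trade a power of \<open>x\<close> for a power of \<open>sqrt V\<close>.
\<close>

lemma heat_prefactor_bounds:
  fixes V x :: real
  assumes "V > 0"
  defines "z \<equiv> x\<^sup>2 / V" and "e \<equiv> exp (- (x\<^sup>2) / (2 * V))"
  shows "0 \<le> z" "0 \<le> e" "e \<le> 1" "z * e \<le> 2" "z\<^sup>2 * e \<le> 8"
proof -
  show z: "0 \<le> z" using assms by simp
  have e: "e = exp (- z / 2)" by (simp add: e_def z_def)
  show "0 \<le> e" "e \<le> 1" using z unfolding e by simp_all
  show "z * e \<le> 2" "z\<^sup>2 * e \<le> 8" unfolding e by (rule mult_exp_half_le[OF z])+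
qed

lemma heat2_bounds:
  assumes "V > 0"
  shows "\<bar>heat2 V x\<bar> \<le> \<bar>x\<bar> / (V * sqrt V)" "x\<^sup>2 * \<bar>heat2 V x\<bar> \<le> 2 * \<bar>x\<bar> / sqrt V"
proof -
  note b = heat_prefactor_bounds[OF assms, of x]
  let ?e = "exp (- (x\<^sup>2) / (2 * V))"
  have *: "\<bar>heat2 V x\<bar> = \<bar>x\<bar> * ?e / (V * sqrt V)"
    using assms by (simp add: heat2_def abs_mult)
  show "\<bar>heat2 V x\<bar> \<le> \<bar>x\<bar> / (V * sqrt V)"
    unfolding * using b(2,3) assms by (intro divide_right_mono) (auto intro: mult_left_le)
  have "x\<^sup>2 * \<bar>heat2 V x\<bar> = \<bar>x\<bar> / sqrt V * (x\<^sup>2 / V * ?e)"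
    unfolding * by (simp add: mult_ac)
  also have "\<dots> \<le> \<bar>x\<bar> / sqrt V * 2" using assms by (intro mult_left_mono b(4)) auto
  finally show "x\<^sup>2 * \<bar>heat2 V x\<bar> \<le> 2 * \<bar>x\<bar> / sqrt V" by (simp add: mult.commute)
qed

lemma heat3_bounds:
  assumes "V > 0"
  shows "\<bar>heat3 V x\<bar> \<le> 3 / (V * sqrt V)" "x\<^sup>2 * \<bar>heat3 V x\<bar> \<le> 10 / sqrt V"
proof -
  note b = heat_prefactor_bounds[OF assms, of x]
  let ?e = "exp (- (x\<^sup>2) / (2 * V))" and ?z = "x\<^sup>2 / V"
  have abs: "\<bar>?z - 1\<bar> \<le> ?z + 1" using b(1) by linarith
  have "\<bar>heat3 V x\<bar> = \<bar>?z - 1\<bar> * ?e / (V * sqrt V)"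
    using assms by (simp add: heat3_def abs_mult)
  also have "\<dots> \<le> (?z + 1) * ?e / (V * sqrt V)"
    using assms by (intro divide_right_mono mult_right_mono abs) auto
  finally have *: "\<bar>heat3 V x\<bar> \<le> (?z * ?e + ?e) / (V * sqrt V)" by (simp only: distrib_right mult_1)
  also have "\<dots> \<le> 3 / (V * sqrt V)"
    using b(2-5) assms by (intro divide_right_mono) (linarith, simp)
  finally show "\<bar>heat3 V x\<bar> \<le> 3 / (V * sqrt V)" .
  have "x\<^sup>2 * \<bar>heat3 V x\<bar> \<le> x\<^sup>2 * ((?z * ?e + ?e) / (V * sqrt V))"
    by (intro mult_left_mono *) auto
  also have "\<dots> = (?z\<^sup>2 * ?e + ?z * ?e) / sqrt V" 
    using assms by (simp add: field_simps power2_eq_square)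
  also have "\<dots> \<le> 10 / sqrt V"
    using b(2-5) assms by (intro divide_right_mono) (linarith, simp)
  finally show "x\<^sup>2 * \<bar>heat3 V x\<bar> \<le> 10 / sqrt V" .
qed

lemma heat4_bounds:
  assumes "V > 0"
  shows "\<bar>heat4 V x\<bar> \<le> 5 * \<bar>x\<bar> / (V\<^sup>2 * sqrt V)" "\<bar>x\<bar> * \<bar>heat4 V x\<bar> \<le> 14 / (V * sqrt V)"
proof -
  note b = heat_prefactor_bounds[OF assms, of x]
  let ?e = "exp (- (x\<^sup>2) / (2 * V))" and ?z = "x\<^sup>2 / V"
  have abs: "\<bar>3 - ?z\<bar> \<le> 3 + ?z" using b(1) by linarith
  have "\<bar>heat4 V x\<bar> = \<bar>x\<bar> * (\<bar>3 - ?z\<bar> * ?e) / (V\<^sup>2 * sqrt V)"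
    using assms by (simp add: heat4_def abs_mult)
  also have "\<dots> \<le> \<bar>x\<bar> * ((3 + ?z) * ?e) / (V\<^sup>2 * sqrt V)"
    using assms by (intro divide_right_mono mult_right_mono mult_left_mono abs) auto
  finally have *: "\<bar>heat4 V x\<bar> \<le> \<bar>x\<bar> * (3 * ?e + ?z * ?e) / (V\<^sup>2 * sqrt V)" by (simp only: distrib_right)
  also have "\<dots> \<le> \<bar>x\<bar> * 5 / (V\<^sup>2 * sqrt V)"
    using b(2-5) assms by (intro divide_right_mono mult_left_mono) (linarith, simp_all)
  finally show "\<bar>heat4 V x\<bar> \<le> 5 * \<bar>x\<bar> / (V\<^sup>2 * sqrt V)" by (simp add: mult.commute)
  have "\<bar>x\<bar> * \<bar>heat4 V x\<bar> \<le> \<bar>x\<bar> * (\<bar>x\<bar> * (3 * ?e + ?z * ?e) / (V\<^sup>2 * sqrt V))"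
    by (intro mult_left_mono *) auto
  also have "\<dots> = (3 * (?z * ?e) + ?z\<^sup>2 * ?e) / (V * sqrt V)" 
    using assms by (simp add: field_simps power2_eq_square)
  also have "\<dots> \<le> 14 / (V * sqrt V)"
    using b(2-5) assms by (intro divide_right_mono) (linarith, simp)
  finally show "\<bar>x\<bar> * \<bar>heat4 V x\<bar> \<le> 14 / (V * sqrt V)" .
qed

lemma heat5_bound:
  assumes "V > 0"
  shows "\<bar>heat5 V x\<bar> \<le> 23 / (V\<^sup>2 * sqrt V)"
proof -
  note b = heat_prefactor_bounds[OF assms, of x]
  let ?e = "exp (- (x\<^sup>2) / (2 * V))" and ?z = "x\<^sup>2 / V"
  have abs: "\<bar>3 - 6 * ?z + ?z\<^sup>2\<bar> \<le> 3 + 6 * ?z + ?z\<^sup>2" using b(1) zero_le_power2[of ?z] by linarith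
  have sum: "3 * ?e + 6 * (?z * ?e) + ?z\<^sup>2 * ?e \<le> 23" using b(3-5) by linarith
  have "\<bar>heat5 V x\<bar> = \<bar>3 - 6 * ?z + ?z\<^sup>2\<bar> * ?e / (V\<^sup>2 * sqrt V)"
    using assms by (simp add: heat5_def abs_mult)
  also have "\<dots> \<le> (3 + 6 * ?z + ?z\<^sup>2) * ?e / (V\<^sup>2 * sqrt V)"
    using assms by (intro divide_right_mono mult_right_mono abs) auto
  also have "\<dots> = (3 * ?e + 6 * (?z * ?e) + ?z\<^sup>2 * ?e) / (V\<^sup>2 * sqrt V)"
    by (simp only: distrib_right mult.assoc)
  also have "\<dots> \<le> 23 / (V\<^sup>2 * sqrt V)"
    using assms by (intro divide_right_mono sum) auto
  finally show ?thesis .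
qed

section \<open>The chain killed at the origin\<close>

text \<open>
  The conditional expectation of \<open>g (S (m + 1))\<close> given \<open>S m = s\<close>, with \<open>q = 2 p - 1\<close>. At \<open>m = 0\<close> division by
  zero yields \<open>0\<close>, so both weights are \<open>1 / 2\<close>, in agreement with the symmetric first step.
\<close>

definition step :: "real \<Rightarrow> nat \<Rightarrow> (int \<Rightarrow> real) \<Rightarrow> int \<Rightarrow> real" where
  "step q m g s = (1 + q * of_int s / real m) / 2 * g (s + 1) + (1 - q * of_int s / real m) / 2 * g (s - 1)"

definition kill :: "(int \<Rightarrow> real) \<Rightarrow> int \<Rightarrow> real" where
  "kill g s = (if s = 0 then 0 else g s)"

text \<open>
  The expectation of \<open>f (S (m + j))\<close> on the event that the walk, started at \<open>s\<close> at time \<open>m\<close>, is not at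
  \<open>0\<close> at the times \<open>m + 1, \<dots>, m + j\<close>. The starting point itself may be \<open>0\<close>.
\<close>

primrec surv :: "real \<Rightarrow> nat \<Rightarrow> nat \<Rightarrow> (int \<Rightarrow> real) \<Rightarrow> int \<Rightarrow> real" where
  "surv q 0 m f = f"
| "surv q (Suc j) m f = step q m (kill (surv q j (Suc m) f))"

text \<open>
  The walk satisfies \<open>\<bar>S m\<bar> \<le> m\<close>; on this range the transition weights are probabilities. Only there is
  \<open>step\<close> a positive operator, which is why the comparison lemmas restrict the positions.
\<close>

lemma step_weights_nonneg:
  assumes "\<bar>q\<bar> \<le> 1" "0 < s" "s \<le> int m"
  shows "\<bar>q * of_int s / real m\<bar> \<le> 1"
proof -
  have "\<bar>q\<bar> * of_int s \<le> 1 * real m"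
    using assms by (intro mult_mono) auto
  then show ?thesis using assms by (simp add: abs_mult divide_le_eq)
qed

lemma step_mono_pos:
  assumes "\<bar>q\<bar> \<le> 1" "0 < s" "s \<le> int m" 
    "\<And>t. 0 < t \<Longrightarrow> t \<le> int (Suc m) \<Longrightarrow> f t \<le> g t"
  shows "step q m (kill f) s \<le> step q m (kill g) s"
  unfolding step_def
  using step_weights_nonneg[OF assms(1-3), THEN abs_le_D1] step_weights_nonneg[OF assms(1-3), THEN abs_le_D2] assms
  by (intro add_mono mult_left_mono) (auto simp: kill_def)

lemma step_add: "step q m (kill (\<lambda>t. f t + g t)) s = step q m (kill f) s + step q m (kill g) s"
proof -
  have "kill (\<lambda>t. f t + g t) = (\<lambda>t. kill f t + kill g t)" by (auto simp: kill_def)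
  then show ?thesis by (simp add: step_def algebra_simps add_divide_distrib diff_divide_distrib)
qed

lemma step_cmult: "step q m (kill (\<lambda>t. c * f t)) s = c * step q m (kill f) s"
proof -
  have "kill (\<lambda>t. c * f t) = (\<lambda>t. c * kill f t)" by (auto simp: kill_def)
  then show ?thesis by (simp add: step_def algebra_simps add_divide_distrib diff_divide_distrib)
qed

lemma surv_mono:
  assumes "\<bar>q\<bar> \<le> 1" "0 < s" "s \<le> int m"
    "\<And>t. 0 < t \<Longrightarrow> t \<le> int (m + j) \<Longrightarrow> f t \<le> g t"
  shows "surv q j m f s \<le> surv q j m g s"
  using assms(2-4)
proof (induction j arbitrary: m s)
  case (Suc j)
  then show ?case unfolding surv.simps by (intro step_mono_pos[OF assms(1)]) auto
qed auto

lemma surv_add: "surv q j m (\<lambda>t. f t + g t) s = surv q j m f s + surv q j m g s"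
proof (induction j arbitrary: m s)
  case (Suc j)
  show ?case unfolding surv.simps Suc step_add ..
qed auto

lemma surv_cmult: "surv q j m (\<lambda>t. c * f t) s = c * surv q j m f s"
proof (induction j arbitrary: m s)
  case (Suc j)
  show ?case unfolding surv.simps Suc step_cmult ..
qed auto

lemma surv_semigroup: "surv q (i + j) m f s = surv q i m (surv q j (m + i) f) s"
proof (induction i arbitrary: m s)
  case (Suc i)
  have "surv q (i + j) (Suc m) f = surv q i (Suc m) (surv q j (m + Suc i) f)"
    using Suc[of "Suc m"] by (auto simp: fun_eq_iff)
  then show ?case by simp
qed auto

lemma surv_nonneg:
  assumes "\<bar>q\<bar> \<le> 1" "0 < s" "s \<le> int m" "\<And>t. 0 \<le> f t"
  shows "0 \<le> surv q j m f s"
  using surv_mono[OF assms(1-3), of j "\<lambda>t. 0 * f t" f] assms(4) surv_cmult[of q j m 0 f s] by simp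

lemma surv_le_1:
  assumes "\<bar>q\<bar> \<le> 1" "0 < s" "s \<le> int m"
  shows "surv q j m (\<lambda>_. 1) s \<le> 1"
  using assms(2,3)
proof (induction j arbitrary: m s)
  case (Suc j)
  have "surv q (Suc j) m (\<lambda>_. 1) s \<le> step q m (kill (\<lambda>_. 1)) s"
    unfolding surv.simps using Suc by (intro step_mono_pos[OF assms(1)]) auto
  also have "\<dots> \<le> (1 + q * of_int s / real m) / 2 * 1 + (1 - q * of_int s / real m) / 2 * 1"
    unfolding step_def using step_weights_nonneg[OF assms(1) Suc.prems, THEN abs_le_D1]
      step_weights_nonneg[OF assms(1) Suc.prems, THEN abs_le_D2]
    by (intro add_mono mult_left_mono) (auto simp: kill_def)
  also have "\<dots> = 1" by (simp add: field_simps)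
  finally show ?case .
qed auto

lemma surv_even:
  assumes "\<And>t. f (- t) = f t"
  shows "surv q j m f (- s) = surv q j m f s"
proof (induction j arbitrary: m s)
  case (Suc j)
  have "kill (surv q j (Suc m) f) (- s + 1) = kill (surv q j (Suc m) f) (s - 1)"
    "kill (surv q j (Suc m) f) (- s - 1) = kill (surv q j (Suc m) f) (s + 1)"
    using Suc[of "Suc m" "s - 1"] Suc[of "Suc m" "s + 1"] by (auto simp: kill_def)
  then show ?case by (simp add: step_def)
qed (simp add: assms)

text \<open>
  The discrete comparison principle: if \<open>\<Phi>\<close> decreases along the killed chain up to errors \<open>e i * w i\<close>,
  and the weight \<open>w\<close> is itself superharmonic, then the errors add up with the weight taken at the
  starting point. It suffices to look at positive positions, since a path cannot change sign
  without being killed.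
\<close>

lemma surv_le_supersolution:
  assumes "\<bar>q\<bar> \<le> 1" "0 < s" "s \<le> int m"
    and sup: "\<And>i t. m \<le> i \<Longrightarrow> i < m + j \<Longrightarrow> 0 < t \<Longrightarrow> t \<le> int i \<Longrightarrow> 
        step q i (kill (\<Phi> (Suc i))) t \<le> \<Phi> i t + e i * w i t"
    and w: "\<And>i t. m \<le> i \<Longrightarrow> i < m + j \<Longrightarrow> 0 < t \<Longrightarrow> t \<le> int i \<Longrightarrow> 
        step q i (kill (w (Suc i))) t \<le> w i t"
    and e: "\<And>i. 0 \<le> e i"
  shows "surv q j m (\<Phi> (m + j)) s \<le> \<Phi> m s + (\<Sum>i=m..<m + j. e i) * w m s"
  using assms(2-5)
proof (induction j arbitrary: m s)
  case (Suc j)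
  let ?E = "\<Sum>i=Suc m..<Suc m + j. e i"
  have IH: "surv q j (Suc m) (\<Phi> (m + Suc j)) t \<le> \<Phi> (Suc m) t + ?E * w (Suc m) t"
    if "0 < t" "t \<le> int (Suc m)" for t
    using Suc.IH[of t "Suc m"] Suc.prems that by simp
  have E0: "0 \<le> ?E" by (intro sum_nonneg e)
  have "surv q (Suc j) m (\<Phi> (m + Suc j)) s \<le> step q m (kill (\<lambda>t. \<Phi> (Suc m) t + ?E * w (Suc m) t)) s"
    unfolding surv.simps using Suc.prems IH by (intro step_mono_pos[OF assms(1)]) auto
  also have "\<dots> = step q m (kill (\<Phi> (Suc m))) s + ?E * step q m (kill (w (Suc m))) s"
    by (simp add: step_add step_cmult)
  also have "\<dots> \<le> \<Phi> m s + e m * w m s + ?E * w m s"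
    using Suc.prems by (intro add_mono mult_left_mono E0) auto
  also have "\<dots> = \<Phi> m s + (e m + ?E) * w m s"
    by (simp only: distrib_right add.assoc)
  also have "e m + ?E = (\<Sum>i=m..<m + Suc j. e i)"
    by (subst (2) sum.atLeast_Suc_lessThan) auto
  finally show ?case .
qed auto

section \<open>Comparison of the killed chain with the heat equation\<close>

text \<open>
  What the comparison needs from the scaling factors beyond a starting time \<open>k\<close>. The recursion says
  that \<open>a m * S m\<close> is a martingale. The bound \<open>K\<close> lets a height \<open>a m * s\<close> with \<open>s \<ge> 1\<close> dominate the
  size \<open>a (m + 1)\<close> of the next increment.
\<close>

locale walk_scaling =
  fixes q :: real and a :: "nat \<Rightarrow> real" and k :: nat and K :: real
  assumes q_bound: "\<bar>q\<bar> \<le> 1"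
    and a_pos: "\<And>m. k < m \<Longrightarrow> 0 < a m"
    and a_rec: "\<And>m. k < m \<Longrightarrow> a (Suc m) * (1 + q / real m) = a m"
    and a_growth: "\<And>m. k < m \<Longrightarrow> a (Suc m) \<le> K * a m"
    and K_ge_1: "1 \<le> K"
begin

definition A :: "nat \<Rightarrow> real" where "A n = (\<Sum>j=1..n. (a j)\<^sup>2)"

text \<open>
  The relative error of one step at time \<open>m\<close> when the remaining variance is at least \<open>v\<close>. The three
  summands come from the variance defect, the third moment and the fourth-order remainder. The
  minimum reflects two bounds for the drift \<open>q * s / m\<close>: it is at most \<open>1\<close>, and at most \<open>s / m\<close>, where
  \<open>s\<close> is of the order \<open>sqrt v / a m\<close> under the Gaussian weight. The second one is summable over \<open>m\<close>
  but not small for small \<open>m\<close>; there the first one is used.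
\<close>

definition rate :: "real \<Rightarrow> nat \<Rightarrow> real" where
  "rate v m = min ((a (Suc m))\<^sup>2 / v) (1 / (real m)\<^sup>2) + (a (Suc m))\<^sup>2 / v / real m + ((a (Suc m))\<^sup>2 / v)\<^sup>2"

lemma A_Suc: "A (Suc n) = A n + (a (Suc n))\<^sup>2"
  by (simp add: A_def)

lemma A_mono: "m \<le> n \<Longrightarrow> A m \<le> A n"
  unfolding A_def by (intro sum_mono2) auto

lemma rate_nonneg: "0 < v \<Longrightarrow> 0 \<le> rate v m"
  by (simp add: rate_def)

text \<open>
  The drift of the walk is exactly compensated by the change of the factor from \<open>a m\<close> to \<open>a (m + 1)\<close>,
  which brings a step into the form of \<open>heat_step_error\<close>.
\<close>

lemma scaled_neighbours:
  assumes "k < m"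
  shows "a (Suc m) * of_int (s + 1) = a m * of_int s + a (Suc m) * (1 - q * of_int s / real m)"
    "a (Suc m) * of_int (s - 1) = a m * of_int s - a (Suc m) * (1 + q * of_int s / real m)"
  unfolding a_rec[OF assms, symmetric] by (simp_all add: field_simps)

lemma step_kill_pos:
  assumes "0 < s" "g 0 = 0"
  shows "step q m (kill g) s = step q m g s"
  using assms by (auto simp: step_def kill_def)

text \<open>
  The constant \<open>c\<close> carries the dependence on the height: it is a multiple of \<open>a m * s\<close> for \<open>heat0\<close>, whose
  even derivatives vanish at \<open>0\<close>, and a number for \<open>heat1\<close>.
\<close>

lemma step_heat_error:
  fixes F0 F1 F2 F3 F4 :: "real \<Rightarrow> real \<Rightarrow> real"
  assumes dx: "\<And>V x. V > 0 \<Longrightarrow> (F0 V has_real_derivative F1 V x) (at x)"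
    "\<And>V x. V > 0 \<Longrightarrow> (F1 V has_real_derivative F2 V x) (at x)"
    "\<And>V x. V > 0 \<Longrightarrow> (F2 V has_real_derivative F3 V x) (at x)"
    "\<And>V x. V > 0 \<Longrightarrow> (F3 V has_real_derivative F4 V x) (at x)"
    and dV: "\<And>V x. V > 0 \<Longrightarrow> ((\<lambda>V. F0 V x) has_real_derivative F2 V x / 2) (at V)"
    "\<And>V x. V > 0 \<Longrightarrow> ((\<lambda>V. F2 V x) has_real_derivative F4 V x / 2) (at V)"
    and m: "k < m" and s: "0 < s" "s \<le> int m" and v: "0 < v" "v \<le> V"
    and c: "0 \<le> c"
    and F2: "\<bar>F2 V (a m * of_int s)\<bar> \<le> c / (V * sqrt V)"
      "(a m * of_int s)\<^sup>2 * \<bar>F2 V (a m * of_int s)\<bar> \<le> c / sqrt V"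
    and F3: "\<bar>a m * of_int s\<bar> * \<bar>F3 V (a m * of_int s)\<bar> \<le> c / (V * sqrt V)"
    and F4: "\<And>U y. V \<le> U \<Longrightarrow> \<bar>y - a m * of_int s\<bar> \<le> 2 * a (Suc m) \<Longrightarrow> \<bar>F4 U y\<bar> \<le> c / (U\<^sup>2 * sqrt U)"
  shows "\<bar>step q m (\<lambda>t. F0 V (a (Suc m) * of_int t)) s - F0 (V + (a (Suc m))\<^sup>2) (a m * of_int s)\<bar>
     \<le> c * K\<^sup>2 * rate v m / sqrt v"
proof -
  define x where "x = a m * of_int s"
  define \<mu> where "\<mu> = q * of_int s / real m"
  define \<alpha> where "\<alpha> = a (Suc m)"
  define r where "r = \<alpha>\<^sup>2 / v"
  have m0: "0 < real m" using m by simp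
  have V: "0 < V" using v by simp
  have \<alpha>: "0 < \<alpha>" unfolding \<alpha>_def using a_pos m by simp
  have x: "0 < x" unfolding x_def using a_pos m s by simp
  have \<mu>: "\<bar>\<mu>\<bar> \<le> 1" unfolding \<mu>_def by (rule step_weights_nonneg[OF q_bound s])
  have C: "\<bar>F4 U y\<bar> \<le> c / (v\<^sup>2 * sqrt v)" if "V \<le> U" "\<bar>y - x\<bar> \<le> 2 * \<alpha>" for U y
  proof -
    have "\<bar>F4 U y\<bar> \<le> c / (U\<^sup>2 * sqrt U)" using F4 that unfolding x_def \<alpha>_def by blast
    also have "\<dots> \<le> c / (v\<^sup>2 * sqrt v)"
      using v that c by (intro divide_left_mono mult_mono power_mono) auto
    finally show ?thesis .
  qed
  have V32: "c / (V * sqrt V) \<le> c / (v * sqrt v)" and V12: "c / sqrt V \<le> c / sqrt v"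
    using v c V by (auto intro!: divide_left_mono mult_mono)
  have \<alpha>\<mu>: "\<alpha> * \<bar>\<mu>\<bar> \<le> K * x / real m"
  proof -
    have "\<bar>\<mu>\<bar> = \<bar>q\<bar> * of_int s / real m" using s by (simp add: \<mu>_def abs_mult)
    also have "\<dots> \<le> 1 * of_int s / real m"
      using q_bound s by (intro divide_right_mono mult_right_mono) auto
    finally have "\<bar>\<mu>\<bar> \<le> of_int s / real m" by simp
    then have "\<alpha> * \<bar>\<mu>\<bar> \<le> (K * a m) * (of_int s / real m)"
      using \<alpha> a_growth[OF m] s unfolding \<alpha>_def by (intro mult_mono) auto
    then show ?thesis by (simp add: x_def mult.assoc)
  qed
  have T2a: "(\<alpha> * \<mu>)\<^sup>2 * \<bar>F2 V x\<bar> \<le> c / sqrt v * r"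
  proof -
    have "(\<alpha> * \<mu>)\<^sup>2 \<le> \<alpha>\<^sup>2 * 1"
      unfolding power_mult_distrib using \<mu> by (intro mult_left_mono) (auto simp: abs_square_le_1)
    then have "(\<alpha> * \<mu>)\<^sup>2 * \<bar>F2 V x\<bar> \<le> \<alpha>\<^sup>2 * (c / (v * sqrt v))"
      using F2(1) V32 unfolding x_def by (intro mult_mono) auto
    then show ?thesis by (simp add: r_def field_simps)
  qed
  have T2b: "(\<alpha> * \<mu>)\<^sup>2 * \<bar>F2 V x\<bar> \<le> c / sqrt v * (K\<^sup>2 * (1 / (real m)\<^sup>2))"
  proof -
    have "(\<alpha> * \<mu>)\<^sup>2 = (\<alpha> * \<bar>\<mu>\<bar>)\<^sup>2" by (simp add: power_mult_distrib)
    also have "\<dots> \<le> (K * x / real m)\<^sup>2"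
      using \<alpha> by (intro power_mono \<alpha>\<mu>) auto
    finally have "(\<alpha> * \<mu>)\<^sup>2 * \<bar>F2 V x\<bar> \<le> (K * x / real m)\<^sup>2 * \<bar>F2 V x\<bar>"
      by (intro mult_right_mono) auto
    also have "\<dots> = (K / real m)\<^sup>2 * (x\<^sup>2 * \<bar>F2 V x\<bar>)"
      by (simp add: power_mult_distrib power_divide)
    also have "\<dots> \<le> (K / real m)\<^sup>2 * (c / sqrt v)"
      using F2(2) V12 unfolding x_def by (intro mult_left_mono) auto
    finally show ?thesis by (simp add: power_divide mult_ac)
  qed
  have K2: "1 \<le> K\<^sup>2" "K \<le> K\<^sup>2"
    using K_ge_1 mult_mono[of 1 K 1 K] mult_left_mono[of 1 K K] by (auto simp: power2_eq_square)
  have r0: "0 \<le> r" using v by (simp add: r_def)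
  have cv: "0 \<le> c / sqrt v" using c v by simp
  have T2: "(\<alpha> * \<mu>)\<^sup>2 * \<bar>F2 V x\<bar> \<le> c / sqrt v * (K\<^sup>2 * min r (1 / (real m)\<^sup>2))"
  proof (cases "r \<le> 1 / (real m)\<^sup>2")
    case True
    have "1 * r \<le> K\<^sup>2 * r" using K2 r0 by (intro mult_right_mono) auto
    then have "c / sqrt v * r \<le> c / sqrt v * (K\<^sup>2 * r)" using cv by (intro mult_left_mono) auto
    then show ?thesis using T2a True by simp
  next
    case False
    then show ?thesis using T2b by simp
  qed
  have T3: "\<alpha> ^ 3 * \<bar>\<mu>\<bar> * \<bar>F3 V x\<bar> \<le> c / sqrt v * (K\<^sup>2 * (r / real m))"
  proof -
    have "\<alpha> ^ 3 * \<bar>\<mu>\<bar> * \<bar>F3 V x\<bar> = \<alpha>\<^sup>2 * (\<alpha> * \<bar>\<mu>\<bar>) * \<bar>F3 V x\<bar>"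
      by (simp add: power2_eq_square power3_eq_cube)
    also have "\<dots> \<le> \<alpha>\<^sup>2 * (K * x / real m) * \<bar>F3 V x\<bar>"
      by (intro mult_right_mono mult_left_mono \<alpha>\<mu>) auto
    also have "\<dots> = \<alpha>\<^sup>2 * K / real m * (\<bar>x\<bar> * \<bar>F3 V x\<bar>)" using x by simp
    also have "\<dots> \<le> \<alpha>\<^sup>2 * K / real m * (c / (v * sqrt v))"
      using F3 V32 K_ge_1 unfolding x_def by (intro mult_left_mono) auto
    also have "\<dots> = c / sqrt v * (K * (r / real m))" by (simp add: r_def mult_ac)
    also have "\<dots> \<le> c / sqrt v * (K\<^sup>2 * (r / real m))"
      using K2 r0 cv by (intro mult_left_mono mult_right_mono) auto
    finally show ?thesis .
  qed
  have T4: "\<alpha> ^ 4 * (c / (v\<^sup>2 * sqrt v)) \<le> c / sqrt v * (K\<^sup>2 * r\<^sup>2)"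
  proof -
    have "\<alpha> ^ 4 * (c / (v\<^sup>2 * sqrt v)) = c / sqrt v * (1 * r\<^sup>2)"
      by (simp add: r_def power_divide power_mult[symmetric] mult_ac)
    also have "\<dots> \<le> c / sqrt v * (K\<^sup>2 * r\<^sup>2)"
      using K2 cv by (intro mult_left_mono mult_right_mono) auto
    finally show ?thesis .
  qed
  have "step q m (\<lambda>t. F0 V (a (Suc m) * of_int t)) s =
      (1 + \<mu>) / 2 * F0 V (x + \<alpha> * (1 - \<mu>)) + (1 - \<mu>) / 2 * F0 V (x - \<alpha> * (1 + \<mu>))"
    unfolding step_def scaled_neighbours[OF m] x_def \<mu>_def \<alpha>_def ..
  then have "\<bar>step q m (\<lambda>t. F0 V (a (Suc m) * of_int t)) s - F0 (V + \<alpha>\<^sup>2) x\<bar>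
      \<le> (\<alpha> * \<mu>)\<^sup>2 * \<bar>F2 V x\<bar> + \<alpha> ^ 3 * \<bar>\<mu>\<bar> * \<bar>F3 V x\<bar> + \<alpha> ^ 4 * (c / (v\<^sup>2 * sqrt v))"
    using heat_step_error[of F0 F1 F2 F3 F4 V \<alpha> \<mu> x, OF dx dV V _ \<mu> C] \<alpha> by simp
  also have "\<dots> \<le> c / sqrt v * (K\<^sup>2 * min r (1 / (real m)\<^sup>2)) + c / sqrt v * (K\<^sup>2 * (r / real m)) + c / sqrt v * (K\<^sup>2 * r\<^sup>2)"
    by (intro add_mono T2 T3 T4)
  also have "\<dots> = c * K\<^sup>2 * rate v m / sqrt v"
    by (simp add: rate_def r_def \<alpha>_def algebra_simps add_divide_distrib)
  finally show ?thesis by (simp add: x_def \<alpha>_def)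
qed

lemma step_heat0_error:
  assumes m: "k < m" and s: "0 < s" "s \<le> int m" and v: "0 < v" "v \<le> V"
  shows "\<bar>step q m (\<lambda>t. heat0 V (a (Suc m) * of_int t)) s - heat0 (V + (a (Suc m))\<^sup>2) (a m * of_int s)\<bar>
     \<le> 14 * (1 + 2 * K) * K\<^sup>2 / sqrt v * rate v m * (a m * of_int s)"
proof -
  define x where "x = a m * of_int s"
  have V: "0 < V" using v by simp
  have x: "0 < x" unfolding x_def using a_pos m s by simp
  have \<alpha>: "a (Suc m) \<le> K * x"
  proof -
    have "a (Suc m) \<le> K * a m * 1" using a_growth[OF m] by simp
    also have "\<dots> \<le> K * a m * of_int s"
      using s a_pos[OF m] K_ge_1 by (intro mult_left_mono) auto
    finally show ?thesis by (simp add: x_def)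
  qed
  define c where "c = 14 * (1 + 2 * K) * x"
  have c: "5 * (1 + 2 * K) * x \<le> c" "3 * x \<le> c" "14 * x \<le> c" "0 \<le> c"
    unfolding c_def using x K_ge_1 by (auto intro!: mult_right_mono)
  have "\<bar>step q m (\<lambda>t. heat0 V (a (Suc m) * of_int t)) s - heat0 (V + (a (Suc m))\<^sup>2) (a m * of_int s)\<bar>
     \<le> c * K\<^sup>2 * rate v m / sqrt v"
  proof (rule step_heat_error[where ?F0.0=heat0 and ?F1.0=heat1 and ?F2.0=heat2 and ?F3.0=heat3 and ?F4.0=heat4,
        OF heat0_dx heat1_dx heat2_dx heat3_dx heat0_dV heat2_dV m s v c(4)])
    show "\<bar>heat2 V (a m * of_int s)\<bar> \<le> c / (V * sqrt V)"
      using heat2_bounds(1)[OF V, of x] c x V unfolding x_def[symmetric]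
      by (elim order_trans) (auto intro!: divide_right_mono)
    show "(a m * of_int s)\<^sup>2 * \<bar>heat2 V (a m * of_int s)\<bar> \<le> c / sqrt V"
      using heat2_bounds(2)[OF V, of x] c x V unfolding x_def[symmetric]
      by (elim order_trans) (auto intro!: divide_right_mono)
    show "\<bar>a m * of_int s\<bar> * \<bar>heat3 V (a m * of_int s)\<bar> \<le> c / (V * sqrt V)"
    proof -
      have "\<bar>x\<bar> * \<bar>heat3 V x\<bar> \<le> x * (3 / (V * sqrt V))"
        using x by (simp only: abs_of_pos) (intro mult_left_mono heat3_bounds(1) V, simp)
      also have "\<dots> \<le> c / (V * sqrt V)"
        using c V by (simp add: divide_right_mono mult.commute)
      finally show ?thesis by (simp add: x_def)
    qed
    fix U y assume U: "V \<le> U" and y: "\<bar>y - a m * of_int s\<bar> \<le> 2 * a (Suc m)"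
    have "\<bar>y\<bar> \<le> x + 2 * (K * x)" using y \<alpha> x unfolding x_def[symmetric] by linarith
    then have "5 * \<bar>y\<bar> \<le> 5 * (1 + 2 * K) * x" by (simp add: algebra_simps)
    then have "5 * \<bar>y\<bar> \<le> c" using c by linarith
    then have "5 * \<bar>y\<bar> / (U\<^sup>2 * sqrt U) \<le> c / (U\<^sup>2 * sqrt U)" using U V by (intro divide_right_mono) auto
    then show "\<bar>heat4 U y\<bar> \<le> c / (U\<^sup>2 * sqrt U)" using heat4_bounds(1)[of U y] U V by linarith
  qed
  then show ?thesis by (simp add: c_def x_def mult_ac)
qed

lemma step_heat1_error:
  assumes m: "k < m" and s: "0 < s" "s \<le> int m" and v: "0 < v" "v \<le> V"
  shows "\<bar>step q m (\<lambda>t. heat1 V (a (Suc m) * of_int t)) s - heat1 (V + (a (Suc m))\<^sup>2) (a m * of_int s)\<bar>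
     \<le> 23 * K\<^sup>2 / sqrt v * rate v m"
proof -
  have V: "0 < V" using v by simp
  have "\<bar>step q m (\<lambda>t. heat1 V (a (Suc m) * of_int t)) s - heat1 (V + (a (Suc m))\<^sup>2) (a m * of_int s)\<bar>
     \<le> 23 * K\<^sup>2 * rate v m / sqrt v"
  proof (rule step_heat_error[where ?F0.0=heat1 and ?F1.0=heat2 and ?F2.0=heat3 and ?F3.0=heat4 and ?F4.0=heat5,
        OF heat1_dx heat2_dx heat3_dx heat4_dx heat1_dV heat3_dV m s v])
    let ?x = "a m * of_int s"
    have le: "3 / (V * sqrt V) \<le> 23 / (V * sqrt V)" "10 / sqrt V \<le> 23 / sqrt V" "14 / (V * sqrt V) \<le> 23 / (V * sqrt V)"
      using V by (auto intro!: divide_right_mono)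
    show "\<bar>heat3 V ?x\<bar> \<le> 23 / (V * sqrt V)"
      by (rule order_trans[OF heat3_bounds(1)[OF V] le(1)])
    show "?x\<^sup>2 * \<bar>heat3 V ?x\<bar> \<le> 23 / sqrt V"
      by (rule order_trans[OF heat3_bounds(2)[OF V] le(2)])
    show "\<bar>?x\<bar> * \<bar>heat4 V ?x\<bar> \<le> 23 / (V * sqrt V)"
      by (rule order_trans[OF heat4_bounds(2)[OF V] le(3)])
    show "\<bar>heat5 U y\<bar> \<le> 23 / (U\<^sup>2 * sqrt U)" if "V \<le> U" for U y
      using that V by (intro heat5_bound) auto
  qed auto
  then show ?thesis by simp
qed

text \<open>
  The martingale property. No boundary term appears, since the height vanishes at \<open>0\<close>.
\<close>

lemma step_linear_weight:
  assumes "k < m" "0 < s"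
  shows "step q m (kill (\<lambda>t. a (Suc m) * of_int t)) s = a m * of_int s"
proof -
  have mean: "(1 + \<mu>) / 2 * (x + \<alpha> * (1 - \<mu>)) + (1 - \<mu>) / 2 * (x - \<alpha> * (1 + \<mu>)) = x" for \<mu> x \<alpha> :: real
    by (simp add: field_simps)
  have "step q m (kill (\<lambda>t. a (Suc m) * of_int t)) s = step q m (\<lambda>t. a (Suc m) * of_int t) s"
    using assms by (intro step_kill_pos) auto
  also have "\<dots> = a m * of_int s"
    unfolding step_def scaled_neighbours[OF assms(1)] by (rule mean)
  finally show ?thesis .
qed

text \<open>
  The errors of \<open>heat0\<close> are weighted with the height, which is harmonic for the killed chain, so they
  accumulate to a multiple of the initial height.
\<close>

lemma surv_heat0:
  assumes m: "k < m" and s: "0 < s" "s \<le> int m" and v: "0 < v"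
  shows "\<bar>surv q j m (\<lambda>t. heat0 v (a (m + j) * of_int t)) s - heat0 (A (m + j) - A m + v) (a m * of_int s)\<bar>
    \<le> 14 * (1 + 2 * K) * K\<^sup>2 / sqrt v * (\<Sum>i=m..<m + j. rate v i) * (a m * of_int s)"
proof -
  let ?C = "14 * (1 + 2 * K) * K\<^sup>2 / sqrt v"
  define \<Phi> where "\<Phi> i t = heat0 (A (m + j) - A i + v) (a i * of_int t)" for i and t :: int
  have C0: "0 \<le> ?C" using v K_ge_1 by simp
  have err: "\<bar>step q i (kill (\<Phi> (Suc i))) t - \<Phi> i t\<bar> \<le> ?C * rate v i * (a i * of_int t)"
    if "m \<le> i" "i < m + j" "0 < t" "t \<le> int i" for i t
  proof -
    have "A (Suc i) \<le> A (m + j)" using that by (intro A_mono) auto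
    moreover have "step q i (kill (\<Phi> (Suc i))) t = step q i (\<Phi> (Suc i)) t"
      using that by (intro step_kill_pos) (auto simp: \<Phi>_def heat0_def)
    moreover have "\<Phi> (Suc i) = (\<lambda>t. heat0 (A (m + j) - A (Suc i) + v) (a (Suc i) * of_int t))"
      by (simp add: \<Phi>_def fun_eq_iff)
    moreover have "\<Phi> i t = heat0 (A (m + j) - A (Suc i) + v + (a (Suc i))\<^sup>2) (a i * of_int t)"
      by (simp add: \<Phi>_def A_Suc algebra_simps)
    ultimately show ?thesis
      using step_heat0_error[of i t v "A (m + j) - A (Suc i) + v"] that m v by simp
  qed
  have w: "step q i (kill (\<lambda>t. a (Suc i) * of_int t)) t \<le> a i * of_int t"
    if "m \<le> i" "0 < t" for i t
    using step_linear_weight[of i t] that m by simp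
  have u: "surv q j m (\<Phi> (m + j)) s \<le> \<Phi> m s + (\<Sum>i=m..<m + j. ?C * rate v i) * (a m * of_int s)"
  proof (rule surv_le_supersolution[OF q_bound s])
    fix i t assume i: "m \<le> i" "i < m + j" "0 < t" "t \<le> int i"
    show "step q i (kill (\<Phi> (Suc i))) t \<le> \<Phi> i t + ?C * rate v i * (a i * of_int t)"
      using err[OF i] by linarith
    show "step q i (kill (\<lambda>t. a (Suc i) * of_int t)) t \<le> a i * of_int t"
      using w i by blast
  qed (use mult_nonneg_nonneg[OF C0 rate_nonneg[OF v]] in blast)+
  have l: "surv q j m (\<lambda>t. -1 * \<Phi> (m + j) t) s \<le> -1 * \<Phi> m s + (\<Sum>i=m..<m + j. ?C * rate v i) * (a m * of_int s)"
  proof (rule surv_le_supersolution[OF q_bound s, where \<Phi>="\<lambda>i t. -1 * \<Phi> i t"])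
    fix i t assume i: "m \<le> i" "i < m + j" "0 < t" "t \<le> int i"
    show "step q i (kill (\<lambda>t. -1 * \<Phi> (Suc i) t)) t \<le> -1 * \<Phi> i t + ?C * rate v i * (a i * of_int t)"
      unfolding step_cmult using err[OF i] by linarith
    show "step q i (kill (\<lambda>t. a (Suc i) * of_int t)) t \<le> a i * of_int t"
      using w i by blast
  qed (use mult_nonneg_nonneg[OF C0 rate_nonneg[OF v]] in blast)+
  have eq: "(\<Sum>i=m..<m + j. ?C * rate v i) = ?C * (\<Sum>i=m..<m + j. rate v i)"
    by (rule sum_distrib_left[symmetric])
  have fin: "\<Phi> (m + j) = (\<lambda>t. heat0 v (a (m + j) * of_int t))" by (simp add: \<Phi>_def fun_eq_iff)
  have "\<bar>surv q j m (\<Phi> (m + j)) s - \<Phi> m s\<bar> \<le> ?C * (\<Sum>i=m..<m + j. rate v i) * (a m * of_int s)"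
    using u l unfolding surv_cmult eq by linarith
  then show ?thesis unfolding fin by (simp add: \<Phi>_def)
qed

text \<open>
  For the Gaussian density only an upper bound is needed, and killing decreases positive functions.
  Hence the constant weight \<open>1\<close> is a valid superharmonic weight.
\<close>

lemma surv_heat1_le:
  assumes m: "k < m" and s: "0 < s" "s \<le> int m" and v: "0 < v"
  shows "surv q j m (\<lambda>t. heat1 v (a (m + j) * of_int t)) s
    \<le> heat1 (A (m + j) - A m + v) (a m * of_int s) + 23 * K\<^sup>2 / sqrt v * (\<Sum>i=m..<m + j. rate v i)"
proof -
  let ?C = "23 * K\<^sup>2 / sqrt v"
  define \<Phi> where "\<Phi> i t = heat1 (A (m + j) - A i + v) (a i * of_int t)" for i and t :: int
  have C0: "0 \<le> ?C" using v K_ge_1 by simp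
  have "surv q j m (\<Phi> (m + j)) s \<le> \<Phi> m s + (\<Sum>i=m..<m + j. ?C * rate v i) * 1"
  proof (rule surv_le_supersolution[OF q_bound s, where w="\<lambda>_ _. 1"])
    fix i t assume i: "m \<le> i" "i < m + j" "0 < t" "t \<le> int i"
    have W: "0 \<le> 1 + q * of_int t / real i" "0 \<le> 1 - q * of_int t / real i"
      using step_weights_nonneg[OF q_bound i(3,4)] by linarith+
    have AA: "A (Suc i) \<le> A (m + j)" using i by (intro A_mono) auto
    have "step q i (kill (\<Phi> (Suc i))) t \<le> step q i (\<Phi> (Suc i)) t"
      unfolding step_def kill_def using W AA v
      by (intro add_mono mult_left_mono) (auto simp: \<Phi>_def heat1_def)
    moreover have "\<Phi> (Suc i) = (\<lambda>t. heat1 (A (m + j) - A (Suc i) + v) (a (Suc i) * of_int t))"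
      by (simp add: \<Phi>_def fun_eq_iff)
    moreover have "\<Phi> i t = heat1 (A (m + j) - A (Suc i) + v + (a (Suc i))\<^sup>2) (a i * of_int t)"
      by (simp add: \<Phi>_def A_Suc algebra_simps)
    ultimately show "step q i (kill (\<Phi> (Suc i))) t \<le> \<Phi> i t + ?C * rate v i * 1"
      using step_heat1_error[of i t v "A (m + j) - A (Suc i) + v"] i m v AA by simp
    have "step q i (kill (\<lambda>_. 1)) t \<le> (1 + q * of_int t / real i) / 2 * 1 + (1 - q * of_int t / real i) / 2 * 1"
      unfolding step_def kill_def using W by (intro add_mono mult_left_mono) auto
    also have "\<dots> = 1" by (simp add: field_simps)
    finally show "step q i (kill (\<lambda>_. 1)) t \<le> 1" .
  qed (use mult_nonneg_nonneg[OF C0 rate_nonneg[OF v]] in blast)+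
  moreover have "\<Phi> (m + j) = (\<lambda>t. heat1 v (a (m + j) * of_int t))" by (simp add: \<Phi>_def fun_eq_iff)
  ultimately show ?thesis by (simp add: \<Phi>_def sum_distrib_left)
qed

end

section \<open>Upper and lower bounds for the probability of no return\<close>

lemma sum_inverse_squares_tail:
  assumes "1 \<le> M" "finite S" "\<And>i. i \<in> S \<Longrightarrow> M < i"
  shows "(\<Sum>i\<in>S. 1 / (real i)\<^sup>2) \<le> 1 / real M"
proof -
  have tel: "(\<Sum>i=Suc M..n. 1 / (real i)\<^sup>2) \<le> 1 / real M - 1 / real n" if "M \<le> n" for n
    using that
  proof (induction n rule: dec_induct)
    case (step n)
    have n: "0 < real n" using step assms(1) by simp
    then have "1 / (real (Suc n))\<^sup>2 \<le> 1 / (real n * real (Suc n))"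
      unfolding power2_eq_square by (intro divide_left_mono mult_right_mono) auto
    also have "\<dots> = 1 / real n - 1 / real (Suc n)"
      using n by (simp add: diff_divide_eq_iff divide_diff_eq_iff)
    finally have "1 / (real (Suc n))\<^sup>2 \<le> 1 / real n - 1 / real (Suc n)" .
    then show ?case using step by simp
  qed simp
  have "S \<subseteq> {Suc M..Max (insert M S)}"
    using assms by (auto simp: Suc_le_eq)
  then have "(\<Sum>i\<in>S. 1 / (real i)\<^sup>2) \<le> (\<Sum>i=Suc M..Max (insert M S). 1 / (real i)\<^sup>2)"
    by (intro sum_mono2) auto
  also have "\<dots> \<le> 1 / real M - 1 / real (Max (insert M S))"
    using assms(2) by (intro tel) auto
  also have "\<dots> \<le> 1 / real M" by simp
  finally show ?thesis .
qed

context walk_scaling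
begin

text \<open>
  With \<open>v = \<theta> * B\<close> the numbers \<open>r i = (a (i + 1))\<^sup>2 / v\<close> sum to at most \<open>1 / \<theta>\<close> and each is at most
  \<open>D / \<theta>\<close>. Up to the cut-off \<open>M\<close> the terms are estimated by the maximum \<open>D / \<theta>\<close>, beyond it by
  \<open>1 / i\<^sup>2\<close> and \<open>r i / M\<close>. The bound is small if first \<open>M\<close> is large and then \<open>D\<close> is small.
\<close>

lemma sum_rate_le:
  assumes D: "\<And>j. k < j \<Longrightarrow> j \<le> n \<Longrightarrow> (a j)\<^sup>2 \<le> D * B"
    and B: "B = A n - A k" "0 < B" and \<theta>: "0 < \<theta>" and M: "1 \<le> M" and m: "k < m" and D0: "0 \<le> D"
  shows "(\<Sum>i=m..<n. rate (\<theta> * B) i) \<le> 2 * real M * D / \<theta> + (1 + 1 / \<theta>) / real M + D / \<theta>\<^sup>2"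
proof -
  define r where "r i = (a (Suc i))\<^sup>2 / (\<theta> * B)" for i
  have r0: "0 \<le> r i" for i using \<theta> B by (simp add: r_def)
  have rD: "r i \<le> D / \<theta>" if "i \<in> {m..<n}" for i
  proof -
    have "(a (Suc i))\<^sup>2 \<le> D * B" using that m by (intro D) auto
    then have "(a (Suc i))\<^sup>2 / (\<theta> * B) \<le> D * B / (\<theta> * B)"
      using \<theta> B by (intro divide_right_mono) auto
    then show ?thesis using B by (simp add: r_def)
  qed
  have sum_r: "(\<Sum>i=m..<n. r i) \<le> 1 / \<theta>"
  proof (cases "m \<le> n")
    case True
    have "(\<Sum>i=m..<n. (a (Suc i))\<^sup>2) = A n - A m"
      using True by (induction n rule: dec_induct) (auto simp: A_Suc)
    also have "\<dots> \<le> B" unfolding B using A_mono[of k m] m by simp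
    finally have "(\<Sum>i=m..<n. (a (Suc i))\<^sup>2) / (\<theta> * B) \<le> B / (\<theta> * B)"
      using \<theta> B by (intro divide_right_mono) auto
    then show ?thesis using B \<theta> by (simp add: r_def sum_divide_distrib)
  qed (use \<theta> in auto)
  have D\<theta>: "0 \<le> D / \<theta>" using D0 \<theta> by simp
  have pointwise: "rate (\<theta> * B) i \<le> (if i \<le> M then 2 * D / \<theta> else 0) + (if M < i then 1 / (real i)\<^sup>2 else 0)
      + r i / real M + r i * (D / \<theta>)" if i: "i \<in> {m..<n}" for i
  proof -
    have i1: "1 \<le> real i" using i m by simp
    have sq: "(r i)\<^sup>2 \<le> r i * (D / \<theta>)"
      unfolding power2_eq_square by (intro mult_left_mono rD r0 i)
    have M0: "0 \<le> r i / real M" using r0 by simp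
    have rate: "rate (\<theta> * B) i = min (r i) (1 / (real i)\<^sup>2) + r i / real i + (r i)\<^sup>2"
      by (simp add: rate_def r_def)
    show ?thesis
    proof (cases "i \<le> M")
      case True
      have "r i / real i \<le> r i / 1" using i1 r0 by (intro divide_left_mono) auto
      then have "r i / real i \<le> D / \<theta>" "min (r i) (1 / (real i)\<^sup>2) \<le> D / \<theta>"
        using rD[OF i] by auto
      then show ?thesis unfolding rate using True sq M0 by simp
    next
      case False
      have "r i / real i \<le> r i / real M" using False M r0 by (intro divide_left_mono) auto
      moreover have "min (r i) (1 / (real i)\<^sup>2) \<le> 1 / (real i)\<^sup>2" by simp
      ultimately show ?thesis unfolding rate using False sq by simp
    qed
  qed
  have s1: "(\<Sum>i=m..<n. (if i \<le> M then 2 * D / \<theta> else 0)) \<le> real M * (2 * D / \<theta>)"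
  proof -
    have "(\<Sum>i=m..<n. (if i \<le> M then 2 * D / \<theta> else 0)) = (\<Sum>i\<in>{i\<in>{m..<n}. i \<le> M}. 2 * D / \<theta>)"
      by (rule sum.inter_filter[symmetric]) simp
    also have "\<dots> = real (card {i\<in>{m..<n}. i \<le> M}) * (2 * D / \<theta>)" by simp
    also have "card {i\<in>{m..<n}. i \<le> M} \<le> card {1..M}" using m by (intro card_mono) auto
    then have "real (card {i\<in>{m..<n}. i \<le> M}) * (2 * D / \<theta>) \<le> real M * (2 * D / \<theta>)"
      using D\<theta> by (intro mult_right_mono) auto
    finally show ?thesis .
  qed
  have s2: "(\<Sum>i=m..<n. (if M < i then 1 / (real i)\<^sup>2 else 0)) \<le> 1 / real M"
  proof -
    have "(\<Sum>i=m..<n. (if M < i then 1 / (real i)\<^sup>2 else 0)) = (\<Sum>i\<in>{i\<in>{m..<n}. M < i}. 1 / (real i)\<^sup>2)"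
      by (rule sum.inter_filter[symmetric]) simp
    also have "\<dots> \<le> 1 / real M" using M by (intro sum_inverse_squares_tail) auto
    finally show ?thesis .
  qed
  have s3: "(\<Sum>i=m..<n. r i / real M) \<le> 1 / \<theta> / real M"
    unfolding sum_divide_distrib[symmetric] by (intro divide_right_mono sum_r) simp
  have s4: "(\<Sum>i=m..<n. r i * (D / \<theta>)) \<le> 1 / \<theta> * (D / \<theta>)"
    unfolding sum_distrib_right[symmetric] by (intro mult_right_mono sum_r D\<theta>)
  have "(\<Sum>i=m..<n. rate (\<theta> * B) i) \<le> (\<Sum>i=m..<n. (if i \<le> M then 2 * D / \<theta> else 0)
      + (if M < i then 1 / (real i)\<^sup>2 else 0) + r i / real M + r i * (D / \<theta>))"
    by (intro sum_mono pointwise)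
  also have "\<dots> \<le> real M * (2 * D / \<theta>) + 1 / real M + 1 / \<theta> / real M + 1 / \<theta> * (D / \<theta>)"
    unfolding sum.distrib by (intro add_mono s1 s2 s3 s4)
  also have "\<dots> = 2 * real M * D / \<theta> + (1 + 1 / \<theta>) / real M + D / \<theta>\<^sup>2"
    by (simp add: power2_eq_square add_divide_distrib)
  finally show ?thesis .
qed

text \<open>
  Started at \<open>0\<close> at time \<open>k\<close>, this is the probability of \<open>R > n\<close>.
\<close>

definition noreturn :: "nat \<Rightarrow> real" where "noreturn n = surv q n k (\<lambda>_. 1) 0"

lemma noreturn_Suc: "noreturn (Suc j) = surv q j (Suc k) (\<lambda>_. 1) 1"
proof -
  have "surv q j (Suc k) (\<lambda>_. 1) (-1) = surv q j (Suc k) (\<lambda>_. 1) 1"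
    by (rule surv_even) simp
  then show ?thesis by (simp add: noreturn_def step_def kill_def)
qed

lemma noreturn_nonneg: "1 \<le> n \<Longrightarrow> 0 \<le> noreturn n"
  by (cases n) (auto simp: noreturn_Suc intro!: surv_nonneg q_bound)

lemma noreturn_le_1: "1 \<le> n \<Longrightarrow> noreturn n \<le> 1"
  by (cases n) (auto simp: noreturn_Suc intro!: surv_le_1 q_bound)

definition err_const :: real where "err_const = 14 * (1 + 2 * K) * K\<^sup>2"

lemma err_const_pos: "0 < err_const"
  using K_ge_1 by (auto simp: err_const_def intro!: mult_pos_pos)

lemma A_diff_pos: "1 \<le> n \<Longrightarrow> 0 < A (k + n) - A k"
proof -
  assume "1 \<le> n"
  then have "A (Suc k) \<le> A (k + n)" by (intro A_mono) auto
  moreover have "0 < (a (Suc k))\<^sup>2" using a_pos[of "Suc k"] by simp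
  ultimately show ?thesis unfolding A_Suc by linarith
qed

text \<open>
  At the final time the normalised \<open>heat0\<close> is at most \<open>1\<close>. At the initial time its argument is
  approximately \<open>a (k + 1) / sqrt (B * (1 + \<theta>))\<close>, and it is almost linear there.
\<close>

lemma noreturn_lower:
  assumes n: "1 \<le> n" and B: "B = A (k + n) - A k"
    and \<theta>: "0 < \<theta>" and D: "(a (Suc k))\<^sup>2 \<le> \<rho> * B"
    and E: "(\<Sum>i=Suc k..<k + n. rate (\<theta> * B) i) \<le> \<rho>"
  shows "sqrt (2 / pi) * ((1 - \<rho> / 2) / sqrt (1 + \<theta>) - err_const * \<rho> / sqrt \<theta>) \<le> sqrt B / a (Suc k) * noreturn n"
proof -
  obtain j where j: "n = Suc j" using n by (cases n) auto
  have B0: "0 < B" unfolding B by (rule A_diff_pos[OF n])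
  define \<alpha> where "\<alpha> = a (Suc k)"
  have \<alpha>: "0 < \<alpha>" using a_pos[of "Suc k"] by (simp add: \<alpha>_def)
  define v where "v = \<theta> * B"
  have v: "0 < v" using \<theta> B0 by (simp add: v_def)
  let ?h = "\<lambda>t::int. heat0 v (a (Suc k + j) * of_int t)"
  \<comment> \<open>the variance left after the first step away from the origin\<close>
  define V where "V = A (Suc k + j) - A (Suc k) + v"
  have V: "V \<le> B * (1 + \<theta>)" "0 < V"
    using A_mono[of "Suc k" "Suc k + j"] v
    by (auto simp: V_def v_def B j A_Suc algebra_simps)
  define z where "z = \<alpha> / sqrt (B * (1 + \<theta>))"
  have z0: "0 \<le> z" using \<alpha> B0 \<theta> by (simp add: z_def)
  have pi: "sqrt (2 / pi) * sqrt (pi / 2) = 1"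
    by (simp add: real_sqrt_mult[symmetric])
  have "z * (1 - \<rho> / 2) \<le> z * (1 - z\<^sup>2 / 2)"
  proof (intro mult_left_mono z0)
    have "z\<^sup>2 = \<alpha>\<^sup>2 / (B * (1 + \<theta>))" using B0 \<theta> by (simp add: z_def power_divide)
    also have "\<dots> \<le> \<alpha>\<^sup>2 / (B * 1)" using B0 \<theta> by (intro divide_left_mono mult_left_mono) auto
    also have "\<dots> \<le> \<rho>" using D B0 by (simp add: \<alpha>_def divide_le_eq)
    finally show "1 - \<rho> / 2 \<le> 1 - z\<^sup>2 / 2" by simp
  qed
  also have "\<dots> \<le> gauss_int z" by (rule gauss_int_ge[OF z0])
  also have "\<dots> \<le> heat0 V \<alpha>"
    unfolding heat0_def z_def using V \<alpha> B0 \<theta> by (intro gauss_int_mono divide_left_mono) auto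
  finally have 1: "z * (1 - \<rho> / 2) \<le> heat0 V \<alpha>" .
  have "heat0 V \<alpha> - err_const / sqrt v * \<rho> * \<alpha> \<le> heat0 V \<alpha> - err_const / sqrt v * (\<Sum>i=Suc k..<Suc k + j. rate v i) * \<alpha>"
    using E err_const_pos v \<alpha> unfolding j by (intro diff_left_mono mult_right_mono mult_left_mono) (auto simp: v_def)
  also have "\<dots> \<le> surv q j (Suc k) ?h 1"
    using surv_heat0[of "Suc k" 1 v j] v by (simp add: V_def \<alpha>_def err_const_def abs_le_iff)
  finally have 2: "heat0 V \<alpha> - err_const / sqrt v * \<rho> * \<alpha> \<le> surv q j (Suc k) ?h 1" .
  have "sqrt (2 / pi) * surv q j (Suc k) ?h 1 = surv q j (Suc k) (\<lambda>t. sqrt (2 / pi) * ?h t) 1"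
    by (rule surv_cmult[symmetric])
  also have "\<dots> \<le> surv q j (Suc k) (\<lambda>_. 1) 1"
  proof (intro surv_mono q_bound)
    fix t :: int
    have "sqrt (2 / pi) * ?h t \<le> sqrt (2 / pi) * sqrt (pi / 2)"
      unfolding heat0_def by (intro mult_left_mono gauss_int_upper) simp
    then show "sqrt (2 / pi) * ?h t \<le> 1" unfolding pi .
  qed auto
  finally have 3: "sqrt (2 / pi) * surv q j (Suc k) ?h 1 \<le> noreturn n" by (simp add: j noreturn_Suc)
  have "z * (1 - \<rho> / 2) - err_const / sqrt v * \<rho> * \<alpha> \<le> surv q j (Suc k) ?h 1"
    using 1 2 by simp
  then have "sqrt (2 / pi) * (z * (1 - \<rho> / 2) - err_const / sqrt v * \<rho> * \<alpha>) \<le> noreturn n"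
    by (intro order_trans[OF mult_left_mono 3]) auto
  then have "sqrt B / \<alpha> * (sqrt (2 / pi) * (z * (1 - \<rho> / 2) - err_const / sqrt v * \<rho> * \<alpha>)) \<le> sqrt B / \<alpha> * noreturn n"
    using B0 \<alpha> by (intro mult_left_mono) auto
  moreover have "sqrt B / \<alpha> * (sqrt (2 / pi) * (z * (1 - \<rho> / 2) - err_const / sqrt v * \<rho> * \<alpha>))
     = sqrt (2 / pi) * ((1 - \<rho> / 2) / sqrt (1 + \<theta>) - err_const * \<rho> / sqrt \<theta>)"
  proof -
    have b: "sqrt B / \<alpha> * z = 1 / sqrt (1 + \<theta>)" "sqrt B / \<alpha> * (err_const / sqrt v * \<rho> * \<alpha>) = err_const * \<rho> / sqrt \<theta>"
      using B0 \<alpha> \<theta> by (simp_all add: z_def v_def real_sqrt_mult)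
    have "sqrt B / \<alpha> * (sqrt (2 / pi) * (z * (1 - \<rho> / 2) - err_const / sqrt v * \<rho> * \<alpha>))
      = sqrt (2 / pi) * ((sqrt B / \<alpha> * z) * (1 - \<rho> / 2) - sqrt B / \<alpha> * (err_const / sqrt v * \<rho> * \<alpha>))"
      by (simp add: right_diff_distrib mult_ac)
    then show ?thesis unfolding b by simp
  qed
  ultimately show ?thesis by (simp add: \<alpha>_def)
qed

lemma half_variance_time:
  assumes n: "1 \<le> n" and B: "B = A (k + n) - A k"
    and D: "\<And>j. k < j \<Longrightarrow> j \<le> k + n \<Longrightarrow> (a j)\<^sup>2 \<le> B / 4"
  obtains l where "1 \<le> l" "l < n" "B / 4 \<le> A (k + l) - A k" "A (k + l) - A k \<le> B / 2"
proof -
  have B0: "0 < B" unfolding B by (rule A_diff_pos[OF n])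
  \<comment> \<open>the first time at which more than half of the variance is spent; one step earlier is \<open>l\<close>\<close>
  define i where "i = (LEAST i. B / 2 < A (k + i) - A k)"
  have ex: "B / 2 < A (k + n) - A k" using B0 B by simp
  have i: "B / 2 < A (k + i) - A k" unfolding i_def by (rule LeastI[of _ n]) (rule ex)
  have "i \<le> n" unfolding i_def by (rule Least_le) (rule ex)
  have "i \<noteq> 0" using i B0 by (intro notI) simp
  then obtain l where l: "i = Suc l" by (cases i) auto
  have half: "A (k + l) - A k \<le> B / 2"
    using not_less_Least[of l "\<lambda>i. B / 2 < A (k + i) - A k"] l unfolding i_def by simp
  have "(a (Suc (k + l)))\<^sup>2 \<le> B / 4" using l \<open>i \<le> n\<close> by (intro D) auto
  then have quarter: "B / 4 \<le> A (k + l) - A k" using i unfolding l by (simp add: A_Suc)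
  then have "l \<noteq> 0" using B0 by (intro notI) simp
  then show ?thesis using that[of l] half quarter l \<open>i \<le> n\<close> by simp
qed

text \<open>
  Anti-concentration: over the second half of the variance the walk spreads over a range of order
  \<open>sqrt B\<close>, so a window of size \<open>\<epsilon> * sqrt B\<close> has probability of order \<open>\<epsilon>\<close>. The indicator of the window is
  dominated by a multiple of \<open>heat1\<close> with the variance \<open>\<epsilon>\<^sup>2 * B\<close> of the window.
\<close>

lemma surv_near_zero_le:
  assumes l: "1 \<le> l" "l < n" and B: "B = A (k + n) - A k" and half: "A (k + l) - A k \<le> B / 2"
    and \<epsilon>: "0 < \<epsilon>" and t: "0 < t" "t \<le> int (k + l)"
    and E: "(\<Sum>i=k + l..<k + n. rate (\<epsilon>\<^sup>2 * B) i) \<le> \<rho>"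
  shows "surv q (n - l) (k + l) (\<lambda>t. if a (k + n) * of_int t \<le> \<epsilon> * sqrt B then 1 else 0) t
    \<le> 3 * \<epsilon> + 46 * K\<^sup>2 * \<rho>"
proof -
  have B0: "0 < B" unfolding B using l by (intro A_diff_pos) auto
  define w where "w = \<epsilon>\<^sup>2 * B"
  have w: "0 < w" "sqrt w = \<epsilon> * sqrt B" using \<epsilon> B0 by (auto simp: w_def real_sqrt_mult)
  have n: "k + l + (n - l) = k + n" using l by simp
  have e2: "1 \<le> 2 * exp (- (1 / 2) :: real)"
  proof -
    have "exp (1 / 2 :: real) * exp (1 / 2) = exp 1" by (simp add: exp_add[symmetric])
    then have "(exp (1 / 2 :: real))\<^sup>2 \<le> 2\<^sup>2" using exp_le by (simp add: power2_eq_square)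
    then have "exp (1 / 2 :: real) \<le> 2" by (rule power2_le_imp_le) simp
    then show ?thesis by (simp add: exp_minus field_simps)
  qed
  let ?h = "\<lambda>t::int. heat1 w (a (k + n) * of_int t)"
  have le: "(if a (k + n) * of_int t \<le> \<epsilon> * sqrt B then 1 else 0) \<le> 2 * \<epsilon> * sqrt B * ?h t" if t: "0 < t" for t :: int
  proof (cases "a (k + n) * of_int t \<le> \<epsilon> * sqrt B")
    case True
    define x where "x = a (k + n) * of_int t"
    have x: "0 \<le> x" using t a_pos[of "k + n"] l by (simp add: x_def)
    have "x\<^sup>2 \<le> (\<epsilon> * sqrt B)\<^sup>2" using True x unfolding x_def by (intro power_mono) auto
    then have "x\<^sup>2 \<le> w" using B0 by (simp add: w_def power_mult_distrib)
    then have "- (1 / 2) \<le> - (x\<^sup>2) / (2 * w)" using w by (simp add: field_simps)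
    then have "exp (- (1 / 2)) \<le> exp (- (x\<^sup>2) / (2 * w))" by simp
    then have "1 \<le> 2 * exp (- (x\<^sup>2) / (2 * w))" using e2 by linarith
    also have "\<dots> = 2 * \<epsilon> * sqrt B * heat1 w x"
      using \<epsilon> B0 by (simp add: heat1_def w(2))
    finally show ?thesis using True by (simp add: x_def)
  next
    case False
    then show ?thesis using \<epsilon> B0 w by (simp add: heat1_def)
  qed
  have "surv q (n - l) (k + l) (\<lambda>t. if a (k + n) * of_int t \<le> \<epsilon> * sqrt B then 1 else 0) t
      \<le> surv q (n - l) (k + l) (\<lambda>t. 2 * \<epsilon> * sqrt B * ?h t) t"
    by (intro surv_mono q_bound t le)
  also have "\<dots> = 2 * \<epsilon> * sqrt B * surv q (n - l) (k + l) ?h t"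
    by (rule surv_cmult)
  also have "\<dots> \<le> 2 * \<epsilon> * sqrt B * (1 / sqrt (B / 2) + 23 * K\<^sup>2 / sqrt w * \<rho>)"
  proof (intro mult_left_mono)
    have "surv q (n - l) (k + l) ?h t \<le> heat1 (A (k + n) - A (k + l) + w) (a (k + l) * of_int t)
       + 23 * K\<^sup>2 / sqrt w * (\<Sum>i=k + l..<k + n. rate w i)"
      using surv_heat1_le[of "k + l" t w "n - l"] l t w(1) unfolding n by simp
    also have "\<dots> \<le> 1 / sqrt (B / 2) + 23 * K\<^sup>2 / sqrt w * \<rho>"
    proof (intro add_mono mult_left_mono)
      have V: "B / 2 \<le> A (k + n) - A (k + l) + w" using half w B by simp
      have "heat1 (A (k + n) - A (k + l) + w) (a (k + l) * of_int t) \<le> 1 / sqrt (A (k + n) - A (k + l) + w)"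
        unfolding heat1_def using V B0 by (intro divide_right_mono) (auto simp: divide_nonpos_pos)
      also have "\<dots> \<le> 1 / sqrt (B / 2)"
        using V B0 by (intro divide_left_mono) auto
      finally show "heat1 (A (k + n) - A (k + l) + w) (a (k + l) * of_int t) \<le> 1 / sqrt (B / 2)" .
      show "(\<Sum>i=k + l..<k + n. rate w i) \<le> \<rho>" using E by (simp add: w_def)
    qed (use w(1) in auto)
    finally show "surv q (n - l) (k + l) ?h t \<le> 1 / sqrt (B / 2) + 23 * K\<^sup>2 / sqrt w * \<rho>" .
  qed (use \<epsilon> B0 in auto)
  also have "\<dots> = 2 * sqrt 2 * \<epsilon> + 46 * K\<^sup>2 * \<rho>"
    using \<epsilon> B0 by (simp add: w(2) real_sqrt_divide field_simps)
  also have "\<dots> \<le> 3 * \<epsilon> + 46 * K\<^sup>2 * \<rho>"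
  proof -
    have "sqrt 2 \<le> 3 / 2" by (rule real_le_lsqrt) (auto simp: power2_eq_square)
    then have "2 * sqrt 2 * \<epsilon> \<le> 3 * \<epsilon>" using \<epsilon> by (intro mult_right_mono) auto
    then show ?thesis by simp
  qed
  finally show ?thesis .
qed

text \<open>
  The extra variance \<open>\<epsilon> ^ 4 * B\<close> for \<open>heat0\<close> is so small that at heights above \<open>\<epsilon> * sqrt B\<close> the argument
  of \<open>gauss_int\<close> exceeds \<open>1 / \<epsilon>\<close>. Lower heights are treated by \<open>surv_near_zero_le\<close>, after splitting the
  time at \<open>k + l\<close>; the factor \<open>2\<close> accounts for \<open>B \<le> 4 * (A (k + l) - A k)\<close>.
\<close>

lemma noreturn_upper:
  assumes n: "1 \<le> n" and B: "B = A (k + n) - A k"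
    and \<epsilon>: "0 < \<epsilon>" and \<rho>: "\<rho> \<le> \<epsilon> ^ 4" "\<rho> \<le> 1 / 4"
    and D: "\<And>j. k < j \<Longrightarrow> j \<le> k + n \<Longrightarrow> (a j)\<^sup>2 \<le> \<rho> * B"
    and E1: "(\<Sum>i=Suc k..<k + n. rate (\<epsilon> ^ 4 * B) i) \<le> \<rho>"
    and E2: "\<And>m. k < m \<Longrightarrow> (\<Sum>i=m..<k + n. rate (\<epsilon>\<^sup>2 * B) i) \<le> \<rho>"
  obtains l where "1 \<le> l" "l < n"
    "sqrt B / a (Suc k) * noreturn n \<le> (1 + err_const * \<rho> / \<epsilon>\<^sup>2) / gauss_int (1 / \<epsilon>)
       + 2 * (3 * \<epsilon> + 46 * K\<^sup>2 * \<rho>) * (sqrt (A (k + l) - A k) / a (Suc k) * noreturn l)"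
proof -
  have B0: "0 < B" unfolding B by (rule A_diff_pos[OF n])
  have D4: "(a j)\<^sup>2 \<le> B / 4" if "k < j" "j \<le> k + n" for j
    using D[OF that] mult_right_mono[OF \<rho>(2), of B] B0 by linarith
  obtain l where l: "1 \<le> l" "l < n" "B / 4 \<le> A (k + l) - A k" "A (k + l) - A k \<le> B / 2"
    by (rule half_variance_time[OF n B D4])
  define \<eta> where "\<eta> = 3 * \<epsilon> + 46 * K\<^sup>2 * \<rho>"
  obtain j where j: "n = Suc j" using n by (cases n) auto
  obtain i where i: "l = Suc i" using l by (cases l) auto
  define \<alpha> where "\<alpha> = a (Suc k)"
  have \<alpha>: "0 < \<alpha>" using a_pos[of "Suc k"] by (simp add: \<alpha>_def)
  have \<alpha>2: "\<alpha>\<^sup>2 \<le> \<epsilon> ^ 4 * B"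
  proof -
    have "\<alpha>\<^sup>2 \<le> \<rho> * B" unfolding \<alpha>_def using n by (intro D) auto
    then show ?thesis using mult_right_mono[OF \<rho>(1), of B] B0 by linarith
  qed
  have \<rho>0: "0 \<le> \<rho>"
  proof -
    have "0 < \<alpha>\<^sup>2" using \<alpha> by simp
    also have "\<alpha>\<^sup>2 \<le> \<rho> * B" unfolding \<alpha>_def using n by (intro D) auto
    finally show ?thesis using B0 by (simp add: zero_less_mult_iff)
  qed
  have \<eta>0: "0 \<le> \<eta>" using \<epsilon> \<rho>0 by (simp add: \<eta>_def)
  define v where "v = \<epsilon> ^ 4 * B"
  have sq4: "sqrt (\<epsilon> ^ 4) = \<epsilon>\<^sup>2"
    using \<epsilon> by (intro real_sqrt_unique) (auto simp: power_mult[symmetric])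
  have v: "0 < v" "sqrt v = \<epsilon>\<^sup>2 * sqrt B" using \<epsilon> B0 by (auto simp: v_def real_sqrt_mult sq4)
  let ?h = "\<lambda>t::int. heat0 v (a (k + n) * of_int t)"
  let ?f = "\<lambda>t::int. if a (k + n) * of_int t \<le> \<epsilon> * sqrt B then 1 else (0::real)"
  define g where "g = gauss_int (1 / \<epsilon>)"
  have g: "0 < g"
  proof -
    have "0 < min 1 (1 / \<epsilon>) * (1 - (min 1 (1 / \<epsilon>))\<^sup>2 / 2)"
    proof (intro mult_pos_pos)
      have "(min 1 (1 / \<epsilon>))\<^sup>2 \<le> 1\<^sup>2" using \<epsilon> by (intro power_mono) auto
      then show "0 < 1 - (min 1 (1 / \<epsilon>))\<^sup>2 / 2" by simp
    qed (use \<epsilon> in auto)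
    also have "\<dots> \<le> gauss_int (min 1 (1 / \<epsilon>))" using \<epsilon> by (intro gauss_int_ge) auto
    also have "\<dots> \<le> g" unfolding g_def by (intro gauss_int_mono) auto
    finally show ?thesis .
  qed
  \<comment> \<open>either the final height is large and \<open>heat0\<close> is nearly maximal, or it lies in the window\<close>
  have cover: "1 \<le> 1 / g * ?h t + ?f t" if t: "0 < t" for t :: int
  proof -
    have x: "0 < a (k + n) * of_int t" using t a_pos[of "k + n"] n by simp
    then have "0 \<le> gauss_int (a (k + n) * of_int t / sqrt v)"
      using gauss_int_mono[of 0 "a (k + n) * of_int t / sqrt v"] v(1) by simp
    then have h0: "0 \<le> 1 / g * ?h t" unfolding heat0_def using g by simp
    show ?thesis
    proof (cases "a (k + n) * of_int t \<le> \<epsilon> * sqrt B")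
      case False
      have "1 / \<epsilon> = \<epsilon> * sqrt B / sqrt v" using \<epsilon> B0 by (simp add: v(2) power2_eq_square)
      also have "\<dots> \<le> a (k + n) * of_int t / sqrt v" using False v(1) by (intro divide_right_mono) simp_all
      finally have "g \<le> ?h t" unfolding g_def heat0_def by (rule gauss_int_mono)
      then show ?thesis using False g by simp
    qed (use h0 in simp)
  qed
  have "noreturn n = surv q j (Suc k) (\<lambda>_. 1) 1" by (simp add: j noreturn_Suc)
  also have "\<dots> \<le> surv q j (Suc k) (\<lambda>t. 1 / g * ?h t + ?f t) 1"
    by (intro surv_mono q_bound cover) auto
  also have "\<dots> = 1 / g * surv q j (Suc k) ?h 1 + surv q j (Suc k) ?f 1"
    unfolding surv_add surv_cmult ..
  finally have split: "noreturn n \<le> 1 / g * surv q j (Suc k) ?h 1 + surv q j (Suc k) ?f 1" .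
  define V where "V = A (k + n) - A (Suc k) + v"
  have V: "B \<le> V" using \<alpha>2 by (simp add: V_def v_def B A_Suc \<alpha>_def)
  have part1: "surv q j (Suc k) ?h 1 \<le> \<alpha> / sqrt B * (1 + err_const * \<rho> / \<epsilon>\<^sup>2)"
  proof -
    have "surv q j (Suc k) ?h 1 \<le> heat0 V \<alpha> + err_const / sqrt v * (\<Sum>i=Suc k..<k + n. rate v i) * \<alpha>"
      using surv_heat0[of "Suc k" 1 v j] v by (simp add: V_def \<alpha>_def err_const_def abs_le_iff j)
    also have "heat0 V \<alpha> \<le> \<alpha> / sqrt V"
      unfolding heat0_def using \<alpha> V B0 by (intro gauss_int_le) auto
    also have "\<alpha> / sqrt V \<le> \<alpha> / sqrt B" using V B0 \<alpha> by (intro divide_left_mono) auto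
    also have "err_const / sqrt v * (\<Sum>i=Suc k..<k + n. rate v i) * \<alpha> \<le> err_const / sqrt v * \<rho> * \<alpha>"
      using E1 err_const_pos v(1) \<alpha> by (intro mult_right_mono mult_left_mono) (auto simp: v_def)
    also have "\<alpha> / sqrt B + err_const / sqrt v * \<rho> * \<alpha> = \<alpha> / sqrt B * (1 + err_const * \<rho> / \<epsilon>\<^sup>2)"
      unfolding v(2) by (simp add: algebra_simps)
    finally show ?thesis by simp
  qed
  have part2: "surv q j (Suc k) ?f 1 \<le> \<eta> * noreturn l"
  proof -
    have ji: "i + (n - l) = j" and kl: "Suc k + i = k + l" using l i j by auto
    have "surv q j (Suc k) ?f 1 = surv q i (Suc k) (surv q (n - l) (k + l) ?f) 1"
      using surv_semigroup[of q i "n - l" "Suc k" ?f 1] unfolding ji kl .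
    also have "\<dots> \<le> surv q i (Suc k) (\<lambda>t. \<eta> * 1) 1"
    proof (intro surv_mono q_bound)
      fix t assume "0 < t" "t \<le> int (Suc k + i)"
      then show "surv q (n - l) (k + l) ?f t \<le> \<eta> * 1"
        using surv_near_zero_le[OF l(1,2) B l(4) \<epsilon> _ _ E2, of t] l i by (simp add: \<eta>_def)
    qed auto
    also have "\<dots> = \<eta> * noreturn l" unfolding surv_cmult by (simp add: i noreturn_Suc)
    finally show ?thesis .
  qed
  have "noreturn n \<le> 1 / g * (\<alpha> / sqrt B * (1 + err_const * \<rho> / \<epsilon>\<^sup>2)) + \<eta> * noreturn l"
    using split part2 mult_left_mono[OF part1, of "1 / g"] g by simp
  then have "sqrt B / \<alpha> * noreturn n \<le> sqrt B / \<alpha> * (1 / g * (\<alpha> / sqrt B * (1 + err_const * \<rho> / \<epsilon>\<^sup>2)) + \<eta> * noreturn l)"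
    using B0 \<alpha> by (intro mult_left_mono) auto
  also have "\<dots> = (1 + err_const * \<rho> / \<epsilon>\<^sup>2) / g + \<eta> * noreturn l * (sqrt B / \<alpha>)"
    using B0 \<alpha> by (simp add: distrib_left mult_ac add_divide_distrib)
  also have "\<dots> \<le> (1 + err_const * \<rho> / \<epsilon>\<^sup>2) / g + \<eta> * noreturn l * (2 * sqrt (A (k + l) - A k) / \<alpha>)"
  proof (intro add_left_mono mult_left_mono divide_right_mono)
    have "sqrt B \<le> sqrt (4 * (A (k + l) - A k))" using l by simp
    also have "\<dots> = 2 * sqrt (A (k + l) - A k)" unfolding real_sqrt_mult by simp
    finally show "sqrt B \<le> 2 * sqrt (A (k + l) - A k)" .
  qed (use \<alpha> \<eta>0 noreturn_nonneg[OF l(1)] in auto)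
  finally have "sqrt B / \<alpha> * noreturn n \<le> (1 + err_const * \<rho> / \<epsilon>\<^sup>2) / g
      + 2 * \<eta> * (sqrt (A (k + l) - A k) / \<alpha> * noreturn l)"
    by (simp add: mult_ac)
  then show ?thesis using that[of l] l by (simp add: \<eta>_def g_def \<alpha>_def)
qed

end

section \<open>The uniform limit\<close>

context walk_scaling
begin

lemma a_le_geometric: "a (Suc k + i) \<le> K ^ i * a (Suc k)"
proof (induction i)
  case (Suc i)
  have "a (Suc (Suc k + i)) \<le> K * a (Suc k + i)" by (rule a_growth) simp
  also have "\<dots> \<le> K * (K ^ i * a (Suc k))" using Suc K_ge_1 by (intro mult_left_mono) auto
  finally show ?case by simp
qed simp

definition scaled_noreturn :: "nat \<Rightarrow> real" where
  "scaled_noreturn n = sqrt (A (k + n) - A k) / a (Suc k) * noreturn n"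

text \<open>
  A bound without asymptotic content. It starts the recursion for the finitely many small \<open>n\<close>, uniformly
  in \<open>k\<close>.
\<close>

lemma scaled_noreturn_crude:
  assumes n: "1 \<le> n" shows "scaled_noreturn n \<le> real n * K ^ n"
proof -
  define \<alpha> where "\<alpha> = a (Suc k)"
  have \<alpha>: "0 < \<alpha>" using a_pos[of "Suc k"] by (simp add: \<alpha>_def)
  have "A (k + i) - A k \<le> real i * (K ^ n * \<alpha>)\<^sup>2" if "i \<le> n" for i
    using that
  proof (induction i)
    case (Suc i)
    have "a (Suc (k + i)) \<le> K ^ i * \<alpha>" using a_le_geometric[of i] by (simp add: \<alpha>_def)
    also have "\<dots> \<le> K ^ n * \<alpha>"
      using Suc.prems K_ge_1 \<alpha> by (intro mult_right_mono power_increasing) auto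
    finally have "(a (Suc (k + i)))\<^sup>2 \<le> (K ^ n * \<alpha>)\<^sup>2"
      using a_pos[of "Suc (k + i)"] by (intro power_mono) auto
    then show ?case using Suc by (simp add: A_Suc distrib_right)
  qed simp
  from this[of n] have "A (k + n) - A k \<le> real n * (K ^ n * \<alpha>)\<^sup>2" by simp
  also have "\<dots> \<le> (real n)\<^sup>2 * (K ^ n * \<alpha>)\<^sup>2"
    using n by (intro mult_right_mono) (auto simp: power2_eq_square)
  also have "\<dots> = (real n * K ^ n * \<alpha>)\<^sup>2" by (simp add: power_mult_distrib)
  finally have "sqrt (A (k + n) - A k) \<le> real n * K ^ n * \<alpha>"
    using K_ge_1 \<alpha> by (intro real_le_lsqrt) auto
  then have "sqrt (A (k + n) - A k) / \<alpha> \<le> real n * K ^ n" using \<alpha> by (simp add: divide_le_eq)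
  then have "scaled_noreturn n \<le> (real n * K ^ n) * 1"
    unfolding scaled_noreturn_def \<alpha>_def[symmetric]
    using noreturn_nonneg[OF n] noreturn_le_1[OF n] K_ge_1 by (intro mult_mono) auto
  then show ?thesis by simp
qed

end

text \<open>
  A set \<open>Z\<close> of starting times with common constants, along which single increments of the martingale
  are uniformly negligible against the variance of the whole segment.
\<close>

locale walk_scaling_family =
  fixes q :: real and a :: "nat \<Rightarrow> real" and K :: real and Z :: "nat \<Rightarrow> bool"
  assumes scaling: "\<And>k. Z k \<Longrightarrow> walk_scaling q a k K"
    and negligible: "\<And>\<eta>. 0 < \<eta> \<Longrightarrow> \<exists>n0. \<forall>n\<ge>n0. \<forall>k. Z k \<longrightarrow>
      (\<forall>j. k < j \<and> j \<le> k + n \<longrightarrow> (a j)\<^sup>2 \<le> \<eta> * (walk_scaling.A a (k + n) - walk_scaling.A a k))"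
begin

abbreviation segment_variance :: "nat \<Rightarrow> nat \<Rightarrow> real" where
  "segment_variance k n \<equiv> walk_scaling.A a (k + n) - walk_scaling.A a k"

abbreviation Q :: "nat \<Rightarrow> nat \<Rightarrow> real" where
  "Q k n \<equiv> walk_scaling.scaled_noreturn q a k n"

lemma sum_rate_small:
  assumes \<theta>: "0 < \<theta>" and \<rho>: "0 < \<rho>"
  shows "\<exists>n0. \<forall>n\<ge>n0. \<forall>k. Z k \<longrightarrow> (\<forall>m>k. (\<Sum>i=m..<k + n. walk_scaling.rate a (\<theta> * segment_variance k n) i) \<le> \<rho>)"
proof -
  define M where "M = nat \<lceil>2 * (1 + 1 / \<theta>) / \<rho>\<rceil>"
  define c where "c = 2 * real M / \<theta> + 1 / \<theta>\<^sup>2"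
  have pos: "0 < 2 * (1 + 1 / \<theta>) / \<rho>"
    using \<theta> \<rho> by (intro divide_pos_pos mult_pos_pos add_pos_pos) auto
  have M: "2 * (1 + 1 / \<theta>) / \<rho> \<le> real M" unfolding M_def by (rule real_nat_ceiling_ge)
  then have M0: "0 < real M" using pos by linarith
  have c: "0 < c" using \<theta> by (simp add: c_def add_nonneg_pos)
  have split: "2 * real M * x / \<theta> + x / \<theta>\<^sup>2 = c * x" for x
    by (simp add: c_def distrib_right)
  have tail: "(1 + 1 / \<theta>) / real M \<le> \<rho> / 2"
    using M M0 \<rho> by (simp add: divide_le_eq mult.commute)
  obtain n0 where n0: "\<And>n k j. n \<ge> n0 \<Longrightarrow> Z k \<Longrightarrow> k < j \<Longrightarrow> j \<le> k + n \<Longrightarrow> (a j)\<^sup>2 \<le> \<rho> / (2 * c) * segment_variance k n"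
    using negligible[of "\<rho> / (2 * c)"] \<rho> c by auto
  show ?thesis
  proof (intro exI[of _ "max 1 n0"] allI impI)
    fix n k m assume n: "max 1 n0 \<le> n" and k: "Z k" and m: "k < m"
    interpret walk_scaling q a k K by (rule scaling[OF k])
    have "(\<Sum>i=m..<k + n. rate (\<theta> * segment_variance k n) i)
        \<le> 2 * real M * (\<rho> / (2 * c)) / \<theta> + (1 + 1 / \<theta>) / real M + \<rho> / (2 * c) / \<theta>\<^sup>2"
    proof (rule sum_rate_le)
      show "(a j)\<^sup>2 \<le> \<rho> / (2 * c) * segment_variance k n" if "k < j" "j \<le> k + n" for j
        using n0[OF _ k that] n by simp
      show "0 < segment_variance k n" using n by (intro A_diff_pos) simp
    qed (use \<theta> \<rho> c M0 m in auto)
    also have "\<dots> = c * (\<rho> / (2 * c)) + (1 + 1 / \<theta>) / real M"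
      using split[of "\<rho> / (2 * c)"] by linarith
    also have "c * (\<rho> / (2 * c)) = \<rho> / 2" using c by simp
    also have "\<rho> / 2 + (1 + 1 / \<theta>) / real M \<le> \<rho>" using tail by linarith
    finally show "(\<Sum>i=m..<k + n. rate (\<theta> * segment_variance k n) i) \<le> \<rho>" .
  qed
qed

lemma scaled_noreturn_lower:
  assumes \<delta>: "0 < \<delta>"
  shows "\<exists>n0. \<forall>n\<ge>n0. \<forall>k. Z k \<longrightarrow> sqrt (2 / pi) - \<delta> < Q k n"
proof (cases "\<exists>k. Z k")
  case True
  then obtain k0 where "Z k0" by blast
  then interpret W0: walk_scaling q a k0 K by (rule scaling)
  \<comment> \<open>\<open>\<theta>\<close> controls the loss \<open>1 / sqrt (1 + \<theta>)\<close>; \<open>\<rho>\<close> is chosen afterwards, depending on \<open>\<theta>\<close>\<close>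
  define \<theta> where "\<theta> = min 1 (\<delta> / 4)"
  have \<theta>: "0 < \<theta>" "\<theta> \<le> 1" "\<theta> \<le> \<delta> / 4" using \<delta> by (auto simp: \<theta>_def)
  define C where "C = 1 + W0.err_const / sqrt \<theta>"
  have C: "0 < C" using W0.err_const_pos \<theta> by (simp add: C_def add_pos_pos)
  define \<rho> where "\<rho> = min 1 (\<delta> / (4 * C))"
  have \<rho>: "0 < \<rho>" "\<rho> \<le> 1" "\<rho> \<le> \<delta> / (4 * C)" using \<delta> C by (auto simp: \<rho>_def)
  obtain n1 where n1: "\<And>n k j. n \<ge> n1 \<Longrightarrow> Z k \<Longrightarrow> k < j \<Longrightarrow> j \<le> k + n \<Longrightarrow> (a j)\<^sup>2 \<le> \<rho> * segment_variance k n"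
    using negligible[OF \<rho>(1)] by auto
  obtain n2 where n2: "\<And>n k m. n \<ge> n2 \<Longrightarrow> Z k \<Longrightarrow> k < m \<Longrightarrow>
      (\<Sum>i=m..<k + n. walk_scaling.rate a (\<theta> * segment_variance k n) i) \<le> \<rho>"
    using sum_rate_small[OF \<theta>(1) \<rho>(1)] by auto
  show ?thesis
  proof (intro exI[of _ "max 1 (max n1 n2)"] allI impI)
    fix n k assume n: "max 1 (max n1 n2) \<le> n" and k: "Z k"
    interpret walk_scaling q a k K by (rule scaling[OF k])
    define c where "c = sqrt (2 / pi)"
    have c: "0 \<le> c" "c \<le> 1" using pi_ge_two by (auto simp: c_def)
    have "c * ((1 - \<rho> / 2) / sqrt (1 + \<theta>) - err_const * \<rho> / sqrt \<theta>) \<le> Q k n"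
      unfolding scaled_noreturn_def c_def
      using n by (intro noreturn_lower n1 n2 refl \<theta> k) auto
    moreover have "c - \<delta> < c * ((1 - \<rho> / 2) / sqrt (1 + \<theta>) - err_const * \<rho> / sqrt \<theta>)"
    proof -
      have s: "1 - \<theta> \<le> 1 / sqrt (1 + \<theta>)"
      proof -
        have "sqrt (1 + \<theta>) \<le> 1 + \<theta>" using \<theta> by (intro real_le_lsqrt) (auto simp: power2_eq_square algebra_simps)
        then have "1 / (1 + \<theta>) \<le> 1 / sqrt (1 + \<theta>)" using \<theta> by (intro divide_left_mono) auto
        moreover have "1 - \<theta> \<le> 1 / (1 + \<theta>)" using \<theta> by (simp add: le_divide_eq algebra_simps)
        ultimately show ?thesis by linarith
      qed
      have "(1 - \<rho> / 2) * (1 - \<theta>) \<le> (1 - \<rho> / 2) * (1 / sqrt (1 + \<theta>))"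
        using \<rho> s by (intro mult_left_mono) auto
      moreover have "1 - \<rho> / 2 - \<theta> \<le> (1 - \<rho> / 2) * (1 - \<theta>)"
        using \<rho> \<theta> by (simp add: algebra_simps)
      ultimately have "1 - \<rho> / 2 - \<theta> \<le> (1 - \<rho> / 2) / sqrt (1 + \<theta>)" by simp
      moreover have "\<rho> * C = \<rho> + err_const * \<rho> / sqrt \<theta>" by (simp add: C_def algebra_simps)
      moreover have "\<rho> * C \<le> \<delta> / 4" using \<rho>(3) C by (simp add: le_divide_eq mult_ac)
      ultimately have "1 - \<delta> / 2 \<le> (1 - \<rho> / 2) / sqrt (1 + \<theta>) - err_const * \<rho> / sqrt \<theta>"
        using \<theta> \<rho>(1) by linarith
      then have "c * (1 - \<delta> / 2) \<le> c * ((1 - \<rho> / 2) / sqrt (1 + \<theta>) - err_const * \<rho> / sqrt \<theta>)"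
        using c by (intro mult_left_mono)
      moreover have "c * (\<delta> / 2) \<le> 1 * (\<delta> / 2)" using c \<delta> by (intro mult_right_mono) auto
      moreover have "c * (1 - \<delta> / 2) = c - c * (\<delta> / 2)" by (simp add: right_diff_distrib)
      ultimately show ?thesis using \<delta> by linarith
    qed
    ultimately show "sqrt (2 / pi) - \<delta> < Q k n" by (simp add: c_def)
  qed
qed auto

lemma scaled_noreturn_recursion:
  assumes \<epsilon>: "0 < \<epsilon>" and \<eta>: "0 < \<eta>"
  shows "\<exists>n0. \<forall>n\<ge>n0. \<forall>k. Z k \<longrightarrow> (\<exists>l. 1 \<le> l \<and> l < n \<and>
    Q k n \<le> (1 + \<eta>) / gauss_int (1 / \<epsilon>) + (6 * \<epsilon> + \<eta>) * Q k l)"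
proof (cases "\<exists>k. Z k")
  case True
  then obtain k0 where "Z k0" by blast
  then interpret W0: walk_scaling q a k0 K by (rule scaling)
  \<comment> \<open>\<open>C * \<rho>\<close> bounds both error terms of \<open>noreturn_upper\<close>\<close>
  define C where "C = 92 * K\<^sup>2 + W0.err_const / \<epsilon>\<^sup>2"
  have C: "0 < C" "92 * K\<^sup>2 \<le> C" "W0.err_const / \<epsilon>\<^sup>2 \<le> C"
    using W0.err_const_pos \<epsilon> by (auto simp: C_def add_nonneg_pos)
  define \<rho> where "\<rho> = min (min (1 / 4) (\<epsilon> ^ 4)) (\<eta> / C)"
  have "0 < \<rho>" using \<epsilon> \<eta> C(1) by (simp add: \<rho>_def)
  moreover have "\<rho> \<le> 1 / 4" unfolding \<rho>_def by (rule min.coboundedI1, rule min.cobounded1)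
  moreover have "\<rho> \<le> \<epsilon> ^ 4" unfolding \<rho>_def by (rule min.coboundedI1, rule min.cobounded2)
  moreover have "\<rho> \<le> \<eta> / C" unfolding \<rho>_def by (rule min.cobounded2)
  ultimately have \<rho>: "0 < \<rho>" "\<rho> \<le> 1 / 4" "\<rho> \<le> \<epsilon> ^ 4" "\<rho> \<le> \<eta> / C" by auto
  have \<rho>C: "C * \<rho> \<le> \<eta>" using \<rho>(4) C(1) by (simp add: le_divide_eq mult.commute)
  have e4: "0 < \<epsilon> ^ 4" and e2: "0 < \<epsilon>\<^sup>2" using \<epsilon> by auto
  obtain n1 where n1: "\<And>n k j. n \<ge> n1 \<Longrightarrow> Z k \<Longrightarrow> k < j \<Longrightarrow> j \<le> k + n \<Longrightarrow> (a j)\<^sup>2 \<le> \<rho> * segment_variance k n"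
    using negligible[OF \<rho>(1)] by auto
  obtain n2 where n2: "\<And>n k m. n \<ge> n2 \<Longrightarrow> Z k \<Longrightarrow> k < m \<Longrightarrow>
      (\<Sum>i=m..<k + n. walk_scaling.rate a (\<epsilon> ^ 4 * segment_variance k n) i) \<le> \<rho>"
    using sum_rate_small[OF e4 \<rho>(1)] by auto
  obtain n3 where n3: "\<And>n k m. n \<ge> n3 \<Longrightarrow> Z k \<Longrightarrow> k < m \<Longrightarrow>
      (\<Sum>i=m..<k + n. walk_scaling.rate a (\<epsilon>\<^sup>2 * segment_variance k n) i) \<le> \<rho>"
    using sum_rate_small[OF e2 \<rho>(1)] by auto
  have g0: "0 \<le> gauss_int (1 / \<epsilon>)" using gauss_int_mono[of 0 "1 / \<epsilon>"] \<epsilon> by simp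
  show ?thesis
  proof (rule exI[of _ "max 1 (max n1 (max n2 n3))"], intro allI impI)
    fix n k assume n: "max 1 (max n1 (max n2 n3)) \<le> n" and k: "Z k"
    interpret walk_scaling q a k K by (rule scaling[OF k])
    obtain l where l: "1 \<le> l" "l < n"
      "sqrt (segment_variance k n) / a (Suc k) * noreturn n \<le> (1 + err_const * \<rho> / \<epsilon>\<^sup>2) / gauss_int (1 / \<epsilon>)
       + 2 * (3 * \<epsilon> + 46 * K\<^sup>2 * \<rho>) * (sqrt (A (k + l) - A k) / a (Suc k) * noreturn l)"
      by (rule noreturn_upper[OF _ refl \<epsilon> \<rho>(3,2) n1[OF _ k] n2[OF _ k] n3[OF _ k]]) (use n in auto)
    have Ql: "0 \<le> Q k l"
      using A_diff_pos[OF l(1)] noreturn_nonneg[OF l(1)] a_pos[of "Suc k"] by (simp add: scaled_noreturn_def)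
    have "err_const / \<epsilon>\<^sup>2 * \<rho> \<le> C * \<rho>" "92 * K\<^sup>2 * \<rho> \<le> C * \<rho>"
      using \<rho>(1) by (intro mult_right_mono C(2,3); simp)+
    then have b: "err_const * \<rho> / \<epsilon>\<^sup>2 \<le> \<eta>" "92 * K\<^sup>2 * \<rho> \<le> \<eta>" using \<rho>C by simp_all
    have "Q k n \<le> (1 + err_const * \<rho> / \<epsilon>\<^sup>2) / gauss_int (1 / \<epsilon>) + 2 * (3 * \<epsilon> + 46 * K\<^sup>2 * \<rho>) * Q k l"
      using l(3) by (simp add: scaled_noreturn_def)
    also have "\<dots> \<le> (1 + \<eta>) / gauss_int (1 / \<epsilon>) + (6 * \<epsilon> + \<eta>) * Q k l"
      using b g0 Ql by (intro add_mono divide_right_mono mult_right_mono) auto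
    finally show "\<exists>l. 1 \<le> l \<and> l < n \<and> Q k n \<le> (1 + \<eta>) / gauss_int (1 / \<epsilon>) + (6 * \<epsilon> + \<eta>) * Q k l"
      using l by blast
  qed
qed auto

text \<open>
  The recursion with \<open>\<epsilon> = 1 / 24\<close> and \<open>\<eta> = 1 / 4\<close> has the contraction factor \<open>6 * \<epsilon> + \<eta> = 1 / 2\<close>, so a bound
  that is at least twice its constant term propagates by strong induction.
\<close>

lemma scaled_noreturn_bounded: "\<exists>C. \<forall>n\<ge>1. \<forall>k. Z k \<longrightarrow> Q k n \<le> C"
proof (cases "\<exists>k. Z k")
  case True
  then obtain k0 where "Z k0" by blast
  then interpret W0: walk_scaling q a k0 K by (rule scaling)
  obtain n0 where n0: "\<And>n k. n \<ge> n0 \<Longrightarrow> Z k \<Longrightarrow> (\<exists>l. 1 \<le> l \<and> l < n \<and>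
    Q k n \<le> (1 + 1 / 4) / gauss_int (1 / (1 / 24)) + (6 * (1 / 24) + 1 / 4) * Q k l)"
    using scaled_noreturn_recursion[of "1 / 24" "1 / 4"] by auto
  define R where "R = (1 + 1 / 4) / gauss_int (1 / (1 / 24))"
  define C where "C = max (2 * R) (real n0 * K ^ n0)"
  have "Q k n \<le> C" if "1 \<le> n" and Zk: "Z k" for n k
    using that(1)
  proof (induction n rule: less_induct)
    case (less n)
    interpret walk_scaling q a k K by (rule scaling[OF Zk])
    show ?case
    proof (cases "n0 \<le> n")
      case True
      then obtain l where l: "1 \<le> l" "l < n" "Q k n \<le> R + (6 * (1 / 24) + 1 / 4) * Q k l"
        using n0[OF True Zk] unfolding R_def by blast
      have "Q k l \<le> C" using less.IH[of l] l by simp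
      moreover have "2 * R \<le> C" by (simp add: C_def)
      ultimately show ?thesis using l(3) by simp
    next
      case False
      have "Q k n \<le> real n * K ^ n" by (rule scaled_noreturn_crude[OF less.prems])
      also have "\<dots> \<le> real n0 * K ^ n0"
        using False K_ge_1 by (intro mult_mono power_increasing) auto
      also have "\<dots> \<le> C" by (simp add: C_def)
      finally show ?thesis .
    qed
  qed
  then show ?thesis by blast
qed auto

text \<open>
  Boundedness turns the recursion into a direct estimate: its last term is at most
  \<open>(6 * \<epsilon> + \<eta>) * C\<close>, and \<open>1 / gauss_int (1 / \<epsilon>)\<close> tends to \<open>sqrt (2 / pi)\<close>.
\<close>

lemma scaled_noreturn_upper:
  assumes \<delta>: "0 < \<delta>"
  shows "\<exists>n0. \<forall>n\<ge>n0. \<forall>k. Z k \<longrightarrow> Q k n < sqrt (2 / pi) + \<delta>"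
proof -
  obtain C0 where C0: "\<And>n k. 1 \<le> n \<Longrightarrow> Z k \<Longrightarrow> Q k n \<le> C0"
    using scaled_noreturn_bounded by blast
  define C where "C = max 1 C0"
  have C: "1 \<le> C" "\<And>n k. 1 \<le> n \<Longrightarrow> Z k \<Longrightarrow> Q k n \<le> C"
    using C0 by (auto simp: C_def intro: max.coboundedI2)
  define c where "c = sqrt (2 / pi)"
  have c: "0 \<le> c" "c \<le> 1" using pi_ge_two by (auto simp: c_def)
  have "((\<lambda>y. 1 / gauss_int y) \<longlongrightarrow> 1 / sqrt (pi / 2)) at_top"
    by (intro tendsto_intros gauss_int_tendsto) simp
  moreover have "1 / sqrt (pi / 2) = c" by (simp add: c_def real_sqrt_divide)
  ultimately have "\<forall>\<^sub>F y in at_top. 1 / gauss_int y < c + \<delta> / 4"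
    using \<delta> by (intro order_tendstoD(2)) auto
  then obtain y0 where y0: "\<And>y. y0 \<le> y \<Longrightarrow> 1 / gauss_int y < c + \<delta> / 4"
    by (auto simp: eventually_at_top_linorder)
  \<comment> \<open>\<open>y = 1 / \<epsilon>\<close> is so large that also \<open>6 * \<epsilon> * C \<le> \<delta> / 4\<close>\<close>
  define y where "y = max (max 1 y0) (24 * C / \<delta>)"
  have y: "1 \<le> y" "y0 \<le> y" "24 * C / \<delta> \<le> y" by (auto simp: y_def)
  define \<epsilon> where "\<epsilon> = 1 / y"
  have \<epsilon>: "0 < \<epsilon>" "1 / \<epsilon> = y" using y by (auto simp: \<epsilon>_def)
  have \<epsilon>C: "6 * \<epsilon> * C \<le> \<delta> / 4"
    using y \<delta> by (simp add: \<epsilon>_def divide_le_eq mult_ac)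
  define \<eta> where "\<eta> = min 1 (\<delta> / (8 * (C + 1 + \<delta>)))"
  have D: "0 < 8 * (C + 1 + \<delta>)" using C(1) \<delta> by simp
  have \<eta>: "0 < \<eta>" "\<eta> \<le> \<delta> / (8 * (C + 1 + \<delta>))" using D \<delta> by (auto simp: \<eta>_def)
  have \<eta>C: "\<eta> * (C + 1 + \<delta>) \<le> \<delta> / 8"
    using \<eta>(2) D by (simp add: le_divide_eq mult_ac)
  obtain n0 where n0: "\<And>n k. n \<ge> n0 \<Longrightarrow> Z k \<Longrightarrow> (\<exists>l. 1 \<le> l \<and> l < n \<and>
    Q k n \<le> (1 + \<eta>) / gauss_int (1 / \<epsilon>) + (6 * \<epsilon> + \<eta>) * Q k l)"
    using scaled_noreturn_recursion[OF \<epsilon>(1) \<eta>(1)] by auto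
  show ?thesis
  proof (intro exI[of _ n0] allI impI)
    fix n k assume "n0 \<le> n" and k: "Z k"
    then obtain l where l: "1 \<le> l" "Q k n \<le> (1 + \<eta>) * (1 / gauss_int y) + (6 * \<epsilon> + \<eta>) * Q k l"
      using n0[of n k] unfolding \<epsilon>(2) by auto
    have "(1 + \<eta>) * (1 / gauss_int y) \<le> (1 + \<eta>) * (c + \<delta> / 4)"
      using y0[OF y(2)] \<eta>(1) by (intro mult_left_mono) auto
    also have "\<dots> = c + \<delta> / 4 + \<eta> * (c + \<delta> / 4)" by (simp add: algebra_simps)
    also have "\<eta> * (c + \<delta> / 4) \<le> \<eta> * (C + 1 + \<delta>)"
      using \<eta>(1) c C(1) \<delta> by (intro mult_left_mono) auto
    finally have 1: "(1 + \<eta>) * (1 / gauss_int y) \<le> c + \<delta> / 4 + \<delta> / 8" using \<eta>C by simp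
    have "(6 * \<epsilon> + \<eta>) * Q k l \<le> (6 * \<epsilon> + \<eta>) * C"
      using \<epsilon>(1) \<eta>(1) C(2)[OF l(1) k] by (intro mult_left_mono) auto
    also have "\<dots> = 6 * \<epsilon> * C + \<eta> * C" by (simp add: algebra_simps)
    also have "\<eta> * C \<le> \<eta> * (C + 1 + \<delta>)" using \<eta>(1) \<delta> by (intro mult_left_mono) auto
    finally have 2: "(6 * \<epsilon> + \<eta>) * Q k l \<le> \<delta> / 4 + \<delta> / 8" using \<epsilon>C \<eta>C by simp
    show "Q k n < sqrt (2 / pi) + \<delta>" using l(2) 1 2 \<delta> unfolding c_def by linarith
  qed
qed

theorem scaled_noreturn_limit:
  assumes "0 < \<delta>"
  shows "\<exists>n0. \<forall>n\<ge>n0. \<forall>k. Z k \<longrightarrow> \<bar>Q k n - sqrt (2 / pi)\<bar> < \<delta>"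
proof -
  obtain n1 where n1: "\<And>n k. n \<ge> n1 \<Longrightarrow> Z k \<Longrightarrow> sqrt (2 / pi) - \<delta> < Q k n"
    using scaled_noreturn_lower[OF assms] by blast
  obtain n2 where n2: "\<And>n k. n \<ge> n2 \<Longrightarrow> Z k \<Longrightarrow> Q k n < sqrt (2 / pi) + \<delta>"
    using scaled_noreturn_upper[OF assms] by blast
  show ?thesis
  proof (intro exI[of _ "max n1 n2"] allI impI)
    fix n k assume "max n1 n2 \<le> n" "Z k"
    then show "\<bar>Q k n - sqrt (2 / pi)\<bar> < \<delta>" using n1[of n k] n2[of n k] by (simp add: abs_less_iff)
  qed
qed

end

section \<open>The elephant random walk as a Markov chain\<close>

text \<open>
  The first \<open>n + 1\<close> steps, computed from the sources alone; list positions start at \<open>0\<close>, times at \<open>1\<close>. If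
  a memory value is out of range the entry is arbitrary, which happens with probability \<open>0\<close>. The point
  of this function is that the steps are determined by sources independent of the next memory and
  flip.
\<close>

primrec history :: "nat \<Rightarrow> (erw_source \<Rightarrow> int) \<Rightarrow> int list" where
  "history 0 w = [w Init]"
| "history (Suc n) w = history n w @ [w (Flip (Suc n)) * history n w ! (nat (w (Memory (Suc n))) - 1)]"

definition past :: "nat \<Rightarrow> erw_source set" where
  "past n = {Init} \<union> Memory ` {1..n} \<union> Flip ` {1..n}"

lemma history_cong: "(\<And>i. i \<in> past n \<Longrightarrow> w i = w' i) \<Longrightarrow> history n w = history n w'"
proof (induction n)
  case (Suc n)
  have "past n \<subseteq> past (Suc n)" by (auto simp: past_def)
  then have "history n w = history n w'" using Suc by blast
  moreover have "w (Flip (Suc n)) = w' (Flip (Suc n))" "w (Memory (Suc n)) = w' (Memory (Suc n))"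
    using Suc.prems by (auto simp: past_def)
  ultimately show ?case by simp
qed (simp add: past_def)

lemma history_measurable:
  "history n \<in> measurable (PiM (past n) (\<lambda>_. count_space UNIV)) (count_space UNIV)"
proof -
  have "past m \<subseteq> past n \<Longrightarrow> history m \<in> measurable (PiM (past n) (\<lambda>_. count_space UNIV)) (count_space UNIV)" for m
  proof (induction m)
    case 0
    have "(\<lambda>w. w Init) \<in> measurable (PiM (past n) (\<lambda>_. count_space UNIV)) (count_space UNIV)"
      by (intro measurable_component_singleton) (auto simp: past_def)
    from measurable_compose[OF this, of "\<lambda>x. [x]" "count_space UNIV"] show ?case by simp
  next
    case (Suc m)
    have "past m \<subseteq> past (Suc m)" by (auto simp: past_def)
    then have "past m \<subseteq> past n" using Suc.prems by blast
    then have [measurable]: "history m \<in> measurable (PiM (past n) (\<lambda>_. count_space UNIV)) (count_space UNIV)"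
      by (rule Suc.IH)
    have [measurable]: "(\<lambda>w. w (Flip (Suc m))) \<in> measurable (PiM (past n) (\<lambda>_. count_space UNIV)) (count_space UNIV)"
      "(\<lambda>w. w (Memory (Suc m))) \<in> measurable (PiM (past n) (\<lambda>_. count_space UNIV)) (count_space UNIV)"
      using Suc.prems by (auto intro!: measurable_component_singleton simp: past_def[of "Suc m"])
    have "(\<lambda>w. (history m w, w (Flip (Suc m)), w (Memory (Suc m)))) \<in>
        measurable (PiM (past n) (\<lambda>_. count_space UNIV)) (count_space UNIV \<Otimes>\<^sub>M count_space UNIV \<Otimes>\<^sub>M count_space UNIV)"
      by measurable
    then have "(\<lambda>w. (history m w, w (Flip (Suc m)), w (Memory (Suc m)))) \<in>
        measurable (PiM (past n) (\<lambda>_. count_space UNIV)) (count_space UNIV)"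
      by (simp add: pair_measure_countable)
    from measurable_compose[OF this, of "\<lambda>(h, f, i). h @ [f * h ! (nat i - 1)]" "count_space UNIV"]
    show ?case by simp
  qed
  then show ?thesis by simp
qed

context elephant_random_walk
begin

definition path :: "nat \<Rightarrow> 'a \<Rightarrow> int list" where
  "path n \<omega> = map (\<lambda>i. X i \<omega>) [1..<Suc n]"

lemma length_path [simp]: "length (path n \<omega>) = n"
  by (simp add: path_def)

lemma nth_path: "i < n \<Longrightarrow> path n \<omega> ! i = X (Suc i) \<omega>"
  by (simp add: path_def nth_append del: upt_Suc)

lemma path_Suc: "path (Suc n) \<omega> = path n \<omega> @ [X (Suc n) \<omega>]"
  by (simp add: path_def)

lemma sum_list_path: "sum_list (path n \<omega>) = erw_position X n \<omega>"
  by (simp add: path_def erw_position_def sum_list_distinct_conv_sum_set atLeastLessThanSuc_atLeastAtMost del: upt_Suc)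

lemma path_measurable [measurable]: "path n \<in> measurable M (count_space UNIV)"
proof (induction n)
  case (Suc n)
  have [measurable]: "X (Suc n) \<in> measurable M (count_space UNIV)" by (rule steps_measurable) simp
  note Suc[measurable]
  show ?case unfolding path_Suc[abs_def] by simp
qed (simp add: path_def)

abbreviation sources :: "erw_source \<Rightarrow> 'a \<Rightarrow> int" where
  "sources \<equiv> erw_sources X u \<epsilon>"

lemma source_measurable:
  assumes "i \<in> {Init} \<union> Memory ` {1..} \<union> Flip ` {1..}"
  shows "sources i \<in> measurable M (count_space UNIV)"
  using sources_indep assms unfolding indep_vars_def by auto

lemma flip_measurable: "1 \<le> n \<Longrightarrow> \<epsilon> n \<in> measurable M (count_space UNIV)"
  using source_measurable[of "Flip n"] by (simp add: erw_sources_def[abs_def])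

lemma memory_measurable: "1 \<le> n \<Longrightarrow> u n \<in> measurable M (count_space UNIV)"
proof -
  assume "1 \<le> n"
  then have "(\<lambda>\<omega>. int (u n \<omega>)) \<in> measurable M (count_space UNIV)"
    using source_measurable[of "Memory n"] by (simp add: erw_sources_def[abs_def])
  then have "(\<lambda>\<omega>. nat (int (u n \<omega>))) \<in> measurable M (count_space UNIV)"
    by (rule measurable_compose) simp
  then show ?thesis by simp
qed

text \<open>
  The hypotheses on the walk fix distributions only, so the ranges of the inputs hold almost surely.
\<close>

lemma AE_memory: "1 \<le> n \<Longrightarrow> AE \<omega> in M. u n \<omega> \<in> {1..n}"
proof -
  assume n: "1 \<le> n"
  have "AE i in distr M (count_space UNIV) (u n). i \<in> {1..n}"
    unfolding memory_uniform[OF n] using n by (intro AE_pmfI) auto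
  then show ?thesis by (subst (asm) AE_distr_iff) (auto intro: memory_measurable n)
qed

lemma AE_first: "AE \<omega> in M. X 1 \<omega> \<in> {1, -1}"
proof -
  have "AE i in distr M (count_space UNIV) (X 1). i \<in> {1, -1}"
    unfolding first_step_uniform by (intro AE_pmfI) auto
  then show ?thesis by (subst (asm) AE_distr_iff) (auto intro: steps_measurable)
qed

lemma AE_flip: assumes "1 \<le> n" shows "AE \<omega> in M. \<epsilon> n \<omega> \<in> {1, -1}"
proof -
  note [measurable] = flip_measurable[OF assms]
  have "prob {\<omega> \<in> space M. \<epsilon> n \<omega> \<in> {1, -1}} = prob ({\<omega> \<in> space M. \<epsilon> n \<omega> = 1} \<union> {\<omega> \<in> space M. \<epsilon> n \<omega> = -1})"
    by (rule arg_cong[where f=prob]) auto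
  also have "\<dots> = p + (1 - p)"
    using flip_pos[OF assms] flip_neg[OF assms] by (subst finite_measure_Union) auto
  finally have "prob {\<omega> \<in> space M. \<epsilon> n \<omega> \<in> {1, -1}} = 1" by simp
  then show ?thesis by (subst (asm) prob_Collect_eq_1) auto
qed

lemma AE_path: "AE \<omega> in M. set (path n \<omega>) \<subseteq> {1, -1}"
proof (induction n)
  case (Suc n)
  show ?case
  proof (cases n)
    case 0
    then show ?thesis using AE_first by (simp add: path_def)
  next
    case (Suc m)
    then have n: "1 \<le> n" by simp
    from Suc.IH AE_memory[OF n] AE_flip[OF n] AE_space show ?thesis
    proof eventually_elim
      case (elim \<omega>)
      have "X (u n \<omega>) \<omega> = path n \<omega> ! (u n \<omega> - 1)" using elim by (subst nth_path) auto
      also have "\<dots> \<in> set (path n \<omega>)" using elim by (intro nth_mem) auto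
      finally have "X (u n \<omega>) \<omega> \<in> {1, -1}" using elim by blast
      moreover have "X (Suc n) \<omega> = \<epsilon> n \<omega> * X (u n \<omega>) \<omega>" using step_rec[OF n] elim by simp
      ultimately show ?case using elim by (auto simp: path_Suc)
    qed
  qed
qed (simp add: path_def)

lemma AE_history: "AE \<omega> in M. path (Suc n) \<omega> = history n (restrict (\<lambda>i. sources i \<omega>) (past n))"
proof (induction n)
  case 0
  show ?case by (simp add: path_def erw_sources_def past_def)
next
  case (Suc n)
  have n: "1 \<le> Suc n" by simp
  from Suc.IH AE_memory[OF n] AE_space show ?case
  proof eventually_elim
    case (elim \<omega>)
    define w where "w = restrict (\<lambda>i. sources i \<omega>) (past (Suc n))"
    have "history n w = path (Suc n) \<omega>"
      unfolding elim(1) by (rule history_cong) (auto simp: past_def w_def)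
    moreover have "w (Flip (Suc n)) = \<epsilon> (Suc n) \<omega>" "w (Memory (Suc n)) = int (u (Suc n) \<omega>)"
      by (auto simp: past_def erw_sources_def w_def)
    moreover have "path (Suc n) \<omega> ! (u (Suc n) \<omega> - 1) = X (u (Suc n) \<omega>) \<omega>"
      using elim by (subst nth_path) auto
    ultimately show ?case
      using step_rec[OF n, of \<omega>] elim(2,3) unfolding w_def[symmetric]
      by (simp add: path_Suc[of "Suc n"])
  qed
qed

definition path_prob :: "int list \<Rightarrow> real" where
  "path_prob l = prob {\<omega> \<in> space M. path (length l) \<omega> = l}"

lemma memory_prob:
  assumes "1 \<le> n" "j \<in> {1..n}" shows "prob {\<omega> \<in> space M. u n \<omega> = j} = 1 / real n"
proof -
  note [measurable] = memory_measurable[OF assms(1)]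
  have "prob {\<omega> \<in> space M. u n \<omega> = j} = measure (distr M (count_space UNIV) (u n)) {j}"
    by (subst measure_distr) (auto simp: vimage_def Int_def conj_commute)
  also have "\<dots> = 1 / real n"
    unfolding memory_uniform[OF assms(1)] using assms by (simp add: measure_pmf_single)
  finally show ?thesis .
qed

lemma flip_prob:
  assumes "1 \<le> n" "e \<in> {1, -1}" shows "prob {\<omega> \<in> space M. \<epsilon> n \<omega> = e} = (1 + (2 * p - 1) * of_int e) / 2"
  using flip_pos[OF assms(1)] flip_neg[OF assms(1)] assms(2) by auto

text \<open>
  The path up to time \<open>n\<close> is almost surely a function of the sources with indices below \<open>n\<close>, hence
  independent of the pair of sources with index \<open>n\<close>.
\<close>

lemma path_sources_indep:
  assumes l: "length l = n" "1 \<le> n"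
  shows "prob {\<omega> \<in> space M. path n \<omega> = l \<and> u n \<omega> = j \<and> \<epsilon> n \<omega> = e}
    = path_prob l * (prob {\<omega> \<in> space M. u n \<omega> = j} * prob {\<omega> \<in> space M. \<epsilon> n \<omega> = e})"
proof -
  note [measurable] = memory_measurable[OF l(2)] flip_measurable[OF l(2)]
  obtain m where m: "n = Suc m" using l by (cases n) auto
  let ?I = "{Init} \<union> Memory ` {1..} \<union> Flip ` {1..}"
  let ?P = "past m" and ?Q = "{Memory n, Flip n}"
  let ?N = "\<lambda>_::erw_source. count_space (UNIV :: int set)"
  let ?Z = "\<lambda>S \<omega>. restrict (\<lambda>i. sources i \<omega>) S"
  have ind: "indep_var (PiM ?P ?N) (?Z ?P) (PiM ?Q ?N) (?Z ?Q)"
    using l by (intro indep_var_restrict[OF sources_indep]) (auto simp: past_def m)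
  have A: "history m -` {l} \<inter> space (PiM ?P ?N) \<in> sets (PiM ?P ?N)"
    by (rule measurable_sets[OF history_measurable]) simp
  have B: "{w \<in> space (PiM ?Q ?N). w (Memory n) = int j \<and> w (Flip n) = e} \<in> sets (PiM ?Q ?N)"
    by measurable
  have Zm: "?Z S \<in> measurable M (PiM S ?N)" if "S \<subseteq> ?I" for S
    using that by (intro measurable_restrict source_measurable) auto
  have Zs: "?Z S \<omega> \<in> space (PiM S ?N)" for S \<omega>
    by (auto simp: space_PiM)
  have PI: "?P \<subseteq> ?I" "?Q \<subseteq> ?I" using l by (auto simp: past_def)
  have [measurable]: "?Z ?P \<in> measurable M (PiM ?P ?N)" "?Z ?Q \<in> measurable M (PiM ?Q ?N)"
    using Zm PI by blast+
  have m1: "{\<omega> \<in> space M. history m (?Z ?P \<omega>) = l} \<in> sets M"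
  proof -
    have "(\<lambda>\<omega>. history m (?Z ?P \<omega>)) \<in> measurable M (count_space UNIV)"
      by (rule measurable_compose[OF Zm[OF PI(1)] history_measurable])
    then show ?thesis by simp
  qed
  have "prob {\<omega> \<in> space M. path n \<omega> = l \<and> u n \<omega> = j \<and> \<epsilon> n \<omega> = e}
     = prob {\<omega> \<in> space M. history m (?Z ?P \<omega>) = l \<and> u n \<omega> = j \<and> \<epsilon> n \<omega> = e}"
  proof (rule finite_measure_eq_AE)
    show "AE \<omega> in M. (\<omega> \<in> {\<omega> \<in> space M. path n \<omega> = l \<and> u n \<omega> = j \<and> \<epsilon> n \<omega> = e})
      = (\<omega> \<in> {\<omega> \<in> space M. history m (?Z ?P \<omega>) = l \<and> u n \<omega> = j \<and> \<epsilon> n \<omega> = e})"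
      using AE_history[of m] by eventually_elim (simp add: m)
    show "{\<omega> \<in> space M. path n \<omega> = l \<and> u n \<omega> = j \<and> \<epsilon> n \<omega> = e} \<in> sets M" by measurable
    have "{\<omega> \<in> space M. history m (?Z ?P \<omega>) = l \<and> u n \<omega> = j \<and> \<epsilon> n \<omega> = e}
      = {\<omega> \<in> space M. history m (?Z ?P \<omega>) = l} \<inter> {\<omega> \<in> space M. u n \<omega> = j \<and> \<epsilon> n \<omega> = e}" by auto
    moreover have "{\<omega> \<in> space M. u n \<omega> = j \<and> \<epsilon> n \<omega> = e} \<in> sets M" by measurable
    ultimately show "{\<omega> \<in> space M. history m (?Z ?P \<omega>) = l \<and> u n \<omega> = j \<and> \<epsilon> n \<omega> = e} \<in> sets M"
      using m1 by simp
  qed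
  also have "\<dots> = prob ((\<lambda>\<omega>. (?Z ?P \<omega>, ?Z ?Q \<omega>)) -` ((history m -` {l} \<inter> space (PiM ?P ?N)) \<times>
       {w \<in> space (PiM ?Q ?N). w (Memory n) = int j \<and> w (Flip n) = e}) \<inter> space M)"
    using Zs by (intro arg_cong[where f=prob]) (auto simp: erw_sources_def)
  also have "\<dots> = prob (?Z ?P -` (history m -` {l} \<inter> space (PiM ?P ?N)) \<inter> space M) *
      prob (?Z ?Q -` {w \<in> space (PiM ?Q ?N). w (Memory n) = int j \<and> w (Flip n) = e} \<inter> space M)"
    by (rule indep_varD[OF ind A B])
  also have "prob (?Z ?P -` (history m -` {l} \<inter> space (PiM ?P ?N)) \<inter> space M) = path_prob l"
    unfolding path_prob_def
  proof (rule finite_measure_eq_AE)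
    show "AE \<omega> in M. (\<omega> \<in> ?Z ?P -` (history m -` {l} \<inter> space (PiM ?P ?N)) \<inter> space M)
      = (\<omega> \<in> {\<omega> \<in> space M. path (length l) \<omega> = l})"
      using AE_history[of m] by eventually_elim (use Zs in \<open>auto simp: m l\<close>)
    show "?Z ?P -` (history m -` {l} \<inter> space (PiM ?P ?N)) \<inter> space M \<in> sets M"
      by (rule measurable_sets[OF Zm[OF PI(1)] A])
  qed measurable
  also have "prob (?Z ?Q -` {w \<in> space (PiM ?Q ?N). w (Memory n) = int j \<and> w (Flip n) = e} \<inter> space M)
     = prob {\<omega> \<in> space M. u n \<omega> = j} * prob {\<omega> \<in> space M. \<epsilon> n \<omega> = e}"
  proof -
    have "prob (?Z ?Q -` {w \<in> space (PiM ?Q ?N). w (Memory n) = int j \<and> w (Flip n) = e} \<inter> space M)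
      = prob (\<Inter>i\<in>?Q. sources i -` (case i of Memory _ \<Rightarrow> {int j} | _ \<Rightarrow> {e}) \<inter> space M)"
      using Zs by (intro arg_cong[where f=prob]) (auto simp: erw_sources_def)
    also have "\<dots> = (\<Prod>i\<in>?Q. prob (sources i -` (case i of Memory _ \<Rightarrow> {int j} | _ \<Rightarrow> {e}) \<inter> space M))"
      using PI(2) by (intro indep_varsD[OF sources_indep]) auto
    also have "\<dots> = prob {\<omega> \<in> space M. u n \<omega> = j} * prob {\<omega> \<in> space M. \<epsilon> n \<omega> = e}"
      by (simp add: erw_sources_def[abs_def] vimage_def Int_def conj_commute)
    finally show ?thesis .
  qed
  finally show ?thesis .
qed


definition signs :: "nat \<Rightarrow> int list set" where
  "signs n = {l. set l \<subseteq> {1, -1} \<and> length l = n}"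

lemma finite_signs [simp]: "finite (signs n)"
  unfolding signs_def by (rule finite_lists_length_eq) simp

lemma path_prob_Nil [simp]: "path_prob [] = 1"
  by (simp add: path_prob_def path_def prob_space)

text \<open>
  The Markov property. The next step is \<open>x\<close> iff the flip equals \<open>x\<close> times the remembered step, and
  averaging over the uniform memory turns the remembered steps into \<open>sum_list l / n\<close>.
\<close>

lemma path_prob_snoc:
  assumes l: "l \<in> signs n" and x: "x \<in> {1, -1}"
  shows "path_prob (l @ [x]) = path_prob l * ((1 + (2 * p - 1) * of_int (sum_list l) / real n * of_int x) / 2)"
proof (cases "n = 0")
  case True
  then have "l = []" using l by (simp add: signs_def)
  have "path_prob [x] = prob {\<omega> \<in> space M. X 1 \<omega> = x}"
    by (simp add: path_prob_def path_def)
  also have "\<dots> = measure (distr M (count_space UNIV) (X 1)) {x}"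
    by (subst measure_distr) (auto simp: vimage_def Int_def conj_commute steps_measurable)
  also have "\<dots> = 1 / 2"
    unfolding first_step_uniform using x by (auto simp: measure_pmf_single)
  finally show ?thesis using True \<open>l = []\<close> by simp
next
  case False
  then have n: "1 \<le> n" by simp
  note [measurable] = memory_measurable[OF n] flip_measurable[OF n]
  have ll: "length l = n" "set l \<subseteq> {1, -1}" using l by (auto simp: signs_def)
  let ?E = "\<lambda>j. {\<omega> \<in> space M. path n \<omega> = l \<and> u n \<omega> = j \<and> \<epsilon> n \<omega> = x * l ! (j - 1)}"
  have sgn: "l ! (j - 1) \<in> {1, -1}" if "j \<in> {1..n}" for j
  proof -
    have "l ! (j - 1) \<in> set l" using that ll by (intro nth_mem) auto
    then show ?thesis using ll by blast
  qed
  have "path_prob (l @ [x]) = prob (\<Union>j\<in>{1..n}. ?E j)"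
    unfolding path_prob_def
  proof (rule finite_measure_eq_AE)
    show "AE \<omega> in M. (\<omega> \<in> {\<omega> \<in> space M. path (length (l @ [x])) \<omega> = l @ [x]}) = (\<omega> \<in> (\<Union>j\<in>{1..n}. ?E j))"
      using AE_memory[OF n] AE_flip[OF n] AE_space
    proof eventually_elim
      case (elim \<omega>)
      have "path (Suc n) \<omega> = l @ [x] \<longleftrightarrow> path n \<omega> = l \<and> X (Suc n) \<omega> = x"
        by (simp add: path_Suc)
      also have "\<dots> \<longleftrightarrow> path n \<omega> = l \<and> \<epsilon> n \<omega> = x * l ! (u n \<omega> - 1)"
      proof (cases "path n \<omega> = l")
        case True
        have "X (u n \<omega>) \<omega> = l ! (u n \<omega> - 1)"
          unfolding True[symmetric] using elim by (subst nth_path) auto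
        then have "X (Suc n) \<omega> = \<epsilon> n \<omega> * l ! (u n \<omega> - 1)"
          using step_rec[OF n] elim by simp
        then show ?thesis using sgn[OF elim(1)] x by auto
      qed simp
      finally show ?case using elim ll by auto
    qed
  qed measurable
  also have "\<dots> = (\<Sum>j\<in>{1..n}. prob (?E j))"
    by (rule finite_measure_finite_Union) (auto simp: disjoint_family_on_def)
  also have "\<dots> = (\<Sum>j\<in>{1..n}. path_prob l * ((1 + (2 * p - 1) * of_int (x * l ! (j - 1))) / (2 * real n)))"
  proof (rule sum.cong[OF refl])
    fix j assume j: "j \<in> {1..n}"
    have "x * l ! (j - 1) \<in> {1, -1}" using sgn[OF j] x by auto
    then show "prob (?E j) = path_prob l * ((1 + (2 * p - 1) * of_int (x * l ! (j - 1))) / (2 * real n))"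
      unfolding path_sources_indep[OF ll(1) n] memory_prob[OF n j] by (subst flip_prob[OF n]) auto
  qed
  also have "\<dots> = path_prob l * ((\<Sum>j\<in>{1..n}. 1 + (2 * p - 1) * of_int (x * l ! (j - 1))) / (2 * real n))"
    by (simp only: sum_distrib_left sum_divide_distrib)
  also have "(\<Sum>j\<in>{1..n}. 1 + (2 * p - 1) * of_int (x * l ! (j - 1)))
      = real n + (2 * p - 1) * (of_int x * of_int (\<Sum>j\<in>{1..n}. l ! (j - 1)))"
    by (simp add: sum.distrib sum_distrib_left)
  also have "(\<Sum>j\<in>{1..n}. l ! (j - 1)) = sum_list l"
    unfolding sum_list_sum_nth ll(1)
    by (rule sum.reindex_bij_witness[of _ Suc "\<lambda>j. j - 1"]) auto
  finally show ?thesis using n by (simp add: field_simps)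
qed

lemma signs_Suc: "signs (Suc n) = (\<lambda>(l, x). l @ [x]) ` (signs n \<times> {1, -1})"
proof (intro equalityI subsetI)
  fix l assume "l \<in> signs (Suc n)"
  then have "l = butlast l @ [last l]" "butlast l \<in> signs n" "last l \<in> {1, -1}"
    by (cases l rule: rev_cases; auto simp: signs_def)+
  then show "l \<in> (\<lambda>(l, x). l @ [x]) ` (signs n \<times> {1, -1})" by (metis (no_types, lifting) case_prod_conv image_eqI mem_Sigma_iff)
qed (auto simp: signs_def)

lemma sum_path_prob_step:
  "(\<Sum>l\<in>signs (Suc n). path_prob l * (H (butlast l) * g (sum_list l)))
   = (\<Sum>l\<in>signs n. path_prob l * (H l * step (2 * p - 1) n g (sum_list l)))"
proof -
  have "(\<Sum>l\<in>signs (Suc n). path_prob l * (H (butlast l) * g (sum_list l)))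
    = (\<Sum>(l, x)\<in>signs n \<times> {1, -1}. path_prob (l @ [x]) * (H l * g (sum_list l + x)))"
    unfolding signs_Suc by (subst sum.reindex) (auto simp: inj_on_def case_prod_unfold)
  also have "\<dots> = (\<Sum>l\<in>signs n. \<Sum>x\<in>{1, -1}. path_prob (l @ [x]) * (H l * g (sum_list l + x)))"
    by (rule sum.cartesian_product[symmetric])
  also have "\<dots> = (\<Sum>l\<in>signs n. path_prob l * (H l * step (2 * p - 1) n g (sum_list l)))"
  proof (rule sum.cong[OF refl])
    fix l assume l: "l \<in> signs n"
    have "(\<Sum>x\<in>{1, -1}. path_prob (l @ [x]) * (H l * g (sum_list l + x)))
      = path_prob (l @ [1]) * (H l * g (sum_list l + 1)) + path_prob (l @ [-1]) * (H l * g (sum_list l - 1))"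
      by simp
    also have "\<dots> = path_prob l * (H l * step (2 * p - 1) n g (sum_list l))"
    proof -
      have alg: "P * w1 * (h * g1) + P * w2 * (h * g2) = P * (h * (w1 * g1 + w2 * g2))" for P w1 w2 h g1 g2 :: real
        by (simp add: algebra_simps)
      have "path_prob (l @ [1]) = path_prob l * ((1 + (2 * p - 1) * of_int (sum_list l) / real n) / 2)"
        "path_prob (l @ [-1]) = path_prob l * ((1 - (2 * p - 1) * of_int (sum_list l) / real n) / 2)"
        using path_prob_snoc[OF l, of 1] path_prob_snoc[OF l, of "-1"] by simp_all
      then show ?thesis unfolding step_def by (simp only: alg)
    qed
    finally show "(\<Sum>x\<in>{1, -1}. path_prob (l @ [x]) * (H l * g (sum_list l + x)))
      = path_prob l * (H l * step (2 * p - 1) n g (sum_list l))" .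
  qed
  finally show ?thesis .
qed

definition avoids :: "nat \<Rightarrow> nat \<Rightarrow> int list \<Rightarrow> bool" where
  "avoids k n l \<longleftrightarrow> sum_list (take k l) = 0 \<and> (\<forall>i\<in>{1..n}. sum_list (take (k + i) l) \<noteq> 0)"

text \<open>
  Induction on \<open>n\<close> peels off the last step of the path, whereas \<open>surv\<close> peels off the first one; the
  semigroup property reconciles the two.
\<close>

lemma sum_avoids_eq_surv:
  "(\<Sum>l\<in>signs (k + n). path_prob l * (of_bool (avoids k n l) * f (sum_list l)))
   = (\<Sum>l\<in>signs k. path_prob l * of_bool (sum_list l = 0)) * surv (2 * p - 1) n k f 0"
proof (induction n arbitrary: f)
  case 0
  have "(\<Sum>l\<in>signs k. path_prob l * (of_bool (avoids k 0 l) * f (sum_list l)))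
    = (\<Sum>l\<in>signs k. path_prob l * of_bool (sum_list l = 0) * f 0)"
    by (rule sum.cong) (auto simp: avoids_def signs_def)
  then show ?case by (simp only: sum_distrib_right surv.simps add_0_right)
next
  case (Suc n)
  have "(\<Sum>l\<in>signs (k + Suc n). path_prob l * (of_bool (avoids k (Suc n) l) * f (sum_list l)))
    = (\<Sum>l\<in>signs (Suc (k + n)). path_prob l * (of_bool (avoids k n (butlast l)) * kill f (sum_list l)))"
  proof (rule sum.cong)
    fix l assume "l \<in> signs (Suc (k + n))"
    then have l: "length l = Suc (k + n)" by (simp add: signs_def)
    have tk: "take (k + i) (butlast l) = take (k + i) l" if "i \<le> n" for i
      using that l by (simp add: take_butlast)
    have "avoids k (Suc n) l \<longleftrightarrow> avoids k n (butlast l) \<and> sum_list l \<noteq> 0"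
      using tk[of 0] tk l by (auto simp: avoids_def atLeastAtMostSuc_conv)
    then show "path_prob l * (of_bool (avoids k (Suc n) l) * f (sum_list l))
       = path_prob l * (of_bool (avoids k n (butlast l)) * kill f (sum_list l))"
      by (auto simp: kill_def)
  qed simp
  also have "\<dots> = (\<Sum>l\<in>signs (k + n). path_prob l * (of_bool (avoids k n l) * step (2 * p - 1) (k + n) (kill f) (sum_list l)))"
    by (rule sum_path_prob_step)
  also have "\<dots> = (\<Sum>l\<in>signs k. path_prob l * of_bool (sum_list l = 0)) * surv (2 * p - 1) n k (step (2 * p - 1) (k + n) (kill f)) 0"
    by (rule Suc.IH)
  also have "surv (2 * p - 1) n k (step (2 * p - 1) (k + n) (kill f)) 0 = surv (2 * p - 1) (Suc n) k f 0"
    using surv_semigroup[of "2 * p - 1" n 1 k f 0] by simp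
  finally show ?case .
qed

lemma prob_path_in:
  assumes "\<And>l. l \<in> signs n \<Longrightarrow> Q l \<longleftrightarrow> l \<in> C" "C \<subseteq> signs n"
  shows "prob {\<omega> \<in> space M. Q (path n \<omega>)} = (\<Sum>l\<in>C. path_prob l)"
proof -
  have fin: "finite C" using assms(2) finite_signs by (rule finite_subset)
  have "prob {\<omega> \<in> space M. Q (path n \<omega>)} = prob (\<Union>l\<in>C. {\<omega> \<in> space M. path (length l) \<omega> = l})"
  proof (rule finite_measure_eq_AE)
    show "AE \<omega> in M. (\<omega> \<in> {\<omega> \<in> space M. Q (path n \<omega>)}) = (\<omega> \<in> (\<Union>l\<in>C. {\<omega> \<in> space M. path (length l) \<omega> = l}))"
      using AE_path[of n]
    proof eventually_elim
      case (elim \<omega>)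
      then have "path n \<omega> \<in> signs n" by (simp add: signs_def)
      then have *: "Q (path n \<omega>) \<longleftrightarrow> path n \<omega> \<in> C" by (rule assms(1))
      have len: "length l = n" if "l \<in> C" for l using that assms(2) by (auto simp: signs_def)
      have "path n \<omega> \<in> C \<longleftrightarrow> (\<exists>l\<in>C. path (length l) \<omega> = l)"
        using len by (metis length_path)
      then show ?case using * by blast
    qed
    have "{\<omega> \<in> space M. Q (path n \<omega>)} = path n -` {l. Q l} \<inter> space M" by auto
    then show "{\<omega> \<in> space M. Q (path n \<omega>)} \<in> sets M"
      using measurable_sets[OF path_measurable, of "{l. Q l}"] by simp
    show "(\<Union>l\<in>C. {\<omega> \<in> space M. path (length l) \<omega> = l}) \<in> sets M"
      by (intro sets.finite_UN fin) measurable
  qed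
  also have "\<dots> = (\<Sum>l\<in>C. path_prob l)"
    unfolding path_prob_def
  proof (rule finite_measure_finite_Union[OF fin])
    show "(\<lambda>l. {\<omega> \<in> space M. path (length l) \<omega> = l}) ` C \<subseteq> sets M" by auto
    have "length l = n" if "l \<in> C" for l using that assms(2) by (auto simp: signs_def)
    then show "disjoint_family_on (\<lambda>l. {\<omega> \<in> space M. path (length l) \<omega> = l}) C"
      by (auto simp: disjoint_family_on_def)
  qed
  finally show ?thesis .
qed

lemma take_path: "m \<le> n \<Longrightarrow> take m (path n \<omega>) = path m \<omega>"
  by (intro nth_equalityI) (auto simp: nth_path)

lemma prob_zero:
  "prob {\<omega> \<in> space M. erw_position X k \<omega> = 0} = (\<Sum>l\<in>signs k. path_prob l * of_bool (sum_list l = 0))"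
proof -
  have "prob {\<omega> \<in> space M. sum_list (path k \<omega>) = 0} = (\<Sum>l\<in>{l\<in>signs k. sum_list l = 0}. path_prob l)"
    by (rule prob_path_in) auto
  also have "\<dots> = (\<Sum>l\<in>signs k. if sum_list l = 0 then path_prob l else 0)"
    by (rule sum.inter_filter) simp
  also have "\<dots> = (\<Sum>l\<in>signs k. path_prob l * of_bool (sum_list l = 0))"
    by (rule sum.cong) auto
  finally show ?thesis by (simp add: sum_list_path)
qed

lemma prob_zero_then_avoid:
  "prob {\<omega> \<in> space M. erw_position X k \<omega> = 0 \<and> (\<forall>i\<in>{1..n}. erw_position X (k + i) \<omega> \<noteq> 0)}
    = prob {\<omega> \<in> space M. erw_position X k \<omega> = 0} * surv (2 * p - 1) n k (\<lambda>_. 1) 0"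
proof -
  have "{\<omega> \<in> space M. erw_position X k \<omega> = 0 \<and> (\<forall>i\<in>{1..n}. erw_position X (k + i) \<omega> \<noteq> 0)}
      = {\<omega> \<in> space M. avoids k n (path (k + n) \<omega>)}"
    by (auto simp: avoids_def take_path sum_list_path)
  also have "prob \<dots> = (\<Sum>l\<in>{l\<in>signs (k + n). avoids k n l}. path_prob l)"
    by (rule prob_path_in) auto
  also have "\<dots> = (\<Sum>l\<in>signs (k + n). if avoids k n l then path_prob l else 0)"
    by (rule sum.inter_filter) simp
  also have "\<dots> = (\<Sum>l\<in>signs (k + n). path_prob l * (of_bool (avoids k n l) * 1))"
    by (rule sum.cong) auto
  finally show ?thesis unfolding sum_avoids_eq_surv[where f="\<lambda>_. 1"] prob_zero .
qed

text \<open>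
  An alternating path \<open>1, -1, 1, -1, \<dots>\<close> returns to \<open>0\<close> at every even time. It has positive probability
  because the step back to \<open>0\<close> has probability \<open>(1 - q / m) / 2\<close> with \<open>q < 1\<close>.
\<close>

lemma prob_zero_pos:
  assumes "even k" "\<bar>2 * p - 1\<bar> \<le> 1" "p < 1"
  shows "0 < prob {\<omega> \<in> space M. erw_position X k \<omega> = 0}"
proof -
  have "\<exists>l\<in>signs (2 * m). sum_list l = 0 \<and> 0 < path_prob l" for m
  proof (induction m)
    case 0
    show ?case by (intro bexI[of _ "[]"]) (auto simp: signs_def)
  next
    case (Suc m)
    then obtain l where l: "l \<in> signs (2 * m)" "sum_list l = 0" "0 < path_prob l" by blast
    have l1: "l @ [1] \<in> signs (Suc (2 * m))" using l by (simp add: signs_def)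
    have 1: "path_prob (l @ [1]) = path_prob l / 2" using path_prob_snoc[OF l(1), of 1] l by simp
    have 2: "path_prob ((l @ [1]) @ [-1]) = path_prob (l @ [1]) * ((1 - (2 * p - 1) / real (Suc (2 * m))) / 2)"
      using path_prob_snoc[OF l1, of "-1"] l by simp
    have "(2 * p - 1) / real (Suc (2 * m)) < 1"
      using assms(3) by (simp add: divide_less_eq)
    then have "0 < path_prob ((l @ [1]) @ [-1])" unfolding 2 1 using l by simp
    then show ?case using l by (intro bexI[of _ "(l @ [1]) @ [-1]"]) (auto simp: signs_def)
  qed
  then obtain l where l: "l \<in> signs k" "sum_list l = 0" "0 < path_prob l"
    using assms(1) by (auto elim!: evenE)
  then have "0 < path_prob l * of_bool (sum_list l = 0)" by simp
  also have "\<dots> \<le> (\<Sum>l\<in>signs k. path_prob l * of_bool (sum_list l = 0))"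
    using l(1) by (intro member_le_sum) (auto simp: path_prob_def)
  finally show ?thesis by (simp add: prob_zero)
qed

lemma return_time_greater_iff: "enat n < return_time k s \<longleftrightarrow> (\<forall>i\<in>{1..n}. s (k + i) \<noteq> 0)"
proof
  assume "enat n < return_time k s"
  show "\<forall>i\<in>{1..n}. s (k + i) \<noteq> 0"
  proof (intro ballI notI)
    fix i assume "i \<in> {1..n}" "s (k + i) = 0"
    then have "return_time k s \<le> enat i"
      unfolding return_time_def by (intro Inf_lower) (auto simp: add.commute)
    also have "\<dots> \<le> enat n" using \<open>i \<in> {1..n}\<close> by simp
    finally show False using \<open>enat n < return_time k s\<close> by simp
  qed
next
  assume *: "\<forall>i\<in>{1..n}. s (k + i) \<noteq> 0"
  have "enat (Suc n) \<le> return_time k s"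
    unfolding return_time_def
  proof (rule Inf_greatest)
    fix x assume "x \<in> enat ` {n. 1 \<le> n \<and> s (n + k) = 0}"
    then obtain i where "x = enat i" "1 \<le> i" "s (k + i) = 0" by (auto simp: add.commute)
    then show "enat (Suc n) \<le> x" using * by (auto simp: not_less_eq_eq[symmetric])
  qed
  then show "enat n < return_time k s" by (simp add: Suc_ile_eq)
qed

lemma position_measurable [measurable]: "erw_position X n \<in> measurable M (count_space UNIV)"
proof -
  have "(\<lambda>\<omega>. sum_list (path n \<omega>)) \<in> measurable M (count_space UNIV)"
    by (rule measurable_compose[OF path_measurable]) simp
  then show ?thesis by (simp add: sum_list_path)
qed

theorem cond_law_return_time:
  assumes "0 < prob {\<omega> \<in> space M. erw_position X k \<omega> = 0}"
  shows "measure (erw_cond_law M X k) {s \<in> space (erw_cond_law M X k). return_time k s > enat n}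
    = surv (2 * p - 1) n k (\<lambda>_. 1) 0"
proof -
  let ?Z = "{\<omega> \<in> space M. erw_position X k \<omega> = 0}"
  let ?\<mu> = "uniform_measure M ?Z"
  let ?N = "PiM {k..} (\<lambda>_. count_space (UNIV :: int set))"
  let ?F = "\<lambda>\<omega>. \<lambda>n\<in>{k..}. erw_position X n \<omega>"
  have F: "?F \<in> measurable ?\<mu> ?N" by (intro measurable_restrict) simp
  have "{s \<in> space (erw_cond_law M X k). return_time k s > enat n} = {s \<in> space ?N. \<forall>i\<in>{1..n}. s (k + i) \<noteq> 0}"
    by (auto simp: return_time_greater_iff erw_cond_law_def)
  moreover have S: "{s \<in> space ?N. \<forall>i\<in>{1..n}. s (k + i) \<noteq> 0} \<in> sets ?N"
  proof -
    have "{s \<in> space ?N. s (k + i) \<noteq> 0} \<in> sets ?N" for i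
      using measurable_sets[OF measurable_component_singleton[of "k + i" "{k..}" "\<lambda>_. count_space (UNIV :: int set)"], of "UNIV - {0}"]
      by (simp add: vimage_def Int_def conj_commute)
    then show ?thesis by (intro sets.sets_Collect_finite_All) auto
  qed
  ultimately have "measure (erw_cond_law M X k) {s \<in> space (erw_cond_law M X k). return_time k s > enat n}
     = measure ?\<mu> (?F -` {s \<in> space ?N. \<forall>i\<in>{1..n}. s (k + i) \<noteq> 0} \<inter> space M)"
    unfolding erw_cond_law_def by (simp add: measure_distr[OF F])
  also have "?F -` {s \<in> space ?N. \<forall>i\<in>{1..n}. s (k + i) \<noteq> 0} \<inter> space M
     = {\<omega> \<in> space M. \<forall>i\<in>{1..n}. erw_position X (k + i) \<omega> \<noteq> 0}"
    by (auto simp: space_PiM)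
  also have "measure ?\<mu> \<dots> = prob (?Z \<inter> {\<omega> \<in> space M. \<forall>i\<in>{1..n}. erw_position X (k + i) \<omega> \<noteq> 0}) / prob ?Z"
  proof (rule measure_uniform_measure)
    show "emeasure M ?Z \<noteq> 0" using assms by (simp add: emeasure_eq_measure)
  qed auto
  also have "?Z \<inter> {\<omega> \<in> space M. \<forall>i\<in>{1..n}. erw_position X (k + i) \<omega> \<noteq> 0}
     = {\<omega> \<in> space M. erw_position X k \<omega> = 0 \<and> (\<forall>i\<in>{1..n}. erw_position X (k + i) \<omega> \<noteq> 0)}" by auto
  also have "prob \<dots> / prob ?Z = surv (2 * p - 1) n k (\<lambda>_. 1) 0"
    unfolding prob_zero_then_avoid using assms by simp
  finally show ?thesis .
qed

end

section \<open>The scaling factors\<close>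

text \<open>
  Gamma ratios behave like powers. The limit comes from Euler's product for \<open>Gamma z\<close> with
  \<open>z = q + 2\<close>: the shift by \<open>2\<close> keeps the argument positive also for \<open>q = -1\<close>.
\<close>

lemma Gamma_ratio_bounds:
  fixes q :: real and n0 :: nat
  assumes q: "-1 \<le> q" and n0: "1 \<le> n0" "0 < real n0 + q"
  obtains c C where "0 < c" 
    "\<And>n. n0 \<le> n \<Longrightarrow> c * real n powr - q \<le> Gamma (real n) / Gamma (real n + q)"
    "\<And>n. n0 \<le> n \<Longrightarrow> Gamma (real n) / Gamma (real n + q) \<le> C * real n powr - q"
proof -
  define z where "z = q + 2"
  have z: "0 < z" using q by (simp add: z_def)
  then have Gz: "Gamma z > 0" by (rule Gamma_real_pos)
  define f where "f n = Gamma (real n) / Gamma (real n + q) * real n powr q" for n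
  \<comment> \<open>index \<open>n + 3\<close>, since \<open>Gamma_series z n\<close> involves \<open>Gamma (z + n + 1)\<close> and \<open>z + n + 1 = (n + 3) + q\<close>\<close>
  have shift: "f (n + 3) = Gamma_series z n / Gamma z *
     (((real n + 1) / real n) * ((real n + 2) / real n) * ((real n + 3) / real n) powr q)" if n: "1 \<le> n" for n
  proof -
    have "pochhammer z (n + 1) = Gamma (z + real (n + 1)) / Gamma z"
      using z by (intro pochhammer_Gamma) auto
    then have "Gamma_series z n = fact n * exp (z * ln (real n)) * Gamma z / Gamma (z + real (n + 1))"
      unfolding Gamma_series_def by simp
    then have gs: "Gamma_series z n / Gamma z = fact n * real n powr z / Gamma (z + real (n + 1))"
      using Gz n by (simp add: powr_def mult.commute)
    have "Gamma (real (n + 3)) = fact (n + 2)" using Gamma_fact[of "n + 2", where 'a = real] by (simp add: add.commute)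
    also have "\<dots> = (real n + 2) * (real n + 1) * fact n" by (simp add: numeral_2_eq_2 algebra_simps)
    finally have G: "Gamma (real (n + 3)) = (real n + 2) * (real n + 1) * fact n" .
    have arg: "real (n + 3) + q = z + real (n + 1)" by (simp add: z_def)
    have p1: "((real n + 3) / real n) powr q = (real n + 3) powr q / real n powr q"
      using n by (simp add: powr_divide)
    have p2: "real n powr z = real n powr q * (real n * real n)"
      using n by (simp add: z_def powr_add power2_eq_square)
    have alg: "(N + 2) * (N + 1) * F / D * R = F * (P * (N * N)) / D * ((N + 1) / N * ((N + 2) / N) * (R / P))"
      if "0 < N" "0 < P" for N F D R P :: real
    proof -
      have "P * (N * N) * ((N + 1) / N * ((N + 2) / N) * (R / P)) = (N + 2) * (N + 1) * R"
        using that by simp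
      moreover have "F * (P * (N * N)) / D * Y = F / D * (P * (N * N) * Y)" for Y by simp
      ultimately show ?thesis using that by (simp add: mult_ac)
    qed
    have "real (n + 3) = real n + 3" by simp
    with alg[of "real n" "real n powr q"] n show ?thesis
      unfolding f_def arg G gs p1 p2 by simp
  qed
  have "(\<lambda>n. Gamma_series z n / Gamma z *
     (((real n + 1) / real n) * ((real n + 2) / real n) * ((real n + 3) / real n) powr q)) \<longlonglongrightarrow>
     Gamma z / Gamma z * ((1 * 1) * 1 powr q)"
  proof (intro tendsto_intros)
    show "(\<lambda>n. (real n + 1) / real n) \<longlonglongrightarrow> 1" "(\<lambda>n. (real n + 2) / real n) \<longlonglongrightarrow> 1"
      "(\<lambda>n. (real n + 3) / real n) \<longlonglongrightarrow> 1"
      by real_asymp+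
  qed (use Gz in auto)
  then have "(\<lambda>n. f (n + 3)) \<longlonglongrightarrow> 1"
    using Gz by (intro Lim_transform_eventually[OF _ eventually_mono[OF eventually_ge_at_top[of 1] shift[symmetric]]]) auto
  then have lim: "f \<longlonglongrightarrow> 1" by (rule LIMSEQ_offset)
  have f_pos: "0 < f n" if "n0 \<le> n" for n
    using that n0 unfolding f_def by (intro mult_pos_pos divide_pos_pos Gamma_real_pos) auto
  have "\<forall>\<^sub>F n in sequentially. 1 / 2 < f n"
    by (rule order_tendstoD(1)[OF lim]) simp
  then obtain m where m: "\<And>n. m \<le> n \<Longrightarrow> 1 / 2 < f n" by (auto simp: eventually_sequentially)
  define c where "c = Min (insert (1 / 2) (f ` {n0..m}))"
  have c0: "0 < c" unfolding c_def using f_pos by (subst Min_gr_iff) auto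
  have c: "c \<le> f n" if "n0 \<le> n" for n
  proof (cases "n \<le> m")
    case True
    then show ?thesis unfolding c_def using that by (intro Min_le) auto
  next
    case False
    have "c \<le> 1 / 2" unfolding c_def by (intro Min_le) auto
    then show ?thesis using m[of n] False by simp
  qed
  have "Bseq f" using lim by (intro convergent_imp_Bseq convergentI)
  then obtain C where C: "\<And>n. norm (f n) \<le> C" by (auto simp: Bseq_def)
  have *: "Gamma (real n) / Gamma (real n + q) = f n * real n powr - q" if "n0 \<le> n" for n
    using that n0 by (simp add: f_def powr_minus field_simps)
  show ?thesis
  proof (rule that[OF c0])
    fix n assume n: "n0 \<le> n"
    show "c * real n powr - q \<le> Gamma (real n) / Gamma (real n + q)"
      unfolding *[OF n] by (intro mult_right_mono c n) simp
    show "Gamma (real n) / Gamma (real n + q) \<le> C * real n powr - q"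
      unfolding *[OF n] using C[of n] by (intro mult_right_mono) auto
  qed
qed

text \<open>
  Uniformly in \<open>k\<close>, a sum of \<open>n\<close> consecutive powers is much larger than its largest term. For \<open>\<beta> \<ge> 0\<close> the
  upper half of the terms are comparable to the last one. For \<open>\<beta> < 0\<close> every term is at least
  \<open>n powr \<beta>\<close> times the first one, as \<open>i \<le> n * j\<close> for \<open>i \<le> k + n\<close> and \<open>j > k\<close>; this is where
  \<open>\<beta> > -1\<close> is needed.
\<close>

lemma power_sum_dominates:
  fixes \<beta> :: real
  assumes \<beta>: "-1 < \<beta>" "\<beta> \<le> 2"
  shows "\<exists>g. filterlim g at_top sequentially \<and>
    (\<forall>n k j. 1 \<le> n \<longrightarrow> k < j \<longrightarrow> j \<le> k + n \<longrightarrow> g n * real j powr \<beta> \<le> (\<Sum>i=Suc k..k + n. real i powr \<beta>))"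
proof (cases "0 \<le> \<beta>")
  case True
  have "real n / 8 * real j powr \<beta> \<le> (\<Sum>i=Suc k..k + n. real i powr \<beta>)"
    if n: "1 \<le> n" and j: "k < j" "j \<le> k + n" for n k j :: nat
  proof -
    have "real n / 8 * real j powr \<beta> \<le> real (card {k + n - n div 2..k + n}) * (real j powr \<beta> / 4)"
    proof -
      have "n \<le> 2 * (n div 2) + 1" by simp
      then have "real n / 2 \<le> real (card {k + n - n div 2..k + n})" by simp
      then have "real n / 2 * (real j powr \<beta> / 4) \<le> real (card {k + n - n div 2..k + n}) * (real j powr \<beta> / 4)"
        by (intro mult_right_mono) auto
      then show ?thesis by simp
    qed
    also have "\<dots> = (\<Sum>i=k + n - n div 2..k + n. real j powr \<beta> / 4)" by simp
    also have "\<dots> \<le> (\<Sum>i=k + n - n div 2..k + n. real i powr \<beta>)"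
    proof (rule sum_mono)
      fix i assume i: "i \<in> {k + n - n div 2..k + n}"
      then have "j \<le> 2 * i" using j by auto
      have i0: "0 < real i" using i n by auto
      have "(1 / 2 :: real) powr 2 \<le> (1 / 2) powr \<beta>" using \<beta> by (intro powr_mono') auto
      then have "1 / 4 \<le> (1 / 2 :: real) powr \<beta>" by (simp add: power2_eq_square)
      then have "real j powr \<beta> * (1 / 4) \<le> real j powr \<beta> * (1 / 2) powr \<beta>" by (intro mult_left_mono) auto
      also have "\<dots> = (real j / 2) powr \<beta>" by (simp add: powr_mult[symmetric])
      also have "\<dots> \<le> real i powr \<beta>" using \<open>j \<le> 2 * i\<close> True by (intro powr_mono2) auto
      finally show "real j powr \<beta> / 4 \<le> real i powr \<beta>" by simp
    qed
    also have "\<dots> \<le> (\<Sum>i=Suc k..k + n. real i powr \<beta>)"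
      using n by (intro sum_mono2) auto
    finally show ?thesis .
  qed
  moreover have "filterlim (\<lambda>n. real n / 8) at_top sequentially" by real_asymp
  ultimately show ?thesis by blast
next
  case False
  have "real n powr (1 + \<beta>) * real j powr \<beta> \<le> (\<Sum>i=Suc k..k + n. real i powr \<beta>)"
    if n: "1 \<le> n" and j: "k < j" "j \<le> k + n" for n k j :: nat
  proof -
    have "real n powr (1 + \<beta>) * real j powr \<beta> = (\<Sum>i=Suc k..k + n. real n powr \<beta> * real j powr \<beta>)"
      using n by (simp add: powr_add)
    also have "\<dots> \<le> (\<Sum>i=Suc k..k + n. real i powr \<beta>)"
    proof (rule sum_mono)
      fix i assume i: "i \<in> {Suc k..k + n}"
      have "k + n \<le> n * Suc k" using n mult_le_mono1[of 1 n k] by simp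
      also have "\<dots> \<le> n * j" using j by (intro mult_le_mono2) simp
      finally have "i \<le> n * j" using i by simp
      then have "real i \<le> real n * real j" by (simp flip: of_nat_mult)
      then have "(real n * real j) powr \<beta> \<le> real i powr \<beta>"
        using False i by (intro powr_mono2') auto
      then show "real n powr \<beta> * real j powr \<beta> \<le> real i powr \<beta>" by (simp add: powr_mult)
    qed
    finally show ?thesis .
  qed
  moreover have "filterlim (\<lambda>n. real n powr (1 + \<beta>)) at_top sequentially"
    using \<beta> by real_asymp
  ultimately show ?thesis by blast
qed

text \<open>
  Since \<open>a (m + 1) = a m * m / (m + q)\<close>, the growth constant must bound \<open>m / (m + q)\<close>. This is at most
  \<open>1 / (2 p)\<close> or \<open>1\<close> for \<open>p > 0\<close>, and at most \<open>2\<close> for \<open>p = 0\<close> and \<open>m \<ge> 2\<close>.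
\<close>

lemma erw_walk_scaling:
  assumes p: "0 \<le> p" "p < 3 / 4" and k: "p = 0 \<longrightarrow> 2 \<le> k"
  shows "walk_scaling (2 * p - 1) (erw_a p) k (max 2 (1 / (2 * p)))"
proof
  show "\<bar>2 * p - 1\<bar> \<le> 1" using p by auto
  show "1 \<le> max 2 (1 / (2 * p))" by simp
  fix m assume m: "k < m"
  define x where "x = real m + (2 * p - 1)"
  have x: "0 < x" using m k p by (cases "p = 0") (auto simp: x_def)
  have am: "erw_a p m = Gamma (real m) / Gamma x"
  proof -
    have "m \<noteq> 0" "\<not> (m = 1 \<and> p = 0)" using m k by auto
    then show ?thesis by (simp add: erw_a_def x_def add_diff_eq)
  qed
  have "erw_a p (Suc m) = Gamma (real m + 1) / Gamma (x + 1)"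
    using m k by (simp add: erw_a_def x_def algebra_simps)
  also have "Gamma (real m + 1) = real m * Gamma (real m)" using m by (intro Gamma_plus1) auto
  also have "Gamma (x + 1) = x * Gamma x" using x by (intro Gamma_plus1) auto
  finally have aS: "erw_a p (Suc m) = real m / x * erw_a p m" by (simp add: am)
  show pos: "0 < erw_a p m" unfolding am using x m by (intro divide_pos_pos Gamma_real_pos) auto
  show "erw_a p (Suc m) * (1 + (2 * p - 1) / real m) = erw_a p m"
  proof -
    have "1 + (2 * p - 1) / real m = x / real m" using m by (simp add: x_def field_simps)
    then show ?thesis unfolding aS using x m by simp
  qed
  have "real m / x \<le> max 2 (1 / (2 * p))"
  proof (cases "p = 0")
    case True
    then show ?thesis using m k by (simp add: x_def divide_le_eq)
  next
    case False
    then have "0 < 2 * p" using p by simp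
    have "2 * p * real m \<le> x \<or> real m \<le> x"
    proof (cases "2 * p \<le> 1")
      case True
      have "0 \<le> (1 - 2 * p) * (real m - 1)" using True m by (intro mult_nonneg_nonneg) auto
      then show ?thesis by (simp add: x_def algebra_simps)
    qed (simp add: x_def)
    then have "real m / x \<le> 1 / (2 * p) \<or> real m / x \<le> 1"
      using x \<open>0 < 2 * p\<close> by (auto simp: divide_le_eq le_divide_eq mult_ac)
    then show ?thesis by auto
  qed
  then show "erw_a p (Suc m) \<le> max 2 (1 / (2 * p)) * erw_a p m"
    unfolding aS using pos by (intro mult_right_mono) auto
qed

lemma walk_scaling_A_erw:
  assumes "walk_scaling q (erw_a p) k K"
  shows "walk_scaling.A (erw_a p) n = erw_A p n"
  by (simp add: walk_scaling.A_def[OF assms] erw_A_def)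

lemma erw_A_diff: "erw_A p (k + n) - erw_A p k = (\<Sum>i=Suc k..k + n. (erw_a p i)\<^sup>2)"
  by (induction n) (auto simp: erw_A_def)

lemma erw_a_negligible:
  assumes p: "0 \<le> p" "p < 3 / 4" and \<eta>: "0 < \<eta>"
  shows "\<exists>n0. \<forall>n\<ge>n0. \<forall>k. (p = 0 \<longrightarrow> 2 \<le> k) \<longrightarrow> (\<forall>j. k < j \<and> j \<le> k + n \<longrightarrow>
    (erw_a p j)\<^sup>2 \<le> \<eta> * (erw_A p (k + n) - erw_A p k))"
proof -
  define q where "q = 2 * p - 1"
  define m0 :: nat where "m0 = (if p = 0 then 2 else 1)"
  have q: "-1 \<le> q" "q < 1 / 2" and m0: "1 \<le> m0" "0 < real m0 + q"
    using p by (auto simp: q_def m0_def)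
  obtain c C where c: "0 < c"
    and lo: "\<And>n. m0 \<le> n \<Longrightarrow> c * real n powr - q \<le> Gamma (real n) / Gamma (real n + q)"
    and up: "\<And>n. m0 \<le> n \<Longrightarrow> Gamma (real n) / Gamma (real n + q) \<le> C * real n powr - q"
    using Gamma_ratio_bounds[OF q(1) m0] by blast
  have a: "erw_a p n = Gamma (real n) / Gamma (real n + q)" "0 \<le> erw_a p n" if "m0 \<le> n" for n
  proof -
    show e: "erw_a p n = Gamma (real n) / Gamma (real n + q)"
      using that m0 by (auto simp: erw_a_def q_def m0_def algebra_simps split: if_splits)
    show "0 \<le> erw_a p n" unfolding e using that m0 by (intro divide_nonneg_pos less_imp_le Gamma_real_pos) auto
  qed
  have sq: "(x powr - q)\<^sup>2 = x powr (- 2 * q)" for x :: real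
    by (simp add: power2_eq_square powr_add[symmetric])
  obtain g where g: "filterlim g at_top sequentially"
    and dom: "\<And>n k j. 1 \<le> n \<Longrightarrow> k < j \<Longrightarrow> j \<le> k + n \<Longrightarrow>
      g n * real j powr (- 2 * q) \<le> (\<Sum>i=Suc k..k + n. real i powr (- 2 * q))"
    using power_sum_dominates[of "- 2 * q"] q by auto
  have "\<forall>\<^sub>F n in sequentially. C\<^sup>2 / (\<eta> * c\<^sup>2) \<le> g n"
    using g by (rule filterlim_at_top[THEN iffD1, rule_format])
  then obtain n1 where n1: "\<And>n. n1 \<le> n \<Longrightarrow> C\<^sup>2 / (\<eta> * c\<^sup>2) \<le> g n"
    by (auto simp: eventually_sequentially)
  show ?thesis
  proof (intro exI[of _ "max 1 n1"] allI impI)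
    fix n k j assume n: "max 1 n1 \<le> n" and k: "p = 0 \<longrightarrow> 2 \<le> k" and j: "k < j \<and> j \<le> k + n"
    have ge: "m0 \<le> i" if "k < i" for i using that k by (auto simp: m0_def)
    have "(erw_a p j)\<^sup>2 \<le> (C * real j powr - q)\<^sup>2"
      using up[of j] a[of j] ge[of j] j by (intro power_mono) auto
    also have "\<dots> = C\<^sup>2 * real j powr (- 2 * q)" by (simp only: power_mult_distrib sq)
    also have "C\<^sup>2 \<le> \<eta> * c\<^sup>2 * g n"
      using n1[of n] n \<eta> c by (simp add: divide_le_eq mult_ac)
    then have "C\<^sup>2 * real j powr (- 2 * q) \<le> \<eta> * c\<^sup>2 * g n * real j powr (- 2 * q)"
      by (intro mult_right_mono) auto
    also have "\<dots> = \<eta> * c\<^sup>2 * (g n * real j powr (- 2 * q))" by (simp only: mult.assoc)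
    also have "\<dots> \<le> \<eta> * c\<^sup>2 * (\<Sum>i=Suc k..k + n. real i powr (- 2 * q))"
      using \<eta> n j by (intro mult_left_mono dom) auto
    also have "\<dots> = \<eta> * (\<Sum>i=Suc k..k + n. c\<^sup>2 * real i powr (- 2 * q))"
      by (simp only: sum_distrib_left mult.assoc)
    also have "\<dots> \<le> \<eta> * (\<Sum>i=Suc k..k + n. (erw_a p i)\<^sup>2)"
    proof (intro mult_left_mono sum_mono)
      fix i assume i: "i \<in> {Suc k..k + n}"
      have "c\<^sup>2 * real i powr (- 2 * q) = (c * real i powr - q)\<^sup>2" by (simp only: power_mult_distrib sq)
      also have "\<dots> \<le> (erw_a p i)\<^sup>2"
        using lo[of i] a[of i] ge[of i] i c by (intro power_mono) auto
      finally show "c\<^sup>2 * real i powr (- 2 * q) \<le> (erw_a p i)\<^sup>2" .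
    qed (use \<eta> in auto)
    finally show "(erw_a p j)\<^sup>2 \<le> \<eta> * (erw_A p (k + n) - erw_A p k)"
      unfolding erw_A_diff .
  qed
qed

section \<open>Uniform asymptotics of the return time\<close>

text \<open>
  The starting times \<open>k\<close> with \<open>k \<ge> 2\<close> in case \<open>p = 0\<close> form a family to which \<open>scaled_noreturn_limit\<close>
  applies; for even \<open>k\<close> the conditioning event has positive probability.
\<close>

theorem theorem4p1:
  fixes M :: "'a measure" and p b :: real
    and X :: "nat \<Rightarrow> 'a \<Rightarrow> int" and u :: "nat \<Rightarrow> 'a \<Rightarrow> nat" and \<epsilon> :: "nat \<Rightarrow> 'a \<Rightarrow> int"
  assumes "elephant_random_walk M p X u \<epsilon>"
    and "0 \<le> p" and "p < 3 / 4" and "b > 0"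
  shows "\<forall>\<delta>>0. \<exists>N. \<forall>n\<ge>N. \<forall>k. even k \<and> real k \<le> b * real n \<and> (p = 0 \<longrightarrow> k \<ge> 2) \<longrightarrow>
           \<bar>sqrt (erw_A p (n + k) - erw_A p k) / erw_a p (k + 1)
              * measure (erw_cond_law M X k)
                  {s \<in> space (erw_cond_law M X k). return_time k s > enat n}
            - sqrt (2 / pi)\<bar> < \<delta>"
proof (intro allI impI)
  fix \<delta> :: real assume \<delta>: "0 < \<delta>"
  interpret elephant_random_walk M p X u \<epsilon> by fact
  let ?Z = "\<lambda>k. p = 0 \<longrightarrow> 2 \<le> k" and ?q = "2 * p - 1"
  have scaling: "walk_scaling ?q (erw_a p) k (max 2 (1 / (2 * p)))" if "?Z k" for k
    by (rule erw_walk_scaling[OF assms(2,3) that])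
  interpret walk_scaling_family ?q "erw_a p" "max 2 (1 / (2 * p))" ?Z
  proof (rule walk_scaling_family.intro)
    show "walk_scaling ?q (erw_a p) k (max 2 (1 / (2 * p)))" if "?Z k" for k
      by (rule scaling[OF that])
    show "\<exists>n0. \<forall>n\<ge>n0. \<forall>k. ?Z k \<longrightarrow> (\<forall>j. k < j \<and> j \<le> k + n \<longrightarrow> (erw_a p j)\<^sup>2
        \<le> \<eta> * (walk_scaling.A (erw_a p) (k + n) - walk_scaling.A (erw_a p) k))" if "0 < \<eta>" for \<eta>
      unfolding walk_scaling_A_erw[OF scaling[of 2, simplified]]
      by (rule erw_a_negligible[OF assms(2,3) that])
  qed
  obtain n0 where n0: "\<And>n k. n0 \<le> n \<Longrightarrow> ?Z k \<Longrightarrow> \<bar>Q k n - sqrt (2 / pi)\<bar> < \<delta>"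
    using scaled_noreturn_limit[OF \<delta>] by blast
  show "\<exists>N. \<forall>n\<ge>N. \<forall>k. even k \<and> real k \<le> b * real n \<and> (p = 0 \<longrightarrow> k \<ge> 2) \<longrightarrow>
           \<bar>sqrt (erw_A p (n + k) - erw_A p k) / erw_a p (k + 1)
              * measure (erw_cond_law M X k)
                  {s \<in> space (erw_cond_law M X k). return_time k s > enat n}
            - sqrt (2 / pi)\<bar> < \<delta>"
  proof (intro exI[of _ n0] allI impI)
    fix n k assume n: "n0 \<le> n" and k: "even k \<and> real k \<le> b * real n \<and> (p = 0 \<longrightarrow> 2 \<le> k)"
    have Zk: "?Z k" using k by blast
    have "0 < prob {\<omega> \<in> space M. erw_position X k \<omega> = 0}"
      using k assms(2,3) by (intro prob_zero_pos) auto
    then have "measure (erw_cond_law M X k) {s \<in> space (erw_cond_law M X k). return_time k s > enat n}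
        = walk_scaling.noreturn ?q k n"
      by (simp add: cond_law_return_time walk_scaling.noreturn_def[OF scaling[OF Zk]])
    then show "\<bar>sqrt (erw_A p (n + k) - erw_A p k) / erw_a p (k + 1)
              * measure (erw_cond_law M X k)
                  {s \<in> space (erw_cond_law M X k). return_time k s > enat n}
            - sqrt (2 / pi)\<bar> < \<delta>"
      using n0[OF n Zk]
      by (simp add: walk_scaling.scaled_noreturn_def[OF scaling[OF Zk]]
            walk_scaling_A_erw[OF scaling[OF Zk]] add.commute)
  qed
qed

end
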